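(* The decision problem Robust-Coloring restricted to $k=2$ is NP-complete. Here Robust-Coloring is: given a graph $G$, a subgraph $H$ of $\overline{G}$, a positive integer $k\leq|V(G)|$ and a nonnegative integer $\overline{m}$, decide whether there exists a $k$-coloring of $G$ such that the number of monochromatic edges of $H$ is at most $\overline{m}$.
   Context: All graphs are finite, simple and unweighted; $\overline{G}$ denotes the complement of $G$. A $k$-coloring of $G$ is a map $\phi:V(G)\to\{1,\dots,k\}$ with $\phi(u)\neq\phi(v)$ for every edge $uv$ of $G$. An edge $uv$ of $H$ is monochromatic under $\phi$ if $\phi(u)=\phi(v)$. *)

theory Defs
  imports "HOL-Computational_Algebra.Polynomial"
begin

section \<open>Deterministic multi-tape Turing machines\<close>

text \<open>
  Symbol \<open>0\<close> is the blank, \<open>1\<close> and \<open>2\<close> stand for the bits \<open>False\<close> and \<open>True\<close>.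
  The working states are \<open>{0..<states M}\<close> with initial state \<open>0\<close>; the additional state
  \<open>states M\<close> is the halting state. Tapes are infinite in both directions; a tape is given by
  its contents and the position of its head.
\<close>

datatype dir = Left | Stay | Right

type_synonym tape = "(int \<Rightarrow> nat) \<times> int"

type_synonym config = "nat \<times> tape list"

record tm =
  tapes :: nat
  states :: nat
  symbols :: nat
  delta :: "nat \<Rightarrow> nat list \<Rightarrow> nat \<times> (nat \<times> dir) list"

text \<open>The conditions on \<open>delta M\<close> concern only its values on a finite domain; by \<open>step\<close> below
  its values elsewhere are never used in a computation.\<close>

definition turing_machine :: "tm \<Rightarrow> bool" where
  "turing_machine M \<longleftrightarrow>
     3 \<le> symbols M \<and>
     (\<forall>q < states M. \<forall>as. length as = tapes M \<and> set as \<subseteq> {..<symbols M} \<longrightarrow>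
        fst (delta M q as) \<le> states M \<and>
        length (snd (delta M q as)) = tapes M \<and>
        fst ` set (snd (delta M q as)) \<subseteq> {..<symbols M})"

fun offset :: "dir \<Rightarrow> int" where
  "offset Left = -1"
| "offset Stay = 0"
| "offset Right = 1"

definition read :: "tape \<Rightarrow> nat" where
  "read tp = fst tp (snd tp)"

definition act :: "nat \<times> dir \<Rightarrow> tape \<Rightarrow> tape" where
  "act a tp = ((fst tp)(snd tp := fst a), snd tp + offset (snd a))"

definition step :: "tm \<Rightarrow> config \<Rightarrow> config" where
  "step M c =
     (if fst c = states M then c
      else let r = delta M (fst c) (map read (snd c)) in (fst r, map2 act (snd r) (snd c)))"

definition contents :: "bool list \<Rightarrow> int \<Rightarrow> nat" where
  "contents w i = (if 0 \<le> i \<and> i < int (length w) then if w ! nat i then 2 else 1 else 0)"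

definition initial :: "tm \<Rightarrow> bool list list \<Rightarrow> config" where
  "initial M ws =
     (0, map (\<lambda>i. (contents (if i < length ws then ws ! i else []), 0)) [0..<tapes M])"

text \<open>The arguments are on the first tapes, one argument per tape; the result is on the last
  tape, which is not an input tape.\<close>

definition computes_within :: "tm \<Rightarrow> bool list list \<Rightarrow> bool list \<Rightarrow> nat \<Rightarrow> bool" where
  "computes_within M ws out T \<longleftrightarrow>
     length ws < tapes M \<and>
     (\<exists>t \<le> T. \<exists>tps. (step M ^^ t) (initial M ws) = (states M, tps) \<and>
        fst (last tps) = contents out)"

definition polytime :: "nat \<Rightarrow> (bool list list \<Rightarrow> bool list) \<Rightarrow> bool" where
  "polytime a f \<longleftrightarrow>
     (\<exists>M (p :: nat poly). turing_machine M \<and>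
        (\<forall>ws. length ws = a \<longrightarrow>
           computes_within M ws (f ws) (poly p (sum_list (map length ws)))))"


section \<open>The class NP and completeness\<close>

type_synonym language = "bool list set"

definition polytime_function :: "(bool list \<Rightarrow> bool list) \<Rightarrow> bool" where
  "polytime_function f \<longleftrightarrow> polytime 1 (\<lambda>ws. f (ws ! 0))"

definition polytime_relation :: "(bool list \<Rightarrow> bool list \<Rightarrow> bool) \<Rightarrow> bool" where
  "polytime_relation R \<longleftrightarrow> polytime 2 (\<lambda>ws. [R (ws ! 0) (ws ! 1)])"

definition NP :: "language set" where
  "NP = {L. \<exists>R (p :: nat poly). polytime_relation R \<and>
     (\<forall>x. x \<in> L \<longleftrightarrow> (\<exists>u. length u \<le> poly p (length x) \<and> R x u))}"

definition polytime_reducible :: "language \<Rightarrow> language \<Rightarrow> bool"  (infix "\<le>\<^sub>p" 50) where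
  "L \<le>\<^sub>p L' \<longleftrightarrow> (\<exists>f. polytime_function f \<and> (\<forall>x. x \<in> L \<longleftrightarrow> f x \<in> L'))"

definition NP_hard :: "language \<Rightarrow> bool" where
  "NP_hard L \<longleftrightarrow> (\<forall>L' \<in> NP. L' \<le>\<^sub>p L)"

definition NP_complete :: "language \<Rightarrow> bool" where
  "NP_complete L \<longleftrightarrow> L \<in> NP \<and> NP_hard L"


section \<open>Graphs and colorings\<close>

type_synonym 'a graph = "'a set \<times> 'a set set"

abbreviation verts :: "'a graph \<Rightarrow> 'a set" where
  "verts G \<equiv> fst G"

abbreviation edges :: "'a graph \<Rightarrow> 'a set set" where
  "edges G \<equiv> snd G"

definition pairs :: "'a set \<Rightarrow> 'a set set" where
  "pairs V = {{u, v} | u v. u \<in> V \<and> v \<in> V \<and> u \<noteq> v}"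

definition simple_graph :: "'a graph \<Rightarrow> bool" where
  "simple_graph G \<longleftrightarrow> finite (verts G) \<and> edges G \<subseteq> pairs (verts G)"

definition complement :: "'a graph \<Rightarrow> 'a graph" where
  "complement G = (verts G, pairs (verts G) - edges G)"

definition subgraph :: "'a graph \<Rightarrow> 'a graph \<Rightarrow> bool" where
  "subgraph H G \<longleftrightarrow> simple_graph H \<and> verts H \<subseteq> verts G \<and> edges H \<subseteq> edges G"

definition coloring :: "nat \<Rightarrow> 'a graph \<Rightarrow> ('a \<Rightarrow> nat) \<Rightarrow> bool" where
  "coloring k G \<phi> \<longleftrightarrow>
     \<phi> ` verts G \<subseteq> {1..k} \<and> (\<forall>u v. {u, v} \<in> edges G \<longrightarrow> \<phi> u \<noteq> \<phi> v)"

definition monochromatic_edges :: "'a graph \<Rightarrow> ('a \<Rightarrow> nat) \<Rightarrow> 'a set set" where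
  "monochromatic_edges H \<phi> = {e \<in> edges H. \<exists>u v. e = {u, v} \<and> \<phi> u = \<phi> v}"


section \<open>Robust-Coloring\<close>

type_synonym rc_instance = "nat graph \<times> nat graph \<times> nat \<times> nat"

text \<open>As inputs of a machine, graphs have the vertices \<open>0, \<dots>, n - 1\<close>.\<close>

definition rc_instances :: "rc_instance set" where
  "rc_instances = {(G, H, k, m).
     simple_graph G \<and> verts G = {..<card (verts G)} \<and> subgraph H (complement G) \<and>
     0 < k \<and> k \<le> card (verts G)}"

definition Robust_Coloring :: "rc_instance set" where
  "Robust_Coloring = {(G, H, k, m) \<in> rc_instances.
     \<exists>\<phi>. coloring k G \<phi> \<and> card (monochromatic_edges H \<phi>) \<le> m}"

text \<open>Row \<open>i\<close> of a graph consists of a bit telling whether \<open>i\<close> is a vertex (of interest for the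
  subgraph \<open>H\<close>, which need not be spanning), followed by row \<open>i\<close> of the adjacency matrix.\<close>

definition graph_rows :: "nat \<Rightarrow> nat graph \<Rightarrow> bool list list" where
  "graph_rows n G = map (\<lambda>i. (i \<in> verts G) # map (\<lambda>j. {i, j} \<in> edges G) [0..<n]) [0..<n]"

text \<open>Binary representation, least significant bit first, no leading zeros\<close>

fun binary :: "nat \<Rightarrow> bool list" where
  "binary n = (if n = 0 then [] else odd n # binary (n div 2))"

declare binary.simps [simp del]

text \<open>Self-delimiting code of a bit string: every bit is preceded by \<open>True\<close>, the end is marked
  by \<open>False\<close>.\<close>

definition delimit :: "bool list \<Rightarrow> bool list" where
  "delimit w = concat (map (\<lambda>b. [True, b]) w) @ [False]"

fun encode :: "rc_instance \<Rightarrow> bool list" where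
  "encode (G, H, k, m) =
     (let n = card (verts G)
      in concat (map delimit (graph_rows n G @ graph_rows n H @ [binary k, binary m])))"

lemma binary_inject: "binary a = binary b \<Longrightarrow> a = b"
proof (induction a arbitrary: b rule: less_induct)
  case (less a)
  show ?case
  proof (cases "a = 0 \<or> b = 0")
    case True
    then show ?thesis
      using less.prems binary.simps[of a] binary.simps[of b] by (auto split: if_splits)
  next
    case False
    then have "odd a = odd b" "binary (a div 2) = binary (b div 2)"
      using less.prems binary.simps[of a] binary.simps[of b] by auto
    moreover have "a div 2 = b div 2"
      using less.IH[of "a div 2" "b div 2"] False calculation by simp
    ultimately show ?thesis
      by (metis even_two_times_div_two odd_two_times_div_two_succ)
  qed
qed

lemma delimit_prefix: "delimit v @ x = delimit w @ y \<Longrightarrow> v = w \<and> x = y"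
proof (induction v arbitrary: w)
  case Nil
  then show ?case by (cases w) (auto simp: delimit_def)
next
  case (Cons b v)
  then show ?case by (cases w) (auto simp: delimit_def)
qed

lemma concat_delimit_inject:
  "concat (map delimit vs) = concat (map delimit ws) \<Longrightarrow> vs = ws"
proof (induction vs arbitrary: ws)
  case Nil
  then show ?case by (cases ws) (auto simp: delimit_def)
next
  case (Cons v vs)
  have "ws \<noteq> []"
    using Cons.prems by (auto simp: delimit_def)
  then obtain w ws' where ws: "ws = w # ws'"
    by (cases ws) auto
  have "delimit v @ concat (map delimit vs) = delimit w @ concat (map delimit ws')"
    using Cons.prems ws by simp
  from delimit_prefix[OF this] show ?case
    using Cons.IH ws by blast
qed

lemma graph_rows_inject:
  assumes "simple_graph G" "simple_graph G'" "verts G \<subseteq> {..<n}" "verts G' \<subseteq> {..<n}"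
    and "graph_rows n G = graph_rows n G'"
  shows "G = G'"
proof -
  have row: "(i \<in> verts G) = (i \<in> verts G')"
    "j < n \<Longrightarrow> ({i, j} \<in> edges G) = ({i, j} \<in> edges G')" if "i < n" for i j
    using arg_cong[OF assms(5), of "\<lambda>r. r ! i"] that by (auto simp: graph_rows_def)
  have "verts G = verts G'"
    using row(1) assms(3,4) by blast
  moreover have "e \<in> edges G \<longleftrightarrow> e \<in> edges G'" for e
  proof (cases "e \<in> pairs {..<n}")
    case True
    then show ?thesis using row(2) by (auto simp: pairs_def)
  next
    case False
    then show ?thesis
      using assms(1-4) unfolding simple_graph_def pairs_def by blast
  qed
  ultimately show ?thesis
    by (intro prod_eqI) auto
qed

lemma inj_on_encode: "inj_on encode rc_instances"
proof (rule inj_onI)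
  fix a b assume a: "a \<in> rc_instances" and b: "b \<in> rc_instances" and eq: "encode a = encode b"
  obtain G H k m where A: "a = (G, H, k, m)" by (cases a) auto
  obtain G' H' k' m' where B: "b = (G', H', k', m')" by (cases b) auto
  define n where "n = card (verts G)"
  define n' where "n' = card (verts G')"
  have L: "graph_rows n G @ graph_rows n H @ [binary k, binary m] =
      graph_rows n' G' @ graph_rows n' H' @ [binary k', binary m']"
    using eq unfolding A B encode.simps Let_def n_def n'_def by (rule concat_delimit_inject)
  have len: "length (graph_rows l K) = l" for l K
    by (simp add: graph_rows_def)
  have n: "n' = n"
    using arg_cong[OF L, of length] len by simp
  have eqs: "graph_rows n G = graph_rows n G'" "graph_rows n H = graph_rows n H'" "k = k'" "m = m'"
  proof -
    have *: "graph_rows n G = graph_rows n G' \<and>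
        graph_rows n H @ [binary k, binary m] = graph_rows n H' @ [binary k', binary m']"
      using L unfolding n by (subst (asm) append_eq_append_conv) (simp_all add: len)
    then have **: "graph_rows n H = graph_rows n H' \<and> [binary k, binary m] = [binary k', binary m']"
      by (subst (asm) append_eq_append_conv) (simp_all add: len)
    show "graph_rows n G = graph_rows n G'" "graph_rows n H = graph_rows n H'"
      using * ** by blast+
    show "k = k'" "m = m'"
      using ** by (auto intro: binary_inject)
  qed
  have "simple_graph G" "simple_graph G'" "simple_graph H" "simple_graph H'"
    "verts G \<subseteq> {..<n}" "verts G' \<subseteq> {..<n}"
    "verts H \<subseteq> {..<n}" "verts H' \<subseteq> {..<n}"
    using a b n unfolding A B n_def n'_def rc_instances_def subgraph_def complement_def by auto
  then show "a = b"
    using graph_rows_inject eqs unfolding A B by blast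
qed

end

theory Submission
  imports Defs
begin

text \<open>
  Membership: a certificate is a set of vertices, and all checks are computable by programs whose
  registers hold numbers in unary, with values polynomial in the length of the input. The functions
  computed by such programs in polynomial time are closed under arithmetic, bounded sums, bounded
  quantifiers and polynomially bounded recursion, so they are recognized by their definitions, and
  the programs run on Turing machines with one tape per register.

  Hardness: with two colors, an edge of G forces its ends to be different, and a triangle of H has one
  monochromatic edge or three. Hence not-all-equal satisfiability of clauses with three literals is
  the question whether disjoint triangles, one per clause, with vertices tied to literals by edges of
  G can be colored with only one monochromatic edge each. Satisfiability of clauses of any length
  reduces to this by evaluating each clause literal by literal, and the computations of a Turing
  machine are described by such clauses. The tapes are described relative to their heads, and the
  state is a further tape that never moves. As the clauses are uniform, they are given by functions
  of the above class, so that the whole reduction is computable in polynomial time.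
\<close>

section \<open>Structured programs for Turing machines\<close>

text \<open>Unary registers suffice since vertex numbers, positions in a code and times of a
  computation are all polynomial in the input length. The exception is the bound \<open>m\<close>,
  written in binary and possibly exponential; it is capped while it is read.

  Not-all-equal clauses suit two colors because exchanging the colors preserves solutions, as
  complementing an assignment does. A triangle always has a monochromatic edge, so a total of at
  most one per triangle means exactly one in each: a global count enforces local conditions.

  With tapes taken relative to their heads there are no atoms for head positions: a step depends on
  the cells at distance 0 and shifts each track by at most one. The price is that cells enter from
  outside any finite window, so its known part shrinks by one cell at both ends in each step; a
  radius of twice the running time leaves enough. No clauses say that a cell has only one symbol:
  the clauses of a computation merely force its facts, and rejection is excluded by forbidding the
  symbol of a negative result.\<close>

datatype tid = In nat | Out | Reg nat

type_synonym store = "tid \<Rightarrow> tape"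

datatype cmd =
    Move tid dir
  | Write tid nat
  | Seq cmd cmd
  | While tid "nat \<Rightarrow> bool" cmd
  | If tid "nat \<Rightarrow> bool" cmd cmd

text \<open>The time index counts machine steps exactly, with one step for each unfolding of a
  compound command, so that the machine simulates commands step by step. Upper bounds come in only
  with \<open>runs\<close>.\<close>

inductive exec :: "cmd \<Rightarrow> store \<Rightarrow> nat \<Rightarrow> store \<Rightarrow> bool" where
  Move: "exec (Move j d) \<sigma> 1 (\<sigma>(j := (fst (\<sigma> j), snd (\<sigma> j) + offset d)))"
| Write: "exec (Write j a) \<sigma> 1 (\<sigma>(j := ((fst (\<sigma> j))(snd (\<sigma> j) := a), snd (\<sigma> j))))"
| Seq: "exec c \<sigma> t \<sigma>' \<Longrightarrow> exec d \<sigma>' t' \<sigma>'' \<Longrightarrow> exec (Seq c d) \<sigma> (Suc (t + t')) \<sigma>''"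
| WhileF: "\<not> b (read (\<sigma> j)) \<Longrightarrow> exec (While j b c) \<sigma> 1 \<sigma>"
| WhileT: "b (read (\<sigma> j)) \<Longrightarrow> exec c \<sigma> t \<sigma>' \<Longrightarrow> exec (While j b c) \<sigma>' t' \<sigma>''
    \<Longrightarrow> exec (While j b c) \<sigma> (Suc (t + t')) \<sigma>''"
| IfT: "b (read (\<sigma> j)) \<Longrightarrow> exec c \<sigma> t \<sigma>' \<Longrightarrow> exec (If j b c d) \<sigma> (Suc t) \<sigma>'"
| IfF: "\<not> b (read (\<sigma> j)) \<Longrightarrow> exec d \<sigma> t \<sigma>' \<Longrightarrow> exec (If j b c d) \<sigma> (Suc t) \<sigma>'"

fun over :: "tid set \<Rightarrow> cmd \<Rightarrow> bool" where
  "over A (Move j d) \<longleftrightarrow> j \<in> A"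
| "over A (Write j a) \<longleftrightarrow> j \<in> A \<and> a < 3"
| "over A (Seq c d) \<longleftrightarrow> over A c \<and> over A d"
| "over A (While j b c) \<longleftrightarrow> j \<in> A \<and> over A c"
| "over A (If j b c d) \<longleftrightarrow> j \<in> A \<and> over A c \<and> over A d"

lemma over_mono: "over A c \<Longrightarrow> A \<subseteq> B \<Longrightarrow> over B c"
  by (induction c) auto

text \<open>The control state of a machine executing a command is the stack of the commands that are
  still to be executed. Only finitely many stacks are reachable.\<close>

fun successor :: "cmd \<Rightarrow> cmd list \<Rightarrow> (tid \<Rightarrow> nat) \<Rightarrow> cmd list" where
  "successor (Move j d) k r = k"
| "successor (Write j a) k r = k"
| "successor (Seq c d) k r = c # d # k"
| "successor (While j b c) k r = (if b (r j) then c # While j b c # k else k)"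
| "successor (If j b c d) k r = (if b (r j) then c # k else d # k)"

fun action :: "cmd \<Rightarrow> nat \<Rightarrow> tid \<Rightarrow> nat \<times> dir" where
  "action (Move i d) a j = (a, if i = j then d else Stay)"
| "action (Write i s) a j = (if i = j then s else a, Stay)"
| "action _ a j = (a, Stay)"

fun stack_step :: "cmd list \<times> store \<Rightarrow> cmd list \<times> store" where
  "stack_step ([], \<sigma>) = ([], \<sigma>)"
| "stack_step (c # k, \<sigma>) =
     (successor c k (\<lambda>j. read (\<sigma> j)), \<lambda>j. act (action c (read (\<sigma> j)) j) (\<sigma> j))"

lemma act_keep: "act (read tp, Stay) tp = tp"
  by (auto simp: act_def read_def)

lemma exec_stack_step: "exec c \<sigma> t \<sigma>' \<Longrightarrow> (stack_step ^^ t) (c # k, \<sigma>) = (k, \<sigma>')"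
proof (induction arbitrary: k rule: exec.induct)
  case (Move j d \<sigma>)
  have "(\<lambda>i. act (action (Move j d) (read (\<sigma> i)) i) (\<sigma> i)) =
      \<sigma>(j := (fst (\<sigma> j), snd (\<sigma> j) + offset d))"
    by (auto simp: fun_eq_iff act_def read_def)
  then show ?case by (simp add: fun_upd_def)
next
  case (Write j a \<sigma>)
  have "(\<lambda>i. act (action (Write j a) (read (\<sigma> i)) i) (\<sigma> i)) =
      \<sigma>(j := ((fst (\<sigma> j))(snd (\<sigma> j) := a), snd (\<sigma> j)))"
    by (auto simp: fun_eq_iff act_def read_def)
  then show ?case by (simp add: fun_upd_def)
next
  case (Seq c \<sigma> t \<sigma>' d t' \<sigma>'')
  have "(stack_step ^^ Suc (t + t')) (Seq c d # k, \<sigma>) = (stack_step ^^ (t' + t)) (c # d # k, \<sigma>)"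
    by (simp add: funpow_Suc_right act_keep add.commute del: funpow.simps)
  then show ?case using Seq.IH by (simp add: funpow_add)
next
  case (WhileT b \<sigma> j c t \<sigma>' t' \<sigma>'')
  have "(stack_step ^^ Suc (t + t')) (While j b c # k, \<sigma>)
      = (stack_step ^^ (t' + t)) (c # While j b c # k, \<sigma>)"
    using WhileT.hyps
    by (simp add: funpow_Suc_right act_keep add.commute del: funpow.simps)
  then show ?case using WhileT.IH by (simp add: funpow_add)
qed (auto simp: funpow_Suc_right act_keep simp del: funpow.simps)

text \<open>These are the stacks met while \<open>c\<close> runs on top of the continuation
  \<open>k\<close>, before \<open>k\<close> alone is left. A loop is its own continuation during its
  body, so recursion on the command suffices and the set stays finite.\<close>

fun stacks :: "cmd \<Rightarrow> cmd list \<Rightarrow> cmd list set" where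
  "stacks (Seq c d) k = {Seq c d # k} \<union> stacks c (d # k) \<union> stacks d k"
| "stacks (While j b c) k = {While j b c # k} \<union> stacks c (While j b c # k)"
| "stacks (If j b c d) k = {If j b c d # k} \<union> stacks c k \<union> stacks d k"
| "stacks c k = {c # k}"

lemma finite_stacks: "finite (stacks c k)"
  by (induction c k rule: stacks.induct) auto

lemma stacks_start: "c # k \<in> stacks c k"
  by (cases c) auto

lemma stacks_Cons:
  assumes "\<kappa> \<in> stacks c k" "over A c"
  shows "\<exists>d l. \<kappa> = d # l \<and> over A d"
  using assms by (induction c k rule: stacks.induct) auto

lemma successor_stacks:
  assumes "d # l \<in> stacks c k"
  shows "successor d l r \<in> insert k (stacks c k)"
  using assms
proof (induction c k rule: stacks.induct)
  case (1 c d' k)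
  then show ?case using stacks_start[of c "d' # k"] stacks_start[of d' k] by auto
next
  case (2 j b c k)
  then show ?case using stacks_start[of c "While j b c # k"] by (auto split: if_splits)
next
  case (3 j b c d k)
  then show ?case using stacks_start[of c k] stacks_start[of d k] by (auto split: if_splits)
qed auto

lemma funpow_simulation:
  assumes "\<And>x y. P x y \<Longrightarrow> P (f x) (g y)" "P x y"
  shows "P ((f ^^ n) x) ((g ^^ n) y)"
  by (induction n) (use assms in auto)

theorem machine_of_command:
  assumes ord: "distinct ord" and c: "over (set ord) c"
  shows "\<exists>M. turing_machine M \<and> tapes M = length ord \<and>
    (\<forall>\<sigma> t \<sigma>'. exec c \<sigma> t \<sigma>' \<longrightarrow>
       (step M ^^ t) (0, map \<sigma> ord) = (states M, map \<sigma>' ord))"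
proof -
  obtain qs where qs: "set qs = stacks c [] - {[c]}" "distinct qs"
    using finite_distinct_list[of "stacks c [] - {[c]}"] finite_stacks by auto
  \<comment> \<open>Machines start in state 0, so \<open>[c]\<close> has to come first; the empty
    stack will get the number \<open>length Q\<close> of the halting state.\<close>
  define Q where "Q = [c] # qs"
  have Q: "set Q = stacks c []" "distinct Q" "Q ! 0 = [c]"
    using qs stacks_start[of c "[]"] by (auto simp: Q_def)
  have Q0: "0 < length Q" by (simp add: Q_def)
  define num where "num \<kappa> = (if \<kappa> = [] then length Q else THE i. i < length Q \<and> Q ! i = \<kappa>)" for \<kappa>
  have num: "num (Q ! i) = i" if "i < length Q" for i
  proof -
    have "Q ! i \<in> stacks c []" using nth_mem[OF that] Q(1) by simp
    from stacks_Cons[OF this c] have "Q ! i \<noteq> []" by auto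
    moreover have "(THE i'. i' < length Q \<and> Q ! i' = Q ! i) = i"
      by (rule the_equality) (use that Q(2) nth_eq_iff_index_eq in blast)+
    ultimately show ?thesis by (simp add: num_def)
  qed
  have num_less: "num \<kappa> < length Q \<and> Q ! num \<kappa> = \<kappa>" if "\<kappa> \<in> stacks c []" for \<kappa>
    using that num Q(1) by (metis in_set_conv_nth)
  define sym where "sym as j = the (map_of (zip ord as) j)" for as :: "nat list" and j
  define M where "M = \<lparr>tapes = length ord, states = length Q, symbols = 3,
    delta = \<lambda>q as. (num (successor (hd (Q ! q)) (tl (Q ! q)) (sym as)),
       map (\<lambda>j. action (hd (Q ! q)) (sym as j) j) ord)\<rparr>"
  have M: "tapes M = length ord" "states M = length Q" "symbols M = 3"
    by (simp_all add: M_def)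
  have sym: "sym as j \<in> set as" if "length as = length ord" "j \<in> set ord" for as j
  proof -
    from that have "map_of (zip ord as) j \<noteq> None"
      by (simp add: map_of_zip_is_None)
    then obtain y where y: "map_of (zip ord as) j = Some y" by auto
    then have "(j, y) \<in> set (zip ord as)" by (rule map_of_SomeD)
    then show ?thesis using y by (auto simp: sym_def dest: set_zip_rightD)
  qed
  have sym_map: "sym (map f ord) j = f j" if "j \<in> set ord" for f j
    using that by (simp add: sym_def map_of_zip_map)
  have act_lt: "fst (action d a j) < 3" if "over (set ord) d" "a < 3" for d a j
    using that by (cases d) auto
  have suc_num: "num (successor d l r) \<le> length Q" if "d # l \<in> stacks c []" for d l r
    using successor_stacks[OF that, of r] num_less by (fastforce simp: num_def)
  have "turing_machine M"
    unfolding turing_machine_def M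
  proof (intro conjI allI impI)
    fix q :: nat and as :: "nat list"
    assume q: "q < length Q" and as: "length as = length ord \<and> set as \<subseteq> {..<3}"
    have mem: "Q ! q \<in> stacks c []" using nth_mem[OF q] Q(1) by simp
    from stacks_Cons[OF this c] obtain d l where dl: "Q ! q = d # l" "over (set ord) d"
      by auto
    with mem have inQ: "d # l \<in> stacks c []" by simp
    show "fst (delta M q as) \<le> length Q"
      using suc_num[OF inQ] dl by (simp add: M_def)
    show "length (snd (delta M q as)) = length ord" by (simp add: M_def)
    show "fst ` set (snd (delta M q as)) \<subseteq> {..<3}"
    proof
      fix y assume "y \<in> fst ` set (snd (delta M q as))"
      then obtain j where "j \<in> set ord" "y = fst (action d (sym as j) j)"
        using dl(1) by (auto simp: M_def)
      moreover have "sym as j < 3" using sym[of as j] as calculation(1) by blast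
      ultimately show "y \<in> {..<3}" using act_lt[OF dl(2)] by simp
    qed
  qed simp
  moreover have "(step M ^^ t) (0, map \<sigma> ord) = (states M, map \<sigma>' ord)" if "exec c \<sigma> t \<sigma>'" for \<sigma> t \<sigma>'
  proof -
    \<comment> \<open>Only stacks in \<open>stacks c []\<close> and the empty one have a state. Both
      sides stay put once the stack is empty, which matches the halting state.\<close>
    define rel where "rel cf s \<longleftrightarrow> fst s \<in> insert [] (stacks c []) \<and>
      cf = (num (fst s), map (snd s) ord)" for cf :: config and s :: "cmd list \<times> store"
    have num_Nil: "num [] = length Q" by (simp add: num_def)
    have "rel (step M cf) (stack_step s)" if "rel cf s" for cf s
    proof (cases "fst s")
      case Nil
      then show ?thesis using that num_Nil by (cases s) (auto simp: rel_def step_def M)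
    next
      case (Cons d l)
      then obtain \<tau> where s: "s = (d # l, \<tau>)" by (cases s) auto
      then have inQ: "d # l \<in> stacks c []" and cf: "cf = (num (d # l), map \<tau> ord)"
        using that by (auto simp: rel_def)
      have "over (set ord) d" using stacks_Cons[OF inQ c] by auto
      then have same: "successor d l (sym (map (\<lambda>j. read (\<tau> j)) ord)) = successor d l (\<lambda>j. read (\<tau> j))"
        by (cases d) (auto simp: sym_map)
      have "map2 act (map (\<lambda>j. action d (sym (map (\<lambda>j. read (\<tau> j)) ord) j) j) ord) (map \<tau> ord)
          = map (\<lambda>j. act (action d (read (\<tau> j)) j) (\<tau> j)) ord"
        by (simp add: zip_map1 zip_map2 zip_same_conv_map sym_map)
      then show ?thesis
        using num_less[OF inQ] successor_stacks[OF inQ] same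
        by (auto simp: rel_def step_def M cf s Let_def comp_def M_def)
    qed
    moreover have "rel (0, map \<sigma> ord) ([c], \<sigma>)"
      using num[OF Q0] Q(3) stacks_start by (auto simp: rel_def)
    ultimately have "rel ((step M ^^ t) (0, map \<sigma> ord)) ((stack_step ^^ t) ([c], \<sigma>))"
      by (rule funpow_simulation)
    then show ?thesis
      using exec_stack_step[OF that, of "[]"] num_Nil by (simp add: rel_def M)
  qed
  ultimately show ?thesis using M(1) by blast
qed

section \<open>Register programs\<close>

text \<open>As the base is at least 2, a power of it dominates any constant and absorbs the factor 2
  of a sum. Neither polynomials nor monotonicity of \<open>T\<close> have to be dealt with.\<close>

definition poly_bounded :: "(nat \<Rightarrow> nat) \<Rightarrow> bool" where
  "poly_bounded T \<longleftrightarrow> (\<exists>k. \<forall>B. T B \<le> (B + 2) ^ k)"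

lemma poly_bounded_le:
  assumes "poly_bounded U" "\<And>B. T B \<le> U B"
  shows "poly_bounded T"
  using assms order_trans unfolding poly_bounded_def by blast

lemma poly_bounded_const: "poly_bounded (\<lambda>_. c)"
proof -
  have "c \<le> (B + 2) ^ c" for B :: nat
  proof -
    have "c \<le> 2 ^ c" by simp
    also have "\<dots> \<le> (B + 2) ^ c" by (rule power_mono) auto
    finally show ?thesis .
  qed
  then show ?thesis unfolding poly_bounded_def by blast
qed

lemma poly_bounded_id: "poly_bounded (\<lambda>B. B)"
  unfolding poly_bounded_def by (rule exI[of _ 1]) simp

lemma poly_bounded_mult:
  assumes "poly_bounded T" "poly_bounded U"
  shows "poly_bounded (\<lambda>B. T B * U B)"
proof -
  obtain k l where "\<And>B. T B \<le> (B + 2) ^ k" "\<And>B. U B \<le> (B + 2) ^ l"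
    using assms unfolding poly_bounded_def by blast
  then have "T B * U B \<le> (B + 2) ^ (k + l)" for B
    unfolding power_add by (intro mult_le_mono)
  then show ?thesis unfolding poly_bounded_def by blast
qed

lemma poly_bounded_add:
  assumes "poly_bounded T" "poly_bounded U"
  shows "poly_bounded (\<lambda>B. T B + U B)"
proof -
  obtain k l where kl: "\<And>B. T B \<le> (B + 2) ^ k" "\<And>B. U B \<le> (B + 2) ^ l"
    using assms unfolding poly_bounded_def by blast
  have "T B + U B \<le> 2 * (B + 2) ^ (k + l)" for B
  proof -
    have "(B + 2) ^ k \<le> (B + 2) ^ (k + l)" "(B + 2) ^ l \<le> (B + 2) ^ (k + l)"
      by (auto intro!: power_increasing)
    then show ?thesis using kl[of B] by linarith
  qed
  moreover have "poly_bounded (\<lambda>B. 2 * (B + 2) ^ (k + l))"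
    by (intro poly_bounded_mult poly_bounded_const) (auto simp: poly_bounded_def)
  ultimately show ?thesis by (rule poly_bounded_le[rotated])
qed

lemma poly_bounded_comp:
  assumes "poly_bounded T" "poly_bounded U"
  shows "poly_bounded (\<lambda>B. T (U B))"
proof -
  obtain k l where kl: "\<And>B. T B \<le> (B + 2) ^ k" "\<And>B. U B \<le> (B + 2) ^ l"
    using assms unfolding poly_bounded_def by blast
  have "T (U B) \<le> (B + 2) ^ ((l + 2) * k)" for B
  proof -
    have "1 \<le> (B + 2) ^ l" by simp
    then have "(B + 2) ^ l + 2 \<le> (B + 2) ^ l * 4" by linarith
    also have "\<dots> \<le> (B + 2) ^ l * (B + 2) ^ 2"
      by (intro mult_le_mono2) (simp add: power2_eq_square)
    finally have "U B + 2 \<le> (B + 2) ^ (l + 2)"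
      using kl(2)[of B] unfolding power_add by linarith
    then have "(U B + 2) ^ k \<le> (B + 2) ^ ((l + 2) * k)"
      unfolding power_mult by (rule power_mono) simp
    then show ?thesis using kl(1)[of "U B"] by linarith
  qed
  then show ?thesis unfolding poly_bounded_def by blast
qed

lemma poly_bounded_Suc: "poly_bounded T \<Longrightarrow> poly_bounded (\<lambda>B. Suc (T B))"
  using poly_bounded_add[OF poly_bounded_const[of 1], of T] by simp

lemmas poly_bounded_intros =
  poly_bounded_const poly_bounded_id poly_bounded_mult poly_bounded_add poly_bounded_Suc

section \<open>Execution within a time bound\<close>

definition runs :: "cmd \<Rightarrow> store \<Rightarrow> nat \<Rightarrow> store \<Rightarrow> bool" where
  "runs c \<sigma> T \<sigma>' \<longleftrightarrow> (\<exists>t\<le>T. exec c \<sigma> t \<sigma>')"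

lemma runs_weaken: "runs c \<sigma> T \<sigma>' \<Longrightarrow> T \<le> T' \<Longrightarrow> runs c \<sigma> T' \<sigma>'"
  unfolding runs_def using order_trans by blast

lemma runs_Seq:
  assumes "runs c \<sigma> T \<sigma>'" "runs d \<sigma>' T' \<sigma>''"
  shows "runs (Seq c d) \<sigma> (Suc (T + T')) \<sigma>''"
proof -
  obtain t t' where "t \<le> T" "exec c \<sigma> t \<sigma>'" "t' \<le> T'" "exec d \<sigma>' t' \<sigma>''"
    using assms unfolding runs_def by auto
  then show ?thesis unfolding runs_def by (intro exI[of _ "Suc (t + t')"]) (auto intro: exec.Seq)
qed

lemma runs_While:
  assumes "\<And>i. i < n \<Longrightarrow> b (read (X i j))" "\<And>i. i < n \<Longrightarrow> runs c (X i) T (X (Suc i))"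
    and "\<not> b (read (X n j))"
  shows "runs (While j b c) (X 0) (n * (T + 1) + 1) (X n)"
  using assms
proof (induction n arbitrary: X)
  case 0
  then show ?case unfolding runs_def by (intro exI[of _ 1]) (auto intro: exec.WhileF[simplified])
next
  case (Suc n)
  have "runs (While j b c) (X (Suc 0)) (n * (T + 1) + 1) (X (Suc n))"
    using Suc.IH[of "\<lambda>i. X (Suc i)"] Suc.prems by auto
  then obtain t' where t': "t' \<le> n * (T + 1) + 1" "exec (While j b c) (X (Suc 0)) t' (X (Suc n))"
    unfolding runs_def by auto
  obtain t where t: "t \<le> T" "exec c (X 0) t (X (Suc 0))"
    using Suc.prems(2)[of 0] unfolding runs_def by auto
  have "exec (While j b c) (X 0) (Suc (t + t')) (X (Suc n))"
    using exec.WhileT[OF _ t(2) t'(2)] Suc.prems(1)[of 0] by simp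
  then show ?case unfolding runs_def using t t' by (intro exI[of _ "Suc (t + t')"]) auto
qed

lemma runs_If:
  assumes "b (read (\<sigma> j)) \<Longrightarrow> runs c \<sigma> T \<sigma>'" "\<not> b (read (\<sigma> j)) \<Longrightarrow> runs d \<sigma> T \<sigma>'"
  shows "runs (If j b c d) \<sigma> (Suc T) \<sigma>'"
proof (cases "b (read (\<sigma> j))")
  case True
  then obtain t where "t \<le> T" "exec c \<sigma> t \<sigma>'" using assms unfolding runs_def by auto
  then show ?thesis
    using True unfolding runs_def by (intro exI[of _ "Suc t"]) (auto intro: exec.IfT)
next
  case False
  then obtain t where "t \<le> T" "exec d \<sigma> t \<sigma>'" using assms unfolding runs_def by auto
  then show ?thesis
    using False unfolding runs_def by (intro exI[of _ "Suc t"]) (auto intro: exec.IfF)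
qed

fun valid :: "cmd \<Rightarrow> bool" where
  "valid (Move j d) \<longleftrightarrow> True"
| "valid (Write j a) \<longleftrightarrow> a < 3"
| "valid (Seq c d) \<longleftrightarrow> valid c \<and> valid d"
| "valid (While j b c) \<longleftrightarrow> valid c"
| "valid (If j b c d) \<longleftrightarrow> valid c \<and> valid d"

definition area :: "nat \<Rightarrow> tid set" where
  "area K = In ` {..<K} \<union> Reg ` {..<K} \<union> {Out}"

lemma area_mono: "K \<le> L \<Longrightarrow> area K \<subseteq> area L"
  by (auto simp: area_def)

lemma ex_area: "\<exists>K. j \<in> area K"
proof (cases j)
  case (In i) then show ?thesis by (intro exI[of _ "Suc i"]) (auto simp: area_def)
next
  case (Reg i) then show ?thesis by (intro exI[of _ "Suc i"]) (auto simp: area_def)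
qed (auto simp: area_def)

lemma over_area_mono: "over (area K) c \<Longrightarrow> K \<le> L \<Longrightarrow> over (area L) c"
  using over_mono area_mono by blast

lemma valid_over: "valid c \<Longrightarrow> \<exists>K. over (area K) c"
proof (induction c)
  case (Seq c d)
  then obtain K L where "over (area K) c" "over (area L) d" by auto
  then have "over (area (K + L)) (Seq c d)"
    using over_area_mono[of _ _ "K + L"] by auto
  then show ?case ..
next
  case (While j b c)
  then obtain K L where "over (area K) c" "j \<in> area L" using ex_area[of j] by auto
  then have "over (area (K + L)) (While j b c)"
    using over_area_mono[of K c "K + L"] area_mono[of L "K + L"] by auto
  then show ?case ..
next
  case (If j b c d)
  then obtain K L K' where "over (area K) c" "over (area K') d" "j \<in> area L"
    using ex_area[of j] by auto
  then have "over (area (K + K' + L)) (If j b c d)"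
    using over_area_mono[of _ _ "K + K' + L"] area_mono[of L "K + K' + L"] by auto
  then show ?case ..
qed (use ex_area in auto)

section \<open>Unary registers\<close>

text \<open>A register holds a number as the distance of the head from cell 0, which carries the mark
  1. So incrementing, decrementing and testing for zero take one step each.\<close>

definition st :: "(nat \<Rightarrow> bool list) \<Rightarrow> (nat \<Rightarrow> nat) \<Rightarrow> (nat \<Rightarrow> nat) \<Rightarrow> bool list \<Rightarrow> store" where
  "st w h s out j = (case j of
      In i \<Rightarrow> (contents (w i), int (h i))
    | Out \<Rightarrow> (contents out, int (length out))
    | Reg r \<Rightarrow> (\<lambda>p. if p = 0 then 1 else 0, int (s r)))"

abbreviation inc :: "nat \<Rightarrow> cmd" where "inc r \<equiv> Move (Reg r) Right"
abbreviation dec :: "nat \<Rightarrow> cmd" where "dec r \<equiv> Move (Reg r) Left"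
abbreviation count_down :: "nat \<Rightarrow> cmd \<Rightarrow> cmd" where
  "count_down r c \<equiv> While (Reg r) (\<lambda>a. a \<noteq> 1) c"
abbreviation clear :: "nat \<Rightarrow> cmd" where "clear r \<equiv> count_down r (dec r)"
abbreviation transfer :: "nat \<Rightarrow> nat \<Rightarrow> cmd" where
  "transfer i j \<equiv> count_down i (Seq (dec i) (inc j))"

lemma runs_Move: "runs (Move j d) \<sigma> 1 (\<sigma>(j := (fst (\<sigma> j), snd (\<sigma> j) + offset d)))"
  unfolding runs_def using exec.Move by blast

lemma runs_MoveI:
  "\<sigma>' = \<sigma>(j := (fst (\<sigma> j), snd (\<sigma> j) + offset d)) \<Longrightarrow> runs (Move j d) \<sigma> 1 \<sigma>'"
  using runs_Move by simp

lemma runs_inc: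
  "s' = s(r := Suc (s r)) \<Longrightarrow> runs (inc r) (st w h s out) 1 (st w h s' out)"
  by (rule runs_MoveI) (auto simp: st_def fun_eq_iff split: tid.splits)

lemma runs_dec:
  "0 < s r \<Longrightarrow> s' = s(r := s r - 1) \<Longrightarrow> runs (dec r) (st w h s out) 1 (st w h s' out)"
  by (rule runs_MoveI) (auto simp: st_def fun_eq_iff split: tid.splits)

lemma runs_In_Right:
  "h' = h(i := Suc (h i)) \<Longrightarrow> runs (Move (In i) Right) (st w h s out) 1 (st w h' s out)"
  by (rule runs_MoveI) (auto simp: st_def fun_eq_iff split: tid.splits)

lemma runs_In_Left:
  "0 < h i \<Longrightarrow> h' = h(i := h i - 1) \<Longrightarrow>
     runs (Move (In i) Left) (st w h s out) 1 (st w h' s out)"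
  by (rule runs_MoveI) (auto simp: st_def fun_eq_iff split: tid.splits)

lemma read_Reg: "read (st w h s out (Reg r)) = (if s r = 0 then 1 else 0)"
  by (simp add: st_def read_def)

lemma read_In: "read (st w h s out (In i)) = contents (w i) (int (h i))"
  by (simp add: st_def read_def)

text \<open>The body has to decrement \<open>r\<close> itself: the stores \<open>s i\<close> after
  \<open>i\<close> rounds hold \<open>n - i\<close> there, and the mark in cell 0 is read exactly
  when this is 0.\<close>

lemma runs_count_down:
  assumes "\<And>i. i < n \<Longrightarrow>
      runs c (st w (h i) (s i) (out i)) T (st w (h (Suc i)) (s (Suc i)) (out (Suc i)))"
    and "\<And>i. i \<le> n \<Longrightarrow> s i r = n - i"
    and "\<sigma> = st w (h 0) (s 0) (out 0)" "\<sigma>' = st w (h n) (s n) (out n)"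
  shows "runs (count_down r c) \<sigma> (n * (T + 1) + 1) \<sigma>'"
  unfolding assms(3,4)
  by (rule runs_While[where X = "\<lambda>i. st w (h i) (s i) (out i)"]) (use assms in \<open>auto simp: read_Reg\<close>)

lemma runs_clear:
  assumes "s' = s(r := 0)"
  shows "runs (clear r) (st w h s out) (s r * 2 + 1) (st w h s' out)"
proof -
  have "runs (clear r) (st w h s out) (s r * (1 + 1) + 1) (st w h s' out)"
    by (rule runs_count_down[where s = "\<lambda>i. s(r := s r - i)" and h = "\<lambda>_. h" and out = "\<lambda>_. out"])
      (use assms in \<open>auto intro!: runs_dec[unfolded One_nat_def]\<close>)
  then show ?thesis by (simp only: one_add_one)
qed

lemma runs_transfer:
  assumes "i \<noteq> j" "s' = s(i := 0, j := s j + s i)"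
  shows "runs (transfer i j) (st w h s out) (s i * 4 + 1) (st w h s' out)"
proof -
  have "runs (count_down i (Seq (dec i) (inc j))) (st w h s out) (s i * (3 + 1) + 1) (st w h s' out)"
  proof (rule runs_count_down[where s = "\<lambda>k. s(i := s i - k, j := s j + k)"
        and h = "\<lambda>_. h" and out = "\<lambda>_. out"])
    fix k assume k: "k < s i"
    let ?s = "\<lambda>k. s(i := s i - k, j := s j + k)"
    have "runs (dec i) (st w h (?s k) out) 1 (st w h ((?s k)(i := s i - Suc k)) out)"
      by (rule runs_dec) (use k assms(1) in auto)
    moreover have "runs (inc j) (st w h ((?s k)(i := s i - Suc k)) out) 1 (st w h (?s (Suc k)) out)"
      by (rule runs_inc) (use k assms(1) in \<open>auto simp: fun_eq_iff\<close>)
    ultimately have "runs (Seq (dec i) (inc j)) (st w h (?s k) out) (Suc (1 + 1)) (st w h (?s (Suc k)) out)"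
      by (rule runs_Seq)
    then show "runs (Seq (dec i) (inc j)) (st w h (?s k) out) 3 (st w h (?s (Suc k)) out)"
      by (simp add: numeral_3_eq_3)
  qed (use assms in auto)
  then show ?thesis by simp
qed

section \<open>The class of functions computed by register programs\<close>

definition fits :: "(nat \<Rightarrow> bool list) \<Rightarrow> (nat \<Rightarrow> nat) \<Rightarrow> nat \<Rightarrow> bool" where
  "fits w v B \<longleftrightarrow> (\<forall>i. length (w i) \<le> B) \<and> (\<forall>i. v i \<le> B)"

text \<open>The functions of words and numbers that register programs compute in time polynomial in the
  word lengths and in the numbers themselves (not in the lengths of their binary representations).
  The assignment \<open>\<rho>\<close> of registers to variables is arbitrary, and \<open>N\<close> bounds the registers in
  use: the program finds the registers from \<open>N\<close> on cleared and leaves the result in register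
  \<open>N\<close> as its only effect.\<close>

definition program_for ::
    "((nat \<Rightarrow> bool list) \<Rightarrow> (nat \<Rightarrow> nat) \<Rightarrow> nat) \<Rightarrow> (nat \<Rightarrow> nat) \<Rightarrow> nat \<Rightarrow> cmd \<Rightarrow> (nat \<Rightarrow> nat) \<Rightarrow> bool"
  where "program_for f \<rho> N c T \<longleftrightarrow> poly_bounded T \<and> valid c \<and>
    (\<forall>w s B out. fits w s B \<longrightarrow> (\<forall>j\<ge>N. s j = 0) \<longrightarrow>
       runs c (st w (\<lambda>_. 0) s out) (T B) (st w (\<lambda>_. 0) (s(N := f w (\<lambda>i. s (\<rho> i)))) out))"

definition upoly :: "((nat \<Rightarrow> bool list) \<Rightarrow> (nat \<Rightarrow> nat) \<Rightarrow> nat) \<Rightarrow> bool" where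
  "upoly f \<longleftrightarrow> (\<exists>T. poly_bounded T \<and> (\<forall>w v B. fits w v B \<longrightarrow> f w v \<le> T B)) \<and>
    (\<forall>\<rho> N. (\<forall>i. \<rho> i < N) \<longrightarrow> (\<exists>c T. program_for f \<rho> N c T))"

lemma upoly_bound:
  assumes "upoly f"
  obtains T where "poly_bounded T" "\<And>w v B. fits w v B \<Longrightarrow> f w v \<le> T B"
  using assms unfolding upoly_def by blast

lemma upoly_program:
  assumes "upoly f" "\<And>i. \<rho> i < N"
  obtains c T where "program_for f \<rho> N c T"
  using assms unfolding upoly_def by blast

lemma program_forD:
  assumes "program_for f \<rho> N c T"
  shows "poly_bounded T" "valid c"
    "fits w s B \<Longrightarrow> (\<And>j. j \<ge> N \<Longrightarrow> s j = 0) \<Longrightarrow> s' = s(N := f w (\<lambda>i. s (\<rho> i))) \<Longrightarrow>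
      runs c (st w (\<lambda>_. 0) s out) (T B) (st w (\<lambda>_. 0) s' out)"
  using assms unfolding program_for_def by auto

lemma upolyI:
  assumes "poly_bounded T" "\<And>w v B. fits w v B \<Longrightarrow> f w v \<le> T B"
    and "\<And>\<rho> N. (\<And>i. \<rho> i < N) \<Longrightarrow> \<exists>c T. poly_bounded T \<and> valid c \<and>
    (\<forall>w s B out. fits w s B \<longrightarrow> (\<forall>j\<ge>N. s j = 0) \<longrightarrow>
       runs c (st w (\<lambda>_. 0) s out) (T B) (st w (\<lambda>_. 0) (s(N := f w (\<lambda>i. s (\<rho> i)))) out))"
  shows "upoly f"
  unfolding upoly_def program_for_def using assms by blast

text \<open>This costs nothing because \<open>upoly\<close> provides a program for every assignment
  \<open>\<rho>\<close> of registers: the program of \<open>f\<close> for \<open>\<rho>\<close>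
  composed with \<open>\<pi>\<close> computes the renamed function.\<close>

lemma upoly_rename:
  assumes "upoly f"
  shows "upoly (\<lambda>w v. f w (\<lambda>n. v (\<pi> n)))"
proof -
  obtain T where "poly_bounded T" "\<And>w v B. fits w v B \<Longrightarrow> f w v \<le> T B"
    using upoly_bound[OF assms] by blast
  then have "\<exists>T. poly_bounded T \<and> (\<forall>w v B. fits w v B \<longrightarrow> f w (\<lambda>n. v (\<pi> n)) \<le> T B)"
    by (intro exI[of _ T]) (auto simp: fits_def)
  moreover have "\<exists>c T. program_for (\<lambda>w v. f w (\<lambda>n. v (\<pi> n))) \<rho> N c T" if \<rho>: "\<forall>i. \<rho> i < N" for \<rho> N
  proof -
    obtain c T where "program_for f (\<lambda>n. \<rho> (\<pi> n)) N c T"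
      by (rule upoly_program[OF assms, of "\<lambda>n. \<rho> (\<pi> n)" N]) (use \<rho> in auto)
    then have "program_for (\<lambda>w v. f w (\<lambda>n. v (\<pi> n))) \<rho> N c T"
      unfolding program_for_def by simp
    then show ?thesis by blast
  qed
  ultimately show ?thesis unfolding upoly_def by blast
qed

text \<open>The result register is already cleared, so a command without effect suffices;
  \<open>Move Out Stay\<close> is one.\<close>

lemma upoly_0: "upoly (\<lambda>w v. 0)"
proof (rule upolyI)
  fix \<rho> :: "nat \<Rightarrow> nat" and N
  have "runs (Move Out Stay) (st w (\<lambda>_. 0) s out) 1 (st w (\<lambda>_. 0) (s(N := 0)) out)"
    if "\<forall>j\<ge>N. s j = 0" for w s out
    by (rule runs_MoveI) (use that in \<open>auto simp: st_def fun_eq_iff split: tid.splits\<close>)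
  then show "\<exists>c T. poly_bounded T \<and> valid c \<and>
    (\<forall>w s B out. fits w s B \<longrightarrow> (\<forall>j\<ge>N. s j = 0) \<longrightarrow>
       runs c (st w (\<lambda>_. 0) s out) (T B) (st w (\<lambda>_. 0) (s(N := 0)) out))"
    by (intro exI[of _ "Move Out Stay"] exI[of _ "\<lambda>_. 1"]) (auto intro: poly_bounded_const)
qed (auto intro: poly_bounded_const[of 0])

lemma upoly_Suc:
  assumes "upoly f"
  shows "upoly (\<lambda>w v. Suc (f w v))"
proof -
  obtain R where R: "poly_bounded R" "\<And>w v B. fits w v B \<Longrightarrow> f w v \<le> R B"
    using upoly_bound[OF assms] by blast
  show ?thesis
  proof (rule upolyI[of "\<lambda>B. Suc (R B)"])
    fix \<rho> :: "nat \<Rightarrow> nat" and N assume "\<And>i. \<rho> i < N"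
    then obtain c T where c: "program_for f \<rho> N c T"
      using upoly_program[OF assms] by blast
    show "\<exists>c T. poly_bounded T \<and> valid c \<and>
      (\<forall>w s B out. fits w s B \<longrightarrow> (\<forall>j\<ge>N. s j = 0) \<longrightarrow>
       runs c (st w (\<lambda>_. 0) s out) (T B)
         (st w (\<lambda>_. 0) (s(N := Suc (f w (\<lambda>i. s (\<rho> i))))) out))"
    proof (intro exI conjI allI impI)
      show "poly_bounded (\<lambda>B. Suc (T B + 1))"
        by (intro poly_bounded_intros program_forD(1)[OF c])
      show "valid (Seq c (inc N))" using program_forD(2)[OF c] by simp
      fix w s B out assume "fits w s B" "\<forall>j\<ge>N. s j = 0"
      then show "runs (Seq c (inc N)) (st w (\<lambda>_. 0) s out) (Suc (T B + 1))
         (st w (\<lambda>_. 0) (s(N := Suc (f w (\<lambda>i. s (\<rho> i))))) out)"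
        by (intro runs_Seq[OF program_forD(3)[OF c]] runs_inc) auto
    qed
  qed (use R in \<open>auto intro: poly_bounded_Suc\<close>)
qed

text \<open>Counting a register down destroys it. So its value goes to \<open>N\<close> and also to
  \<open>Suc N\<close>, from where it is restored.\<close>

lemma upoly_var: "upoly (\<lambda>w v. v i)"
proof (rule upolyI[of "\<lambda>B. B"])
  fix \<rho> :: "nat \<Rightarrow> nat" and N assume \<rho>: "\<And>i. \<rho> i < N"
  let ?body = "Seq (dec (\<rho> i)) (Seq (inc N) (inc (Suc N)))"
  show "\<exists>c T. poly_bounded T \<and> valid c \<and>
    (\<forall>w s B out. fits w s B \<longrightarrow> (\<forall>j\<ge>N. s j = 0) \<longrightarrow>
       runs c (st w (\<lambda>_. 0) s out) (T B) (st w (\<lambda>_. 0) (s(N := s (\<rho> i))) out))"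
  proof (intro exI conjI allI impI)
    show "poly_bounded (\<lambda>B. Suc ((B * (5 + 1) + 1) + (B * 4 + 1)))"
      by (intro poly_bounded_intros)
    show "valid (Seq (count_down (\<rho> i) ?body) (transfer (Suc N) (\<rho> i)))" by simp
    fix w s B and out :: "bool list" assume fit: "fits w s B" and clr: "\<forall>j\<ge>N. s j = 0"
    let ?n = "s (\<rho> i)" and ?s = "\<lambda>k. s(\<rho> i := s (\<rho> i) - k, N := k, Suc N := k)"
    have ne: "\<rho> i \<noteq> N" "\<rho> i \<noteq> Suc N" using \<rho>[of i] by auto
    have "?n \<le> B" using fit by (auto simp: fits_def)
    have "runs ?body (st w (\<lambda>_. 0) (?s k) out) (Suc (1 + Suc (1 + 1))) (st w (\<lambda>_. 0) (?s (Suc k)) out)"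
      if "k < ?n" for k
      by (rule runs_Seq[OF runs_dec[OF _ refl] runs_Seq[OF runs_inc[OF refl] runs_inc]])
        (use that ne in \<open>auto simp: fun_eq_iff\<close>)
    then have "runs ?body (st w (\<lambda>_. 0) (?s k) out) 5 (st w (\<lambda>_. 0) (?s (Suc k)) out)"
      if "k < ?n" for k using that by (auto intro!: runs_weaken[where T' = 5])
    then have "runs (count_down (\<rho> i) ?body) (st w (\<lambda>_. 0) s out) (?n * (5 + 1) + 1)
        (st w (\<lambda>_. 0) (?s ?n) out)"
      by (rule runs_count_down) (use ne clr in \<open>auto intro!: arg_cong[of _ _ "\<lambda>s. st w (\<lambda>_. 0) s out"]\<close>)
    moreover have "runs (transfer (Suc N) (\<rho> i)) (st w (\<lambda>_. 0) (?s ?n) out) (?s ?n (Suc N) * 4 + 1)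
        (st w (\<lambda>_. 0) (s(N := s (\<rho> i))) out)"
      by (rule runs_transfer) (use ne clr in \<open>auto simp: fun_eq_iff\<close>)
    ultimately show "runs (Seq (count_down (\<rho> i) ?body) (transfer (Suc N) (\<rho> i)))
        (st w (\<lambda>_. 0) s out) (Suc ((B * (5 + 1) + 1) + (B * 4 + 1))) (st w (\<lambda>_. 0) (s(N := s (\<rho> i))) out)"
      using \<open>?n \<le> B\<close> by (intro runs_weaken[OF runs_Seq]) auto
  qed
qed (auto simp: fits_def poly_bounded_id)

text \<open>Bits are never blank, so the first blank ends the word. Programs expect the input heads
  at cell 0, and \<open>Suc N\<close> counts the way back.\<close>

lemma upoly_length: "upoly (\<lambda>w v. length (w i))"
proof (rule upolyI[of "\<lambda>B. B"])
  fix \<rho> :: "nat \<Rightarrow> nat" and N assume \<rho>: "\<And>i. \<rho> i < N"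
  let ?scan = "Seq (Move (In i) Right) (Seq (inc N) (inc (Suc N)))"
  let ?return = "Seq (Move (In i) Left) (dec (Suc N))"
  show "\<exists>c T. poly_bounded T \<and> valid c \<and>
    (\<forall>w s B out. fits w s B \<longrightarrow> (\<forall>j\<ge>N. s j = 0) \<longrightarrow>
       runs c (st w (\<lambda>_. 0) s out) (T B) (st w (\<lambda>_. 0) (s(N := length (w i))) out))"
  proof (intro exI conjI allI impI)
    show "poly_bounded (\<lambda>B. Suc ((B * (5 + 1) + 1) + (B * (3 + 1) + 1)))"
      by (intro poly_bounded_intros)
    show "valid (Seq (While (In i) (\<lambda>a. a \<noteq> 0) ?scan) (count_down (Suc N) ?return))" by simp
    fix w s B and out :: "bool list" assume fit: "fits w s B" and clr: "\<forall>j\<ge>N. s j = 0"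
    let ?n = "length (w i)" and ?s = "\<lambda>k. s(N := k, Suc N := k)"
      and ?h = "\<lambda>k. (\<lambda>_. 0)(i := k)"
    have "?n \<le> B" using fit by (auto simp: fits_def)
    have "runs ?scan (st w (?h k) (?s k) out) (Suc (1 + Suc (1 + 1)))
        (st w (?h (Suc k)) (?s (Suc k)) out)" for k
      by (rule runs_Seq[OF runs_In_Right[where h' = "?h (Suc k)"] runs_Seq[OF runs_inc[OF refl] runs_inc]])
        (auto simp: fun_eq_iff)
    then have "runs ?scan (st w (?h k) (?s k) out) 5 (st w (?h (Suc k)) (?s (Suc k)) out)" for k
      by (auto intro!: runs_weaken[where T' = 5])
    then have "runs (While (In i) (\<lambda>a. a \<noteq> 0) ?scan) (st w (?h 0) (?s 0) out)
        (?n * (5 + 1) + 1) (st w (?h ?n) (?s ?n) out)"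
      by (intro runs_While[where X = "\<lambda>k. st w (?h k) (?s k) out"])
        (auto simp: read_In contents_def)
    moreover have "runs (count_down (Suc N) ?return) (st w (?h ?n) (?s ?n) out) (?n * (3 + 1) + 1)
        (st w (\<lambda>_. 0) (s(N := length (w i))) out)"
    proof (rule runs_count_down[where h = "\<lambda>k. ?h (?n - k)" and s = "\<lambda>k. s(N := ?n, Suc N := ?n - k)"
          and out = "\<lambda>_. out"])
      fix k assume k: "k < ?n"
      show "runs ?return (st w (?h (?n - k)) (s(N := ?n, Suc N := ?n - k)) out) 3
          (st w (?h (?n - Suc k)) (s(N := ?n, Suc N := ?n - Suc k)) out)"
        by (rule runs_weaken[OF runs_Seq[OF runs_In_Left[where h' = "?h (?n - Suc k)"] runs_dec]])
          (use k in \<open>auto simp: fun_eq_iff\<close>)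
    qed (use clr in \<open>auto intro!: arg_cong2[of _ _ _ _ "\<lambda>h s. st w h s out"]\<close>)
    moreover have "st w (?h 0) (?s 0) out = st w (\<lambda>_. 0) s out"
      using clr by (auto intro!: arg_cong2[of _ _ _ _ "\<lambda>h s. st w h s out"])
    ultimately show "runs (Seq (While (In i) (\<lambda>a. a \<noteq> 0) ?scan) (count_down (Suc N) ?return))
        (st w (\<lambda>_. 0) s out) (Suc ((B * (5 + 1) + 1) + (B * (3 + 1) + 1)))
        (st w (\<lambda>_. 0) (s(N := length (w i))) out)"
      using \<open>?n \<le> B\<close> by (intro runs_weaken[OF runs_Seq]) auto
  qed
qed (auto simp: fits_def poly_bounded_id)

text \<open>While \<open>N\<close> is counted down, the input head moves right and
  \<open>Suc N\<close> records the distance for the way back; meanwhile \<open>N + 2\<close> keeps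
  the symbol. Positions beyond the word read as blank and need no separate test.\<close>

lemma upoly_contents:
  assumes "upoly f"
  shows "upoly (\<lambda>w v. contents (w i) (int (f w v)))"
proof -
  obtain R where R: "poly_bounded R" "\<And>w v B. fits w v B \<Longrightarrow> f w v \<le> R B"
    using upoly_bound[OF assms] by blast
  show ?thesis
  proof (rule upolyI[of "\<lambda>_. 2"])
    fix \<rho> :: "nat \<Rightarrow> nat" and N assume \<rho>: "\<And>i. \<rho> i < N"
    then obtain c T where c: "program_for f \<rho> N c T"
      using upoly_program[OF assms] by blast
    let ?go = "Seq (dec N) (Seq (inc (Suc N)) (Move (In i) Right))"
    let ?test = "If (In i) (\<lambda>a. a = 2) (Seq (inc (N + 2)) (inc (N + 2)))
      (If (In i) (\<lambda>a. a = 1) (inc (N + 2)) (Move Out Stay))"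
    let ?return = "Seq (Move (In i) Left) (dec (Suc N))"
    let ?prog = "Seq c (Seq (count_down N ?go) (Seq ?test
      (Seq (count_down (Suc N) ?return) (transfer (N + 2) N))))"
    let ?T = "\<lambda>B. Suc (T B + Suc (R B * (5 + 1) + 1 + Suc (4 + Suc (R B * (3 + 1) + 1 + 9))))"
    show "\<exists>c T. poly_bounded T \<and> valid c \<and>
      (\<forall>w s B out. fits w s B \<longrightarrow> (\<forall>j\<ge>N. s j = 0) \<longrightarrow>
       runs c (st w (\<lambda>_. 0) s out) (T B)
         (st w (\<lambda>_. 0) (s(N := contents (w i) (int (f w (\<lambda>i. s (\<rho> i)))))) out))"
    proof (intro exI conjI allI impI)
      show "poly_bounded ?T"
        by (intro poly_bounded_intros program_forD(1)[OF c] R(1))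
      show "valid ?prog" using program_forD(2)[OF c] by simp
      fix w s B and out :: "bool list" assume fit: "fits w s B" and clr: "\<forall>j\<ge>N. s j = 0"
      define n where "n = f w (\<lambda>i. s (\<rho> i))"
      define a where "a = contents (w i) (int n)"
      have a: "a = 0 \<or> a = 1 \<or> a = 2" by (auto simp: a_def contents_def)
      let ?h = "\<lambda>k. (\<lambda>_. 0)(i := k)"
      have "n \<le> R B" unfolding n_def by (rule R(2)) (use fit in \<open>auto simp: fits_def\<close>)
      have r1: "runs c (st w (\<lambda>_. 0) s out) (T B) (st w (\<lambda>_. 0) (s(N := n)) out)"
        by (rule program_forD(3)[OF c fit]) (use clr in \<open>auto simp: n_def\<close>)
      have "runs ?go (st w (?h k) (s(N := n - k, Suc N := k)) out) 5
          (st w (?h (Suc k)) (s(N := n - Suc k, Suc N := Suc k)) out)" if "k < n" for k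
        by (rule runs_weaken[OF runs_Seq[OF runs_dec[OF _ refl] runs_Seq[OF
                runs_inc[where s' = "s(N := n - Suc k, Suc N := Suc k)"] runs_In_Right]]])
          (use that in \<open>auto simp: fun_eq_iff\<close>)
      then have r2: "runs (count_down N ?go) (st w (\<lambda>_. 0) (s(N := n)) out) (n * (5 + 1) + 1)
          (st w (?h n) (s(Suc N := n)) out)"
        by (rule runs_count_down) (use clr in \<open>auto intro!: arg_cong2[of _ _ _ _ "\<lambda>h s. st w h s out"]\<close>)
      have rd: "read (st w (?h n) s out (In i)) = a" for s by (simp add: read_In a_def)
      have "runs (Seq (inc (N + 2)) (inc (N + 2))) (st w (?h n) (s(Suc N := n)) out) 3
          (st w (?h n) (s(Suc N := n, N + 2 := a)) out)" if "a = 2"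
        by (rule runs_weaken[OF runs_Seq[OF runs_inc[OF refl] runs_inc]]) (use that clr in auto)
      moreover have "runs (If (In i) (\<lambda>a. a = 1) (inc (N + 2)) (Move Out Stay))
          (st w (?h n) (s(Suc N := n)) out) 3 (st w (?h n) (s(Suc N := n, N + 2 := a)) out)" if "a \<noteq> 2"
      proof (rule runs_weaken[OF runs_If[where T = 1]])
        assume "read (st w (?h n) (s(Suc N := n)) out (In i)) = 1"
        then show "runs (inc (N + 2)) (st w (?h n) (s(Suc N := n)) out) 1
            (st w (?h n) (s(Suc N := n, N + 2 := a)) out)"
          unfolding rd by (intro runs_inc) (use clr in auto)
      next
        assume "read (st w (?h n) (s(Suc N := n)) out (In i)) \<noteq> 1"
        then have "a = 0" using a that unfolding rd by simp
        then show "runs (Move Out Stay) (st w (?h n) (s(Suc N := n)) out) 1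
            (st w (?h n) (s(Suc N := n, N + 2 := a)) out)"
          by (intro runs_MoveI) (use clr in \<open>auto simp: st_def fun_eq_iff split: tid.splits\<close>)
      qed simp
      ultimately have r3: "runs ?test (st w (?h n) (s(Suc N := n)) out) (Suc 3)
          (st w (?h n) (s(Suc N := n, N + 2 := a)) out)"
        by (intro runs_If) (simp_all only: rd simp_thms)
      have r4: "runs (count_down (Suc N) ?return) (st w (?h n) (s(Suc N := n, N + 2 := a)) out)
          (n * (3 + 1) + 1) (st w (\<lambda>_. 0) (s(N + 2 := a)) out)"
      proof (rule runs_count_down[where h = "\<lambda>k. ?h (n - k)" and out = "\<lambda>_. out"
            and s = "\<lambda>k. s(Suc N := n - k, N + 2 := a)"])
        fix k assume k: "k < n"
        show "runs ?return (st w (?h (n - k)) (s(Suc N := n - k, N + 2 := a)) out) 3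
            (st w (?h (n - Suc k)) (s(Suc N := n - Suc k, N + 2 := a)) out)"
          by (rule runs_weaken[OF runs_Seq[OF runs_In_Left[where h' = "?h (n - Suc k)"] runs_dec]])
            (use k in \<open>auto simp: fun_eq_iff\<close>)
      qed (use clr in \<open>auto intro!: arg_cong2[of _ _ _ _ "\<lambda>h s. st w h s out"]\<close>)
      have "runs (transfer (N + 2) N) (st w (\<lambda>_. 0) (s(N + 2 := a)) out)
          ((s(N + 2 := a)) (N + 2) * 4 + 1) (st w (\<lambda>_. 0) (s(N := a)) out)"
        by (rule runs_transfer) (use clr in \<open>auto simp: fun_eq_iff\<close>)
      then have r5: "runs (transfer (N + 2) N) (st w (\<lambda>_. 0) (s(N + 2 := a)) out)
          9 (st w (\<lambda>_. 0) (s(N := a)) out)"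
        by (rule runs_weaken) (use a in auto)
      have "runs ?prog (st w (\<lambda>_. 0) s out) (?T B) (st w (\<lambda>_. 0) (s(N := a)) out)"
        by (rule runs_weaken[OF runs_Seq[OF r1 runs_Seq[OF r2 runs_Seq[OF r3 runs_Seq[OF r4 r5]]]]])
          (use \<open>n \<le> R B\<close> in auto)
      then show "runs ?prog (st w (\<lambda>_. 0) s out) (?T B)
          (st w (\<lambda>_. 0) (s(N := contents (w i) (int (f w (\<lambda>i. s (\<rho> i)))))) out)"
        by (simp only: a_def n_def)
    qed
  qed (auto simp: contents_def poly_bounded_const)
qed

text \<open>Variables are numbered from the innermost one: here the loop counter is 0, the accumulated
  value is 1, and the variables of the context are shifted by 2.\<close>

lemma upoly_loop:
  assumes a: "upoly a" and b: "upoly b"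
    and g: "upoly (\<lambda>w v. g w (v 0) (v 1) (\<lambda>n. v (Suc (Suc n))))"
    and R: "poly_bounded R"
      "\<And>w v B i. fits w v B \<Longrightarrow> i \<le> b w v \<Longrightarrow> rec_nat (a w v) (\<lambda>i y. g w i y v) i \<le> R B"
  shows "upoly (\<lambda>w v. rec_nat (a w v) (\<lambda>i y. g w i y v) (b w v))"
proof -
  obtain Rb where Rb: "poly_bounded Rb" "\<And>w v B. fits w v B \<Longrightarrow> b w v \<le> Rb B"
    using upoly_bound[OF b] by blast
  show ?thesis
  proof (rule upolyI[OF R(1)])
    fix \<rho> :: "nat \<Rightarrow> nat" and N assume \<rho>: "\<And>i. \<rho> i < N"
    obtain cb Tb where cb: "program_for b \<rho> N cb Tb"
      by (rule upoly_program[OF b \<rho>])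
    obtain ca Ta where ca: "program_for a \<rho> (Suc N) ca Ta"
      by (rule upoly_program[OF a less_SucI[OF \<rho>]])
    \<comment> \<open>Register \<open>N\<close> holds the number of remaining rounds,
      \<open>Suc N\<close> the accumulated value and \<open>N + 2\<close> the number of finished
      rounds, which is the counter that \<open>g\<close> sees. The program for \<open>g\<close>
      leaves its result in \<open>N + 3\<close>.\<close>
    define \<rho>' where "\<rho>' = case_nat (N + 2) (case_nat (Suc N) \<rho>)"
    have \<rho>': "\<rho>' k < N + 3" for k
      using trans_less_add1[OF \<rho>, of _ 3] by (auto simp: \<rho>'_def split: nat.split)
    obtain cg Tg where
      cg: "program_for (\<lambda>w v. g w (v 0) (v 1) (\<lambda>n. v (Suc (Suc n)))) \<rho>' (N + 3) cg Tg"
      by (rule upoly_program[OF g \<rho>'])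
    let ?body = "Seq cg (Seq (clear (Suc N)) (Seq (transfer (N + 3) (Suc N)) (Seq (inc (N + 2)) (dec N))))"
    let ?prog = "Seq cb (Seq ca (Seq (count_down N ?body) (Seq (clear (N + 2)) (transfer (Suc N) N))))"
    \<comment> \<open>Inside the loop the registers hold values up to \<open>D B\<close> instead of
      \<open>B\<close>, so the times of the inner programs are taken at \<open>D B\<close>. That the
      accumulated values stay below \<open>R B\<close> is what keeps the iteration
      polynomial.\<close>
    define D where "D B = B + Rb B + R B" for B
    let ?Tbody = "\<lambda>B. Suc (Tg (D B) + Suc (D B * 2 + 1 + Suc (D B * 4 + 1 + Suc (1 + 1))))"
    let ?T = "\<lambda>B. Suc (Tb B + Suc (Ta (D B) + Suc (D B * (?Tbody B + 1) + 1
      + Suc (D B * 2 + 1 + (D B * 4 + 1)))))"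
    show "\<exists>c T. poly_bounded T \<and> valid c \<and>
      (\<forall>w s B out. fits w s B \<longrightarrow> (\<forall>j\<ge>N. s j = 0) \<longrightarrow>
       runs c (st w (\<lambda>_. 0) s out) (T B) (st w (\<lambda>_. 0)
         (s(N := rec_nat (a w (\<lambda>i. s (\<rho> i))) (\<lambda>i y. g w i y (\<lambda>i. s (\<rho> i))) (b w (\<lambda>i. s (\<rho> i))))) out))"
    proof (intro exI conjI allI impI)
      have D: "poly_bounded D"
        unfolding D_def by (intro poly_bounded_intros R(1) Rb(1))
      show "poly_bounded ?T"
        by (intro poly_bounded_intros poly_bounded_comp[OF _ D] program_forD(1)[OF cg] D
          program_forD(1)[OF ca] program_forD(1)[OF cb])
      show "valid ?prog"
        using program_forD(2)[OF cg] program_forD(2)[OF cb] program_forD(2)[OF ca] by simp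
      fix w s B and out :: "bool list" assume fit: "fits w s B" and clr: "\<forall>j\<ge>N. s j = 0"
      define v where "v = (\<lambda>i. s (\<rho> i))"
      define n where "n = b w v"
      define val where "val = rec_nat (a w v) (\<lambda>i y. g w i y v)"
      have ne: "\<rho> k \<noteq> N + i" for k i using \<rho>[of k] by simp
      note ne0 = ne[of _ 0, simplified] and ne1 = ne[of _ 1, simplified] and ne2 = ne[of _ 2, simplified]
      have fitv: "fits w v B" using fit by (auto simp: fits_def v_def)
      have n: "n \<le> D B" using Rb(2)[OF fitv] by (auto simp: n_def D_def)
      have val: "val k \<le> D B" if "k \<le> n" for k
        using R(2)[OF fitv, of k] that by (auto simp: n_def D_def val_def)
      have "B \<le> D B" by (simp add: D_def)
      have fits_upd: "fits w (t(k := y)) (D B)" if "fits w t (D B)" "y \<le> D B" for t k y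
        using that by (auto simp: fits_def)
      have fitD: "fits w s (D B)" using fit \<open>B \<le> D B\<close> by (meson fits_def order_trans)
      have r1: "runs cb (st w (\<lambda>_. 0) s out) (Tb B) (st w (\<lambda>_. 0) (s(N := n)) out)"
        by (rule program_forD(3)[OF cb fit]) (use clr in \<open>auto simp: n_def v_def\<close>)
      have r2: "runs ca (st w (\<lambda>_. 0) (s(N := n)) out) (Ta (D B))
          (st w (\<lambda>_. 0) (s(N := n, Suc N := val 0)) out)"
        by (rule program_forD(3)[OF ca fits_upd[OF fitD n]])
          (use clr in \<open>auto simp: val_def v_def ne0\<close>)
      let ?s = "\<lambda>k. s(N := n - k, Suc N := val k, N + 2 := k)"
      have s0: "s(N := n, Suc N := val 0, Suc (Suc N) := 0) = s(N := n, Suc N := val 0)"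
        using clr by (auto simp: fun_eq_iff)
      have "runs ?body (st w (\<lambda>_. 0) (?s k) out) (?Tbody B) (st w (\<lambda>_. 0) (?s (Suc k)) out)"
        if k: "k < n" for k
      proof -
        have vk: "val (Suc k) = g w k (val k) v" by (simp add: val_def)
        have env: "(?s k) (\<rho>' 0) = k" "(?s k) (\<rho>' 1) = val k"
            "(\<lambda>i. (?s k) (\<rho>' (Suc (Suc i)))) = v"
          by (auto simp: \<rho>'_def v_def ne0 ne1 ne2)
        have q1: "runs cg (st w (\<lambda>_. 0) (?s k) out) (Tg (D B))
            (st w (\<lambda>_. 0) ((?s k)(N + 3 := val (Suc k))) out)"
          by (rule program_forD(3)[OF cg]) (use k n val[of k] clr in
            \<open>auto intro!: fits_upd fitD simp: vk env[simplified]\<close>)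
        have q2: "runs (clear (Suc N)) (st w (\<lambda>_. 0) ((?s k)(N + 3 := val (Suc k))) out) (D B * 2 + 1)
            (st w (\<lambda>_. 0) ((?s k)(Suc N := 0, N + 3 := val (Suc k))) out)"
          by (rule runs_weaken[OF runs_clear]) (use k val[of k] in \<open>auto simp: fun_eq_iff\<close>)
        have q3: "runs (transfer (N + 3) (Suc N)) (st w (\<lambda>_. 0) ((?s k)(Suc N := 0, N + 3 := val (Suc k))) out)
            (D B * 4 + 1) (st w (\<lambda>_. 0) ((?s k)(Suc N := val (Suc k))) out)"
          by (rule runs_weaken[OF runs_transfer])
            (use k val[of "Suc k"] clr in \<open>auto simp: fun_eq_iff\<close>)
        have q4: "runs (inc (N + 2)) (st w (\<lambda>_. 0) ((?s k)(Suc N := val (Suc k))) out) 1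
            (st w (\<lambda>_. 0) ((?s k)(Suc N := val (Suc k), N + 2 := Suc k)) out)"
          by (rule runs_inc) (auto simp: fun_eq_iff)
        have q5: "runs (dec N) (st w (\<lambda>_. 0) ((?s k)(Suc N := val (Suc k), N + 2 := Suc k)) out) 1
            (st w (\<lambda>_. 0) (?s (Suc k)) out)"
          by (rule runs_dec) (use k in \<open>auto simp: fun_eq_iff\<close>)
        show ?thesis by (rule runs_Seq[OF q1 runs_Seq[OF q2 runs_Seq[OF q3 runs_Seq[OF q4 q5]]]])
      qed
      then have r3: "runs (count_down N ?body) (st w (\<lambda>_. 0) (s(N := n, Suc N := val 0)) out)
          (n * (?Tbody B + 1) + 1) (st w (\<lambda>_. 0) (?s n) out)"
        by (rule runs_count_down[where s = ?s and h = "\<lambda>_ _. 0" and out = "\<lambda>_. out"])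
          (simp_all add: s0)
      have r4: "runs (clear (N + 2)) (st w (\<lambda>_. 0) (?s n) out) (D B * 2 + 1)
          (st w (\<lambda>_. 0) (s(Suc N := val n)) out)"
        by (rule runs_weaken[OF runs_clear]) (use n clr in \<open>auto simp: fun_eq_iff\<close>)
      have r5: "runs (transfer (Suc N) N) (st w (\<lambda>_. 0) (s(Suc N := val n)) out) (D B * 4 + 1)
          (st w (\<lambda>_. 0) (s(N := val n)) out)"
        by (rule runs_weaken[OF runs_transfer])
          (use val[of n] clr in \<open>auto simp: fun_eq_iff\<close>)
      have "n * (?Tbody B + 1) \<le> D B * (?Tbody B + 1)" using n by (rule mult_le_mono1)
      then have "runs ?prog (st w (\<lambda>_. 0) s out) (?T B) (st w (\<lambda>_. 0) (s(N := val n)) out)"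
        by (intro runs_weaken[OF runs_Seq[OF r1 runs_Seq[OF r2 runs_Seq[OF r3 runs_Seq[OF r4 r5]]]]])
          linarith
      then show "runs ?prog (st w (\<lambda>_. 0) s out) (?T B) (st w (\<lambda>_. 0)
         (s(N := rec_nat (a w (\<lambda>i. s (\<rho> i))) (\<lambda>i y. g w i y (\<lambda>i. s (\<rho> i))) (b w (\<lambda>i. s (\<rho> i))))) out)"
        by (simp only: n_def val_def v_def)
    qed
  qed (use R(2) in auto)
qed

section \<open>Composition and arithmetic\<close>

lemma upoly_const: "upoly (\<lambda>w v. c)"
  by (induction c) (rule upoly_0, erule upoly_Suc)

text \<open>A loop with a single round does this: it starts from the value of \<open>f\<close>,
  which \<open>g\<close> then finds in the variable of the accumulated value.\<close>

lemma upoly_let: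
  assumes f: "upoly f" and g: "upoly (\<lambda>w v. g w (v 0) (\<lambda>n. v (Suc n)))"
  shows "upoly (\<lambda>w v. g w (f w v) v)"
proof -
  obtain Rf where Rf: "poly_bounded Rf" "\<And>w v B. fits w v B \<Longrightarrow> f w v \<le> Rf B"
    using upoly_bound[OF f] by blast
  obtain Rg where Rg: "poly_bounded Rg" "\<And>w v B. fits w v B \<Longrightarrow> g w (v 0) (\<lambda>n. v (Suc n)) \<le> Rg B"
    using upoly_bound[OF g] by blast
  have "upoly (\<lambda>w v. rec_nat (f w v) (\<lambda>i y. g w y v) 1)"
  proof (rule upoly_loop[where R = "\<lambda>B. Rf B + Rg (B + Rf B)"])
    show "upoly (\<lambda>w v. g w (v 1) (\<lambda>n. v (Suc (Suc n))))"
      using upoly_rename[OF g, of Suc] by simp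
    show "poly_bounded (\<lambda>B. Rf B + Rg (B + Rf B))"
      by (intro poly_bounded_add poly_bounded_comp[OF Rg(1)] poly_bounded_id Rf(1))
    fix w v B i assume fit: "fits w v B" and i: "i \<le> (1 :: nat)"
    have "fits w (case_nat (f w v) v) (B + Rf B)"
      using fit Rf(2)[OF fit] by (auto simp: fits_def trans_le_add1 split: nat.split)
    from Rg(2)[OF this] have "g w (f w v) v \<le> Rg (B + Rf B)" by simp
    then show "rec_nat (f w v) (\<lambda>i y. g w y v) i \<le> Rf B + Rg (B + Rf B)"
      using i Rf(2)[OF fit] by (cases i) auto
  qed (auto intro: upoly_const f)
  then show ?thesis by simp
qed

lemma upoly_comp1:
  assumes "upoly (\<lambda>w v. F w (v 0))" "upoly a"
  shows "upoly (\<lambda>w v. F w (a w v))"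
  by (rule upoly_let[where g = "\<lambda>w x v. F w x", OF assms(2,1)])

lemma upoly_comp2:
  assumes "upoly (\<lambda>w v. F w (v 0) (v 1))" "upoly a" "upoly b"
  shows "upoly (\<lambda>w v. F w (a w v) (b w v))"
proof -
  \<comment> \<open>Renaming by \<open>\<lambda>n. 1 - n\<close> exchanges the variables 0 and
    1.\<close>
  have "upoly (\<lambda>w v. F w (v 1) (v 0))"
    using upoly_rename[OF assms(1), of "\<lambda>n. 1 - n"] by simp
  from upoly_let[where g = "\<lambda>w y v. F w (v 0) y", OF upoly_rename[OF assms(3), of Suc]] this
  have "upoly (\<lambda>w v. F w (v 0) (b w (\<lambda>n. v (Suc n))))" by simp
  from upoly_let[where g = "\<lambda>w x v. F w x (b w v)", OF assms(2) this] show ?thesis .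
qed

lemma upoly_add:
  assumes "upoly f" "upoly g"
  shows "upoly (\<lambda>w v. f w v + g w v)"
proof -
  have rec: "rec_nat a (\<lambda>i y. Suc y) i = a + i" for a i :: nat by (induction i) auto
  obtain Rf where Rf: "poly_bounded Rf" "\<And>w v B. fits w v B \<Longrightarrow> f w v \<le> Rf B"
    using upoly_bound[OF assms(1)] by blast
  obtain Rg where Rg: "poly_bounded Rg" "\<And>w v B. fits w v B \<Longrightarrow> g w v \<le> Rg B"
    using upoly_bound[OF assms(2)] by blast
  have "upoly (\<lambda>w v. rec_nat (f w v) (\<lambda>i y. Suc y) (g w v))"
  proof (rule upoly_loop[where R = "\<lambda>B. Rf B + Rg B"])
    show "rec_nat (f w v) (\<lambda>i y. Suc y) i \<le> Rf B + Rg B" if "fits w v B" "i \<le> g w v" for w v B i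
      using Rf(2)[OF that(1)] Rg(2)[OF that(1)] that(2) by (simp add: rec)
  qed (use assms Rf Rg in \<open>auto intro: upoly_Suc upoly_var poly_bounded_add\<close>)
  then show ?thesis by (simp add: rec)
qed

text \<open>A loop that always returns its counter ends with the predecessor of the number of
  rounds; iterating the predecessor subtracts.\<close>

lemma upoly_diff:
  assumes "upoly f" "upoly g"
  shows "upoly (\<lambda>w v. f w v - g w v)"
proof -
  have pred: "rec_nat 0 (\<lambda>i y. i) i = i - 1" for i :: nat by (cases i) auto
  have "upoly (\<lambda>w v. rec_nat 0 (\<lambda>i y. i) (v 0))"
    by (rule upoly_loop[where R = "\<lambda>B. B"])
      (auto intro: upoly_0 upoly_var poly_bounded_id simp: pred fits_def le_diff_conv dest: order_trans
        intro: trans_le_add1)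
  then have p: "upoly (\<lambda>w v. v 0 - 1)" by (simp add: pred)
  have rec: "rec_nat a (\<lambda>i y. y - 1) i = a - i" for a i :: nat by (induction i) auto
  obtain Rf where Rf: "poly_bounded Rf" "\<And>w v B. fits w v B \<Longrightarrow> f w v \<le> Rf B"
    using upoly_bound[OF assms(1)] by blast
  have "upoly (\<lambda>w v. rec_nat (f w v) (\<lambda>i y. y - 1) (g w v))"
    by (rule upoly_loop[where R = Rf])
      (use assms Rf in \<open>auto intro: upoly_comp1[where F = "\<lambda>w x. x - 1", OF p, unfolded One_nat_def]
          upoly_var trans_le_add1 simp: rec[unfolded One_nat_def] le_diff_conv\<close>)
  then show ?thesis unfolding rec .
qed

lemma upoly_sum:
  assumes b: "upoly b" and g: "upoly (\<lambda>w v. g w (v 0) (\<lambda>n. v (Suc n)))"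
  shows "upoly (\<lambda>w v. \<Sum>i<b w v. g w i v)"
proof -
  have rec: "rec_nat 0 (\<lambda>i y. y + h i) i = (\<Sum>j<i. h j)" for h and i :: nat
    by (induction i) auto
  obtain Rb where Rb: "poly_bounded Rb" "\<And>w v B. fits w v B \<Longrightarrow> b w v \<le> Rb B"
    using upoly_bound[OF b] by blast
  obtain Rg where Rg: "poly_bounded Rg" "\<And>w v B. fits w v B \<Longrightarrow> g w (v 0) (\<lambda>n. v (Suc n)) \<le> Rg B"
    using upoly_bound[OF g] by blast
  have "upoly (\<lambda>w v. rec_nat 0 (\<lambda>i y. y + g w i v) (b w v))"
  proof (rule upoly_loop[where R = "\<lambda>B. Rb B * Rg (B + Rb B)"])
    have "upoly (\<lambda>w v. g w (v 0) (\<lambda>n. v (Suc (Suc n))))"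
      using upoly_rename[OF g, of "case_nat 0 (\<lambda>n. n + 2)"] by simp
    then show "upoly (\<lambda>w v. v 1 + g w (v 0) (\<lambda>n. v (Suc (Suc n))))"
      by (intro upoly_add upoly_var)
    show "poly_bounded (\<lambda>B. Rb B * Rg (B + Rb B))"
      by (intro poly_bounded_mult poly_bounded_add poly_bounded_comp[OF Rg(1)] poly_bounded_id Rb(1))
    fix w v B i assume fit: "fits w v B" and i: "i \<le> b w v"
    have "g w j v \<le> Rg (B + Rb B)" if "j < i" for j
    proof -
      have "j \<le> Rb B" using that i Rb(2)[OF fit] by simp
      then have "fits w (case_nat j v) (B + Rb B)"
        using fit by (auto simp: fits_def trans_le_add1 split: nat.split)
      from Rg(2)[OF this] show ?thesis by simp
    qed
    then have "(\<Sum>j<i. g w j v) \<le> i * Rg (B + Rb B)"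
      using sum_bounded_above[of "{..<i}" "\<lambda>j. g w j v" "Rg (B + Rb B)"] by simp
    also have "\<dots> \<le> Rb B * Rg (B + Rb B)"
      using i Rb(2)[OF fit] by (intro mult_le_mono1) simp
    finally show "rec_nat 0 (\<lambda>i y. y + g w i v) i \<le> Rb B * Rg (B + Rb B)" by (simp add: rec)
  qed (auto intro: upoly_0 b)
  then show ?thesis by (simp add: rec)
qed

lemma upoly_mult:
  assumes "upoly f" "upoly g"
  shows "upoly (\<lambda>w v. f w v * g w v)"
  using upoly_sum[OF assms(1), of "\<lambda>w i v. g w v"] upoly_rename[OF assms(2), of Suc] by simp

section \<open>Predicates, bounded quantifiers and division\<close>

abbreviation upred :: "((nat \<Rightarrow> bool list) \<Rightarrow> (nat \<Rightarrow> nat) \<Rightarrow> bool) \<Rightarrow> bool" where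
  "upred P \<equiv> upoly (\<lambda>w v. of_bool (P w v))"

lemma upred_True: "upred (\<lambda>w v. True)" and upred_False: "upred (\<lambda>w v. False)"
  using upoly_const[of 1] upoly_const[of 0] by simp_all

lemma upred_le:
  assumes "upoly f" "upoly g" shows "upred (\<lambda>w v. f w v \<le> g w v)"
proof -
  have "of_bool (a \<le> b) = 1 - (a - b)" for a b :: nat by auto
  then show ?thesis
    using upoly_diff[OF upoly_const[of 1] upoly_diff[OF assms]] by simp
qed

lemma upred_less:
  assumes "upoly f" "upoly g" shows "upred (\<lambda>w v. f w v < g w v)"
  using upred_le[OF upoly_Suc[OF assms(1)] assms(2)] by (simp add: Suc_le_eq)

lemma upred_not:
  assumes "upred P" shows "upred (\<lambda>w v. \<not> P w v)"
proof -
  have "of_bool (\<not> b) = (1 :: nat) - of_bool b" for b by (cases b) auto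
  then show ?thesis using upoly_diff[OF upoly_const[of 1] assms] by simp
qed

lemma upred_conj: "upred P \<Longrightarrow> upred Q \<Longrightarrow> upred (\<lambda>w v. P w v \<and> Q w v)"
  using upoly_mult[of "\<lambda>w v. of_bool (P w v)" "\<lambda>w v. of_bool (Q w v)"] by (simp add: of_bool_conj)

lemma upred_disj:
  assumes "upred P" "upred Q" shows "upred (\<lambda>w v. P w v \<or> Q w v)"
  using upred_not[OF upred_conj[OF upred_not upred_not], OF assms] by simp

lemma upred_imp:
  assumes "upred P" "upred Q" shows "upred (\<lambda>w v. P w v \<longrightarrow> Q w v)"
  unfolding imp_conv_disj by (intro upred_disj upred_not assms)

lemma upred_eq:
  assumes "upoly f" "upoly g" shows "upred (\<lambda>w v. f w v = g w v)"
proof -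
  have "upred (\<lambda>w v. f w v \<le> g w v \<and> g w v \<le> f w v)"
    by (intro upred_conj upred_le assms)
  then show ?thesis by (simp only: eq_iff[symmetric])
qed

lemma upred_iff:
  assumes "upred P" "upred Q" shows "upred (\<lambda>w v. P w v = Q w v)"
  using upred_eq[OF assms] by (simp add: of_bool_eq_iff)

lemma upred_ex:
  assumes b: "upoly b" and P: "upred (\<lambda>w v. P w (v 0) (\<lambda>n. v (Suc n)))"
  shows "upred (\<lambda>w v. \<exists>i<b w v. P w i v)"
proof -
  have "upred (\<lambda>w v. 0 < (\<Sum>i<b w v. of_bool (P w i v) :: nat))"
    by (intro upred_less upoly_0 upoly_sum b P)
  moreover have "0 < (\<Sum>i<m. of_bool (Q i) :: nat) \<longleftrightarrow> (\<exists>i<m. Q i)" for m :: nat and Q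
    by (auto simp: zero_less_iff_neq_zero)
  ultimately show ?thesis by simp
qed

lemma upred_all:
  assumes b: "upoly b" and P: "upred (\<lambda>w v. P w (v 0) (\<lambda>n. v (Suc n)))"
  shows "upred (\<lambda>w v. \<forall>i<b w v. P w i v)"
proof -
  have "upred (\<lambda>w v. \<not> (\<exists>i<b w v. \<not> P w i v))"
    by (intro upred_not upred_ex b P)
  then show ?thesis by simp
qed

lemma upoly_if:
  assumes "upred P" "upoly f" "upoly g"
  shows "upoly (\<lambda>w v. if P w v then f w v else g w v)"
proof -
  have "upoly (\<lambda>w v. of_bool (P w v) * f w v + of_bool (\<not> P w v) * g w v)"
    by (intro upoly_add upoly_mult upred_not assms)
  moreover have "(\<lambda>w v. of_bool (P w v) * f w v + of_bool (\<not> P w v) * g w v)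
      = (\<lambda>w v. if P w v then f w v else g w v)"
    by (auto simp: fun_eq_iff)
  ultimately show ?thesis by simp
qed

lemma upred_if:
  assumes "upred P" "upred f" "upred g"
  shows "upred (\<lambda>w v. if P w v then f w v else g w v)"
proof -
  have "(\<lambda>w v. of_bool (if P w v then f w v else g w v) :: nat)
      = (\<lambda>w v. if P w v then of_bool (f w v) else of_bool (g w v))"
    by (auto simp: fun_eq_iff)
  then show ?thesis using upoly_if[OF assms] by simp
qed

text \<open>The quotient counts the positive multiples of \<open>b\<close> up to \<open>a\<close>,
  so division becomes a bounded sum. The conjunct \<open>0 < b\<close> accounts for division by
  0.\<close>

lemma div_eq_sum: "a div b = (\<Sum>i<a. of_bool (0 < b \<and> (i + 1) * b \<le> a))" for a b :: nat
proof (cases "b = 0")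
  case False
  have "{i. i < a \<and> (i + 1) * b \<le> a} = {..<a div b}"
  proof -
    have "(i + 1) * b \<le> a \<longleftrightarrow> i < a div b" for i
      using False less_eq_div_iff_mult_less_eq[of b "i + 1" a] by (simp add: Suc_le_eq)
    moreover have "i < a" if "i < a div b" for i
      using that div_le_dividend[of a b] by linarith
    ultimately show ?thesis by auto
  qed
  moreover have "{..<a} \<inter> {i. (i + 1) * b \<le> a} = {i. i < a \<and> (i + 1) * b \<le> a}" by auto
  ultimately show ?thesis
    using False by (simp add: of_bool_def sum.If_cases)
qed simp

lemma upoly_div:
  assumes "upoly f" "upoly g" shows "upoly (\<lambda>w v. f w v div g w v)"
proof -
  have "upoly (\<lambda>w v. \<Sum>i<f w v. of_bool (0 < g w v \<and> (i + 1) * g w v \<le> f w v))"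
    by (intro upoly_sum assms upred_conj upred_less upred_le upoly_mult upoly_add upoly_const
      upoly_var upoly_rename[OF assms(1)] upoly_rename[OF assms(2)])
  then show ?thesis by (simp only: div_eq_sum[symmetric])
qed

lemma upoly_mod:
  assumes "upoly f" "upoly g" shows "upoly (\<lambda>w v. f w v mod g w v)"
  unfolding modulo_nat_def by (intro upoly_diff upoly_mult upoly_div assms)

lemma upred_even: "upoly f \<Longrightarrow> upred (\<lambda>w v. even (f w v))"
  unfolding even_iff_mod_2_eq_zero by (intro upred_eq upoly_mod upoly_const)

text \<open>The power of 2 may be exponential and is never computed. Repeated halving has the same
  effect and stays below the value of \<open>f\<close>.\<close>

lemma upoly_shift_div:
  assumes "upoly f" "upoly g"
  shows "upoly (\<lambda>w v. f w v div 2 ^ g w v)"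
proof -
  have rec: "rec_nat a (\<lambda>i y. y div 2) i = a div 2 ^ i" for a i :: nat
    by (induction i) (auto simp: div_mult2_eq power_Suc2 simp del: power_Suc)
  obtain Rf where Rf: "poly_bounded Rf" "\<And>w v B. fits w v B \<Longrightarrow> f w v \<le> Rf B"
    using upoly_bound[OF assms(1)] by blast
  have "upoly (\<lambda>w v. rec_nat (f w v) (\<lambda>i y. y div 2) (g w v))"
  proof (rule upoly_loop[where R = Rf])
    show "upoly (\<lambda>w v. v 1 div 2)" by (intro upoly_div upoly_var upoly_const)
    show "rec_nat (f w v) (\<lambda>i y. y div 2) i \<le> Rf B" if "fits w v B" for w v B i
      unfolding rec using Rf(2)[OF that] div_le_dividend order_trans by blast
  qed (use assms Rf in auto)
  then show ?thesis by (simp add: rec)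
qed

lemma upoly_poly:
  assumes "upoly f"
  shows "upoly (\<lambda>w v. poly p (f w v))"
proof (induction p)
  case 0
  show ?case by (simp add: upoly_0)
next
  case (pCons a p)
  have "upoly (\<lambda>w v. a + f w v * poly p (f w v))"
    by (intro upoly_add upoly_mult upoly_const assms pCons.IH)
  then show ?case by simp
qed

text \<open>Since \<open>Z\<close> is a constant, the distinction is unrolled into nested
  conditionals, with a program of its own for each case. In this way the finite table of a fixed
  machine becomes part of a program.\<close>

lemma upoly_cases:
  assumes "\<And>i. upoly (f i)" "upoly a"
  shows "upoly (\<lambda>w v. if a w v < Z then f (a w v) w v else 0)"
proof (induction Z)
  case 0
  then show ?case by (simp add: upoly_const)
next
  case (Suc Z)
  have "upoly (\<lambda>w v. if a w v = Z then f Z w v else if a w v < Z then f (a w v) w v else 0)"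
    by (intro upoly_if upred_eq upoly_const assms Suc.IH)
  moreover have "(\<lambda>w v. if a w v = Z then f Z w v else if a w v < Z then f (a w v) w v else 0)
      = (\<lambda>w v. if a w v < Suc Z then f (a w v) w v else 0)"
    by (auto simp: fun_eq_iff)
  ultimately show ?case by simp
qed

lemmas upoly_basic = upoly_const upoly_Suc upoly_var upoly_length upoly_contents upoly_add upoly_diff
  upoly_mult upoly_sum upoly_if upoly_div upoly_mod upoly_shift_div upoly_poly
  upred_True upred_False upred_le upred_less upred_not upred_conj upred_disj upred_imp upred_eq
  upred_iff upred_ex upred_all upred_if upred_even

section \<open>From register programs to polynomial-time machines\<close>

text \<open>The marks in cell 0 of the register tapes have to be written before the program starts.\<close>

fun mark :: "nat \<Rightarrow> cmd" where
  "mark 0 = Move Out Stay"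
| "mark (Suc k) = Seq (mark k) (Write (Reg k) 1)"

definition unmarked :: "(nat \<Rightarrow> bool list) \<Rightarrow> nat \<Rightarrow> nat \<Rightarrow> store" where
  "unmarked w k K j = (case j of Reg r \<Rightarrow> if k \<le> r \<and> r < K then (\<lambda>_. 0, 0) else (\<lambda>p. if p = 0 then 1 else 0, 0)
    | _ \<Rightarrow> st w (\<lambda>_. 0) (\<lambda>_. 0) [] j)"

lemma runs_mark: "k \<le> K \<Longrightarrow> runs (mark k) (unmarked w 0 K) (2 * k + 1) (unmarked w k K)"
proof (induction k)
  case 0
  show ?case
    by (simp, rule runs_MoveI[unfolded One_nat_def]) (auto simp: fun_eq_iff)
next
  case (Suc k)
  have "runs (Write (Reg k) 1) (unmarked w k K) 1 (unmarked w (Suc k) K)"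
  proof -
    have "unmarked w (Suc k) K = (unmarked w k K)(Reg k := ((fst (unmarked w k K (Reg k)))
        (snd (unmarked w k K (Reg k)) := 1), snd (unmarked w k K (Reg k))))"
      using Suc.prems by (auto simp: unmarked_def fun_eq_iff not_le less_Suc_eq split: tid.splits)
    then show ?thesis unfolding runs_def using exec.Write by (metis order_refl)
  qed
  from runs_Seq[OF Suc.IH this] show ?case using Suc.prems by simp
qed

lemma over_mark: "k \<le> K \<Longrightarrow> over (area K) (mark k)"
  by (induction k) (auto simp: area_def)

lemma contents_append: "contents (out @ [b]) = (contents out)(int (length out) := if b then 2 else 1)"
  by (auto simp: contents_def fun_eq_iff nth_append)

lemma runs_emit:
  "runs (Seq (Write Out (if b then 2 else 1)) (Move Out Right)) (st w h s out) 3 (st w h s (out @ [b]))"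
proof -
  let ?a = "if b then 2 else 1" and ?\<sigma> = "st w h s out"
  let ?\<sigma>' = "?\<sigma>(Out := ((fst (?\<sigma> Out))(snd (?\<sigma> Out) := ?a), snd (?\<sigma> Out)))"
  have "runs (Write Out ?a) ?\<sigma> 1 ?\<sigma>'"
    unfolding runs_def using exec.Write by blast
  moreover have "runs (Move Out Right) ?\<sigma>' 1 (st w h s (out @ [b]))"
    by (rule runs_MoveI) (auto simp: st_def fun_eq_iff contents_append split: tid.splits)
  ultimately show ?thesis by (rule runs_weaken[OF runs_Seq]) simp
qed

definition inputs :: "bool list list \<Rightarrow> nat \<Rightarrow> bool list" where
  "inputs ws i = (if i < length ws then ws ! i else [])"

text \<open>A word is given by its length and by its bit at each position, both functions of the
  class. So programs only ever handle numbers, and a single loop emits the bits from left to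
  right.\<close>

theorem polytime_by_upoly:
  assumes l: "upoly (\<lambda>w v. l w)" and e: "upred (\<lambda>w v. e w (v 0))"
  shows "polytime a (\<lambda>ws. map (e (inputs ws)) [0..<l (inputs ws)])"
proof -
  obtain Rl where Rl: "poly_bounded Rl" "\<And>w v B. fits w v B \<Longrightarrow> l w \<le> Rl B"
    using upoly_bound[OF l] by blast
  obtain cl Tl where cl: "program_for (\<lambda>w v. l w) (\<lambda>_. 0) 1 cl Tl"
    by (rule upoly_program[OF l, of "\<lambda>_. 0" 1]) auto
  obtain ce Te where ce: "program_for (\<lambda>w v. of_bool (e w (v 0))) (\<lambda>_. 0) 2 ce Te"
    by (rule upoly_program[OF e, of "\<lambda>_. 0" 2]) auto
  let ?emit = "\<lambda>b. Seq (Write Out (if b then 2 else 1)) (Move Out Right)"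
  let ?body = "Seq ce (Seq (If (Reg 2) (\<lambda>a. a \<noteq> 1) (?emit True) (?emit False))
    (Seq (clear 2) (Seq (inc 0) (dec 1))))"
  \<comment> \<open>Register 0 is the current position, register 1 the number of bits still to be
    written and register 2 the current bit.\<close>
  define main where "main = Seq cl (count_down 1 ?body)"
  define D where "D B = B + Rl B" for B
  let ?Tbody = "\<lambda>B. Suc (Te (D B) + Suc (Suc 3 + Suc (3 + Suc (1 + 1))))"
  define T where "T B = Suc (Tl B + (D B * (?Tbody B + 1) + 1))" for B
  have D: "poly_bounded D" unfolding D_def by (intro poly_bounded_intros Rl(1))
  have T: "poly_bounded T"
    unfolding T_def by (intro poly_bounded_intros poly_bounded_comp[OF _ D] program_forD(1)[OF ce] D
      program_forD(1)[OF cl])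
  have "valid main"
    using program_forD(2)[OF ce] program_forD(2)[OF cl] by (simp add: main_def)
  have run: "runs main (st w (\<lambda>_. 0) (\<lambda>_. 0) []) (T B)
      (st w (\<lambda>_. 0) ((\<lambda>_. 0)(0 := l w)) (map (e w) [0..<l w]))" if fit: "fits w (\<lambda>_. 0) B" for w B
  proof -
    define n where "n = l w"
    have n: "n \<le> D B" using Rl(2)[OF fit] by (simp add: n_def D_def)
    have "runs cl (st w (\<lambda>_. 0) (\<lambda>_. 0) []) (Tl B) (st w (\<lambda>_. 0) ((\<lambda>_. 0)(1 := n)) [])"
      by (rule program_forD(3)[OF cl fit]) (auto simp: n_def)
    moreover
    let ?s = "\<lambda>k. (\<lambda>_. 0)(0 := k, 1 := n - k)" and ?o = "\<lambda>k. map (e w) [0..<k]"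
    have "runs ?body (st w (\<lambda>_. 0) (?s k) (?o k)) (?Tbody B) (st w (\<lambda>_. 0) (?s (Suc k)) (?o (Suc k)))"
      if k: "k < n" for k
    proof -
      have "fits w (?s k) (D B)"
        using fit k n by (auto simp: fits_def D_def trans_le_add1)
      then have q1: "runs ce (st w (\<lambda>_. 0) (?s k) (?o k)) (Te (D B))
          (st w (\<lambda>_. 0) ((?s k)(2 := of_bool (e w k))) (?o k))"
        by (rule program_forD(3)[OF ce]) auto
      have q2: "runs (If (Reg 2) (\<lambda>a. a \<noteq> 1) (?emit True) (?emit False))
          (st w (\<lambda>_. 0) ((?s k)(2 := of_bool (e w k))) (?o k)) (Suc 3)
          (st w (\<lambda>_. 0) ((?s k)(2 := of_bool (e w k))) (?o (Suc k)))"
        using runs_emit[of "e w k" w "\<lambda>_. 0" "(?s k)(2 := of_bool (e w k))" "?o k"]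
        by (intro runs_If) (auto simp: read_Reg split: if_splits)
      have q3: "runs (clear 2) (st w (\<lambda>_. 0) ((?s k)(2 := of_bool (e w k))) (?o (Suc k))) 3
          (st w (\<lambda>_. 0) (?s k) (?o (Suc k)))"
        by (rule runs_weaken[OF runs_clear]) (auto simp: fun_eq_iff)
      have q4: "runs (inc 0) (st w (\<lambda>_. 0) (?s k) (?o (Suc k))) 1
          (st w (\<lambda>_. 0) ((?s k)(0 := Suc k)) (?o (Suc k)))"
        by (rule runs_inc) (auto simp: fun_eq_iff)
      have q5: "runs (dec 1) (st w (\<lambda>_. 0) ((?s k)(0 := Suc k)) (?o (Suc k))) 1
          (st w (\<lambda>_. 0) (?s (Suc k)) (?o (Suc k)))"
        by (rule runs_dec) (use k in \<open>auto simp: fun_eq_iff\<close>)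
      show ?thesis by (rule runs_Seq[OF q1 runs_Seq[OF q2 runs_Seq[OF q3 runs_Seq[OF q4 q5]]]])
    qed
    then have "runs (count_down 1 ?body) (st w (\<lambda>_. 0) ((\<lambda>_. 0)(1 := n)) []) (n * (?Tbody B + 1) + 1)
        (st w (\<lambda>_. 0) ((\<lambda>_. 0)(0 := n)) (?o n))"
      by (rule runs_count_down[where s = ?s and h = "\<lambda>_ _. 0" and out = ?o])
        (auto intro!: arg_cong[of _ _ "\<lambda>s. st w (\<lambda>_. 0) s (?o n)"] arg_cong[of _ _ "\<lambda>s. st w (\<lambda>_. 0) s []"])
    moreover have "n * (?Tbody B + 1) \<le> D B * (?Tbody B + 1)" using n by (rule mult_le_mono1)
    ultimately show ?thesis
      unfolding main_def T_def n_def by (intro runs_weaken[OF runs_Seq]) auto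
  qed
  obtain K where K: "over (area K) main" using valid_over[OF \<open>valid main\<close>] by blast
  \<comment> \<open>The inputs have to come first and the output last. There are at least
    \<open>a\<close> input tapes for the arguments, and at least \<open>K\<close> to cover
    \<open>area K\<close>; those from \<open>a\<close> on are blank.\<close>
  define ord where "ord = map In [0..<K + a] @ map Reg [0..<K] @ [Out]"
  have "distinct ord" by (auto simp: ord_def distinct_map inj_on_def)
  moreover have "area K \<subseteq> set ord" by (auto simp: ord_def area_def)
  then have "over (set ord) (Seq (mark K) main)"
    using over_mono[OF K] over_mono[OF over_mark[of K K]] by simp
  ultimately obtain M where M: "turing_machine M" "tapes M = length ord"
    "\<And>\<sigma> t \<sigma>'. exec (Seq (mark K) main) \<sigma> t \<sigma>' \<Longrightarrow>
       (step M ^^ t) (0, map \<sigma> ord) = (states M, map \<sigma>' ord)"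
    using machine_of_command by blast
  have "poly_bounded (\<lambda>B. Suc (2 * K + 1 + T B))"
    by (intro poly_bounded_intros T)
  then obtain k where k: "\<And>B. Suc (2 * K + 1 + T B) \<le> (B + 2) ^ k"
    unfolding poly_bounded_def by blast
  have "computes_within M ws (map (e (inputs ws)) [0..<l (inputs ws)])
      (poly ([:2, 1:] ^ k) (sum_list (map length ws)))" if ws: "length ws = a" for ws
  proof -
    let ?w = "inputs ws" and ?B = "sum_list (map length ws)"
    have "fits ?w (\<lambda>_. 0) ?B"
      by (auto simp: fits_def inputs_def intro: member_le_sum_list)
    moreover have "unmarked ?w K K = st ?w (\<lambda>_. 0) (\<lambda>_. 0) []"
      by (auto simp: unmarked_def st_def fun_eq_iff split: tid.splits)
    ultimately have "runs (Seq (mark K) main) (unmarked ?w 0 K) (Suc (2 * K + 1 + T ?B))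
        (st ?w (\<lambda>_. 0) ((\<lambda>_. 0)(0 := l ?w)) (map (e ?w) [0..<l ?w]))"
      using runs_Seq[OF runs_mark[OF order_refl, of K ?w], of main "T ?B"] run by simp
    then obtain t where t: "t \<le> (?B + 2) ^ k" "exec (Seq (mark K) main) (unmarked ?w 0 K) t
        (st ?w (\<lambda>_. 0) ((\<lambda>_. 0)(0 := l ?w)) (map (e ?w) [0..<l ?w]))"
      using k[of ?B] unfolding runs_def by (meson order_trans)
    have "map (unmarked ?w 0 K) ord = snd (initial M ws)"
    proof (rule nth_equalityI)
      show "length (map (unmarked ?w 0 K) ord) = length (snd (initial M ws))"
        by (simp add: initial_def M(2))
      fix i assume "i < length (map (unmarked ?w 0 K) ord)"
      then have i: "i < length ord" by simp
      have nil: "contents [] = (\<lambda>_. 0)" by (auto simp: contents_def)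
      consider "i < K + a" | "K + a \<le> i" "i < K + a + K" | "i = K + a + K"
        using i by (fastforce simp: ord_def)
      then have "unmarked ?w 0 K (ord ! i) = (contents (inputs ws i), 0)"
      proof cases
        case 1
        then show ?thesis by (simp add: ord_def nth_append unmarked_def st_def)
      next
        case 2
        then show ?thesis using ws
          by (auto simp: ord_def nth_append unmarked_def st_def inputs_def nil)
      next
        case 3
        then show ?thesis using ws
          by (auto simp: ord_def nth_append unmarked_def st_def inputs_def)
      qed
      then show "map (unmarked ?w 0 K) ord ! i = snd (initial M ws) ! i"
        using i by (simp add: initial_def M(2) inputs_def)
    qed
    moreover have "fst (initial M ws) = 0" by (simp add: initial_def)
    ultimately have "(0, map (unmarked ?w 0 K) ord) = initial M ws" by (simp add: prod_eq_iff)
    with M(3)[OF t(2)] have "(step M ^^ t) (initial M ws) =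
        (states M, map (st ?w (\<lambda>_. 0) ((\<lambda>_. 0)(0 := l ?w)) (map (e ?w) [0..<l ?w])) ord)"
      by simp
    moreover have "length ws < tapes M" using ws by (simp add: M(2) ord_def)
    moreover have "last (map (st ?w (\<lambda>_. 0) ((\<lambda>_. 0)(0 := l ?w)) (map (e ?w) [0..<l ?w])) ord)
        = (contents (map (e ?w) [0..<l ?w]), int (l ?w))"
      by (simp add: ord_def st_def)
    moreover have "poly ([:2, 1:] ^ k) ?B = (?B + 2) ^ k"
      by (simp add: add.commute)
    ultimately show ?thesis
      unfolding computes_within_def using t(1) by auto
  qed
  then show ?thesis unfolding polytime_def using M(1) by blast
qed

section \<open>The code of an instance\<close>

lemma map_upt_Suc2: "map f [0..<Suc (Suc n)] = f 0 # f 1 # map (\<lambda>i. f (Suc (Suc i))) [0..<n]"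
  by (simp only: map_upt_Suc One_nat_def)

lemma map_upt_offset: "map f [b..<b + k] = map (\<lambda>i. f (i + b)) [0..<k]"
  by (rule nth_equalityI) (auto simp: add.commute)

lemma delimit_conv:
  "delimit w = map (\<lambda>i. i \<noteq> 2 * length w \<and> (even i \<or> w ! (i div 2))) [0..<Suc (2 * length w)]"
proof (induction w)
  case Nil
  show ?case by (simp add: delimit_def)
next
  case (Cons b w)
  have "delimit (b # w) = True # b # delimit w" by (simp add: delimit_def)
  moreover have "Suc (2 * length (b # w)) = Suc (Suc (Suc (2 * length w)))" by simp
  ultimately show ?case
    unfolding Cons.IH by (simp only: map_upt_Suc2) simp
qed

lemma concat_blocks:
  assumes "0 < r"
  shows "concat (map (\<lambda>a. map (f a) [0..<r]) [0..<m]) = map (\<lambda>i. f (i div r) (i mod r)) [0..<m * r]"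
proof (induction m)
  case (Suc m)
  have "[0..<Suc m * r] = [0..<m * r] @ map (\<lambda>i. i + m * r) [0..<r]"
    unfolding map_add_upt by (metis add.commute mult_Suc upt_add_eq_append zero_le)
  moreover have "map (\<lambda>i. f ((i + m * r) div r) ((i + m * r) mod r)) [0..<r] = map (f m) [0..<r]"
    using assms by (intro map_cong) auto
  ultimately show ?case using Suc.IH by (simp add: comp_def)
qed simp

text \<open>There are \<open>2 * n\<close> rows of \<open>n + 1\<close> bits, each delimited into
  \<open>2 * n + 3\<close> bits whose last one, at \<open>2 * n + 2\<close>, is the end mark. The
  next five bits are the delimited code of \<open>k = 2\<close>, which has ones at 0, 2 and 3. The
  rest is the delimited code of \<open>m\<close>, with \<open>ml\<close> binary digits
  \<open>mb\<close>.\<close>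

definition code_bit :: "nat \<Rightarrow> (nat \<Rightarrow> nat \<Rightarrow> bool) \<Rightarrow> nat \<Rightarrow> (nat \<Rightarrow> bool) \<Rightarrow> nat \<Rightarrow> bool" where
  "code_bit n row ml mb i =
    (if i < 2 * n * (2 * n + 3)
     then i mod (2 * n + 3) \<noteq> 2 * n + 2 \<and>
       (even (i mod (2 * n + 3)) \<or> row (i div (2 * n + 3)) (i mod (2 * n + 3) div 2))
     else if i < 2 * n * (2 * n + 3) + 5
     then i = 2 * n * (2 * n + 3) \<or> i = 2 * n * (2 * n + 3) + 2 \<or> i = 2 * n * (2 * n + 3) + 3
     else i - (2 * n * (2 * n + 3) + 5) \<noteq> 2 * ml \<and>
       (even (i - (2 * n * (2 * n + 3) + 5)) \<or> mb ((i - (2 * n * (2 * n + 3) + 5)) div 2)))"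

definition code_length :: "nat \<Rightarrow> nat \<Rightarrow> nat" where
  "code_length n ml = 2 * n * (2 * n + 3) + 5 + Suc (2 * ml)"

definition code :: "nat \<Rightarrow> (nat \<Rightarrow> nat \<Rightarrow> bool) \<Rightarrow> nat \<Rightarrow> (nat \<Rightarrow> bool) \<Rightarrow> bool list" where
  "code n row ml mb = map (code_bit n row ml mb) [0..<code_length n ml]"

lemma code_eq:
  "code n row ml mb = concat (map delimit
    (map (\<lambda>a. map (row a) [0..<Suc n]) [0..<2 * n] @ [[False, True], map mb [0..<ml]]))"
proof -
  let ?r = "2 * n + 3"
  let ?b = "2 * n * ?r"
  have "delimit (map (row a) [0..<Suc n]) =
      map (\<lambda>i. i \<noteq> 2 * n + 2 \<and> (even i \<or> row a (i div 2))) [0..<?r]" for a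
  proof -
    have "Suc (2 * length (map (row a) [0..<Suc n])) = ?r" by simp
    then show ?thesis unfolding delimit_conv
      by (intro map_cong) (auto simp: less_Suc_eq_le numeral_3_eq_3 simp del: upt_Suc)
  qed
  then have "concat (map delimit (map (\<lambda>a. map (row a) [0..<Suc n]) [0..<2 * n])) =
      concat (map (\<lambda>a. map (\<lambda>i. i \<noteq> 2 * n + 2 \<and> (even i \<or> row a (i div 2))) [0..<?r]) [0..<2 * n])"
    by (simp add: comp_def del: upt_Suc)
  also have "\<dots> = map (code_bit n row ml mb) [0..<?b]"
    by (subst concat_blocks) (auto simp: code_bit_def)
  finally have 1: "concat (map delimit (map (\<lambda>a. map (row a) [0..<Suc n]) [0..<2 * n]))
      = map (code_bit n row ml mb) [0..<?b]" .
  have "map (code_bit n row ml mb) [?b..<?b + 5] = map (\<lambda>i. code_bit n row ml mb (i + ?b)) [0..<5]"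
    by (rule map_upt_offset)
  also have "\<dots> = delimit [False, True]"
    by (simp add: code_bit_def delimit_def upt_rec numeral_eq_Suc)
  finally have 2: "map (code_bit n row ml mb) [?b..<?b + 5] = delimit [False, True]" .
  have "map (code_bit n row ml mb) [?b + 5..<?b + 5 + Suc (2 * ml)]
      = map (\<lambda>i. code_bit n row ml mb (i + (?b + 5))) [0..<Suc (2 * ml)]"
    by (rule map_upt_offset)
  also have "\<dots> = delimit (map mb [0..<ml])"
    unfolding delimit_conv by (auto simp: code_bit_def simp del: upt_Suc)
  finally have 3: "map (code_bit n row ml mb) [?b + 5..<?b + 5 + Suc (2 * ml)] = delimit (map mb [0..<ml])" .
  have "[0..<code_length n ml] = [0..<?b] @ [?b..<?b + 5] @ [?b + 5..<?b + 5 + Suc (2 * ml)]"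
    unfolding code_length_def by (metis append_assoc le_add1 le_add2 upt_add_eq_append zero_le)
  then show ?thesis
    unfolding code_def by (simp only: map_append concat_append 1 2 3 list.map concat.simps append_Nil2)
qed

lemma code_cong:
  assumes "\<And>a b. a < 2 * n \<Longrightarrow> b \<le> n \<Longrightarrow> row a b = row' a b" "\<And>i. i < ml \<Longrightarrow> mb i = mb' i"
  shows "code n row ml mb = code n row' ml mb'"
proof -
  have "map (\<lambda>a. map (row a) [0..<Suc n]) [0..<2 * n] = map (\<lambda>a. map (row' a) [0..<Suc n]) [0..<2 * n]"
    using assms(1) by (auto simp del: upt_Suc)
  moreover have "map mb [0..<ml] = map mb' [0..<ml]" using assms(2) by simp
  ultimately show ?thesis unfolding code_eq by (simp only:)
qed

section \<open>Instances given by relations on numbers\<close>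

text \<open>Only pairs \<open>a < b\<close> are consulted, so \<open>E\<close> may be any relation
  and each edge has one representative. Conditions on edges become bounded quantifiers, and counting
  edges becomes a bounded sum.\<close>

definition graph_of :: "nat \<Rightarrow> (nat \<Rightarrow> bool) \<Rightarrow> (nat \<Rightarrow> nat \<Rightarrow> bool) \<Rightarrow> nat graph" where
  "graph_of n V E = ({a. a < n \<and> V a}, {{a, b} | a b. a < b \<and> b < n \<and> E a b})"

lemma edge_graph_of:
  "{a, b} \<in> edges (graph_of n V E) \<longleftrightarrow> a < b \<and> b < n \<and> E a b \<or> b < a \<and> a < n \<and> E b a"
  by (auto simp: graph_of_def doubleton_eq_iff)

lemma graph_of_simple_graph:
  assumes "simple_graph G" "verts G \<subseteq> {..<n}"
  shows "G = graph_of n (\<lambda>a. a \<in> verts G) (\<lambda>a b. {a, b} \<in> edges G)"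
proof -
  have E: "e \<in> edges G \<longleftrightarrow> (\<exists>a b. e = {a, b} \<and> a < b \<and> b < n \<and> {a, b} \<in> edges G)" for e
  proof
    assume e: "e \<in> edges G"
    then obtain a b where ab: "e = {a, b}" "a \<in> verts G" "b \<in> verts G" "a \<noteq> b"
      using assms(1) unfolding simple_graph_def pairs_def by blast
    then have "a < n" "b < n" using assms(2) by auto
    then show "\<exists>a b. e = {a, b} \<and> a < b \<and> b < n \<and> {a, b} \<in> edges G"
      using ab e by (cases "a < b") (metis insert_commute linorder_neqE_nat)+
  qed auto
  have "edges G = edges (graph_of n (\<lambda>a. a \<in> verts G) (\<lambda>a b. {a, b} \<in> edges G))"
    by (rule set_eqI) (unfold graph_of_def snd_conv mem_Collect_eq, rule E)
  moreover have "verts G = verts (graph_of n (\<lambda>a. a \<in> verts G) (\<lambda>a b. {a, b} \<in> edges G))"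
    using assms(2) by (auto simp: graph_of_def)
  ultimately show ?thesis by (simp add: prod_eq_iff)
qed

definition graph_row :: "(nat \<Rightarrow> bool) \<Rightarrow> (nat \<Rightarrow> nat \<Rightarrow> bool) \<Rightarrow> nat \<Rightarrow> nat \<Rightarrow> bool" where
  "graph_row V E a b =
    (if b = 0 then V a else a < b - 1 \<and> E a (b - 1) \<or> b - 1 < a \<and> E (b - 1) a)"

definition instance_row ::
    "nat \<Rightarrow> (nat \<Rightarrow> nat \<Rightarrow> bool) \<Rightarrow> (nat \<Rightarrow> bool) \<Rightarrow> (nat \<Rightarrow> nat \<Rightarrow> bool) \<Rightarrow> nat \<Rightarrow> nat \<Rightarrow> bool" where
  "instance_row n g hV h a b =
    (if a < n then graph_row (\<lambda>_. True) g a b else graph_row hV h (a - n) b)"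

lemma graph_rows_graph_of:
  "graph_rows n (graph_of n V E) = map (\<lambda>a. map (graph_row V E a) [0..<Suc n]) [0..<n]"
proof -
  have "(a \<in> verts (graph_of n V E)) # map (\<lambda>b. {a, b} \<in> edges (graph_of n V E)) [0..<n]
      = map (graph_row V E a) [0..<Suc n]" if "a < n" for a
    unfolding map_upt_Suc edge_graph_of using that
    by (auto simp: graph_row_def graph_of_def)
  then show ?thesis unfolding graph_rows_def by (intro map_cong) auto
qed

abbreviation instance_of ::
    "nat \<Rightarrow> (nat \<Rightarrow> nat \<Rightarrow> bool) \<Rightarrow> (nat \<Rightarrow> bool) \<Rightarrow> (nat \<Rightarrow> nat \<Rightarrow> bool) \<Rightarrow> nat \<Rightarrow> rc_instance" where
  "instance_of n g hV h m \<equiv> (graph_of n (\<lambda>_. True) g, graph_of n hV h, 2, m)"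

lemma card_verts_graph_of: "card (verts (graph_of n (\<lambda>_. True) g)) = n"
  by (simp add: graph_of_def)

lemma binary_2: "binary 2 = [False, True]"
  by (simp add: binary.simps)

lemma encode_instance_of:
  "encode (instance_of n g hV h m) =
    code n (instance_row n g hV h) (length (binary m)) (nth (binary m))"
proof -
  let ?row = "instance_row n g hV h"
  have "map (\<lambda>a. map (?row a) [0..<Suc n]) [0..<2 * n]
      = map (\<lambda>a. map (?row a) [0..<Suc n]) [0..<n] @ map (\<lambda>a. map (?row (a + n)) [0..<Suc n]) [0..<n]"
  proof -
    have "[0..<2 * n] = [0..<n] @ map (\<lambda>i. i + n) [0..<n]"
      unfolding map_add_upt by (metis mult_2 upt_add_eq_append zero_le)
    then show ?thesis by (simp add: comp_def del: upt_Suc)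
  qed
  also have "map (\<lambda>a. map (?row a) [0..<Suc n]) [0..<n] = graph_rows n (graph_of n (\<lambda>_. True) g)"
    unfolding graph_rows_graph_of by (auto simp: instance_row_def simp del: upt_Suc)
  also have "map (\<lambda>a. map (?row (a + n)) [0..<Suc n]) [0..<n] = graph_rows n (graph_of n hV h)"
    unfolding graph_rows_graph_of by (auto simp: instance_row_def simp del: upt_Suc)
  finally show ?thesis
    unfolding code_eq encode.simps card_verts_graph_of Let_def binary_2 map_nth by simp
qed

text \<open>The condition \<open>2 \<le> n\<close> is the requirement that \<open>k\<close> is at
  most the number of vertices, for \<open>k = 2\<close>.\<close>

definition proper_instance :: "nat \<Rightarrow> (nat \<Rightarrow> nat \<Rightarrow> bool) \<Rightarrow> (nat \<Rightarrow> bool) \<Rightarrow> (nat \<Rightarrow> nat \<Rightarrow> bool) \<Rightarrow> bool" where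
  "proper_instance n g hV h \<longleftrightarrow>
    2 \<le> n \<and> (\<forall>b<n. \<forall>a<b. h a b \<longrightarrow> hV a \<and> hV b \<and> \<not> g a b)"

lemma instance_of_in_rc_instances:
  "instance_of n g hV h m \<in> rc_instances \<longleftrightarrow> proper_instance n g hV h"
proof -
  have "simple_graph (graph_of n (\<lambda>_. True) g)"
    by (fastforce simp: simple_graph_def graph_of_def pairs_def)
  moreover have "subgraph (graph_of n hV h) (complement (graph_of n (\<lambda>_. True) g)) \<longleftrightarrow>
      (\<forall>b<n. \<forall>a<b. h a b \<longrightarrow> hV a \<and> hV b \<and> \<not> g a b)" (is "?L \<longleftrightarrow> ?R")
  proof
    assume L: ?L
    show ?R
    proof (intro allI impI)
      fix a b assume ab: "b < n" "a < b" "h a b"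
      then have e: "{a, b} \<in> edges (graph_of n hV h)" by (simp add: edge_graph_of)
      then have "{a, b} \<in> pairs (verts (graph_of n hV h))"
        using L unfolding subgraph_def simple_graph_def by blast
      then have "hV a" "hV b" by (auto simp: pairs_def graph_of_def doubleton_eq_iff)
      moreover have "{a, b} \<notin> edges (graph_of n (\<lambda>_. True) g)"
        using L e unfolding subgraph_def complement_def by auto
      then have "\<not> g a b" using ab by (simp add: edge_graph_of)
      ultimately show "hV a \<and> hV b \<and> \<not> g a b" by simp
    qed
  next
    assume R: ?R
    have "e \<in> pairs (verts (graph_of n hV h)) \<and> e \<in> pairs (verts (graph_of n (\<lambda>_. True) g)) \<and>
        e \<notin> edges (graph_of n (\<lambda>_. True) g)" if "e \<in> edges (graph_of n hV h)" for e
    proof -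
      obtain a b where ab: "e = {a, b}" "a < b" "b < n" "h a b"
        using \<open>e \<in> edges (graph_of n hV h)\<close> by (auto simp: graph_of_def)
      then have "hV a" "hV b" "\<not> g a b" using R by auto
      then show ?thesis
        using ab by (fastforce simp: edge_graph_of pairs_def graph_of_def doubleton_eq_iff)
    qed
    then show ?L
      by (auto simp: subgraph_def simple_graph_def complement_def) (auto simp: graph_of_def)
  qed
  ultimately show ?thesis
    unfolding rc_instances_def proper_instance_def
    by (auto simp: card_verts_graph_of) (auto simp: graph_of_def)
qed

lemma card_monochromatic_edges:
  "card (monochromatic_edges (graph_of n hV h) \<phi>)
    = (\<Sum>b<n. \<Sum>a<b. of_bool (h a b \<and> \<phi> a = \<phi> b))"
proof -
  let ?S = "Sigma {..<n} (\<lambda>b. {a. a < b \<and> h a b \<and> \<phi> a = \<phi> b})"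
  have "monochromatic_edges (graph_of n hV h) \<phi> = (\<lambda>(b, a). {a, b}) ` ?S"
  proof (intro equalityI subsetI)
    fix e assume "e \<in> monochromatic_edges (graph_of n hV h) \<phi>"
    then have "e \<in> edges (graph_of n hV h)" and uv: "\<exists>u v. e = {u, v} \<and> \<phi> u = \<phi> v"
      by (auto simp: monochromatic_edges_def)
    then obtain a b where ab: "e = {a, b}" "a < b" "b < n" "h a b"
      by (auto simp: graph_of_def)
    from uv have "\<phi> a = \<phi> b" by (auto simp: ab(1) doubleton_eq_iff)
    with ab(1-4) show "e \<in> (\<lambda>(b, a). {a, b}) ` ?S" by (intro image_eqI[of _ _ "(b, a)"]) auto
  qed (auto simp: monochromatic_edges_def graph_of_def)
  moreover have "inj_on (\<lambda>(b, a). {a, b}) ?S"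
    by (auto simp: inj_on_def doubleton_eq_iff)
  ultimately have "card (monochromatic_edges (graph_of n hV h) \<phi>) = card ?S"
    by (simp add: card_image)
  also have "\<dots> = (\<Sum>b<n. card {a. a < b \<and> h a b \<and> \<phi> a = \<phi> b})"
    by (subst card_SigmaI) auto
  also have "\<dots> = (\<Sum>b<n. \<Sum>a<b. of_bool (h a b \<and> \<phi> a = \<phi> b))"
  proof (rule sum.cong)
    fix b
    have "{..<b} \<inter> {a. h a b \<and> \<phi> a = \<phi> b} = {a. a < b \<and> h a b \<and> \<phi> a = \<phi> b}" by auto
    then show "card {a. a < b \<and> h a b \<and> \<phi> a = \<phi> b} = (\<Sum>a<b. of_bool (h a b \<and> \<phi> a = \<phi> b))"
      by (simp add: of_bool_def sum.If_cases)
  qed simp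
  finally show ?thesis .
qed

definition good_cut :: "nat \<Rightarrow> (nat \<Rightarrow> nat \<Rightarrow> bool) \<Rightarrow> (nat \<Rightarrow> nat \<Rightarrow> bool) \<Rightarrow> nat \<Rightarrow> (nat \<Rightarrow> bool) \<Rightarrow> bool" where
  "good_cut n g h m u \<longleftrightarrow> (\<forall>b<n. \<forall>a<b. g a b \<longrightarrow> u a \<noteq> u b) \<and>
    (\<Sum>b<n. \<Sum>a<b. of_bool (h a b \<and> u a = u b)) \<le> m"

text \<open>Only equality of colors matters, so the colors 1 and 2 may be replaced by truth
  values.\<close>

lemma instance_of_in_Robust_Coloring:
  "instance_of n g hV h m \<in> Robust_Coloring \<longleftrightarrow> proper_instance n g hV h \<and> (\<exists>u. good_cut n g h m u)"
proof -
  let ?G = "graph_of n (\<lambda>_. True) g" and ?H = "graph_of n hV h"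
  have "(\<exists>\<phi>. coloring 2 ?G \<phi> \<and> card (monochromatic_edges ?H \<phi>) \<le> m) \<longleftrightarrow> (\<exists>u. good_cut n g h m u)"
  proof
    assume "\<exists>\<phi>. coloring 2 ?G \<phi> \<and> card (monochromatic_edges ?H \<phi>) \<le> m"
    then obtain \<phi> where \<phi>: "coloring 2 ?G \<phi>" "card (monochromatic_edges ?H \<phi>) \<le> m" by blast
    have 12: "\<phi> a \<in> {1, 2}" if "a < n" for a
    proof -
      have "\<phi> a \<in> {1..2}" using \<phi>(1) that by (auto simp: coloring_def graph_of_def)
      then show ?thesis by auto
    qed
    have eq: "(\<phi> a = \<phi> b) = ((\<phi> a = 2) = (\<phi> b = 2))" if "a < n" "b < n" for a b
      using 12[OF that(1)] 12[OF that(2)] by auto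
    have "\<phi> a \<noteq> \<phi> b" if "b < n" "a < b" "g a b" for a b
    proof -
      have "{a, b} \<in> edges ?G" using that by (simp add: edge_graph_of)
      then show ?thesis using \<phi>(1) unfolding coloring_def by blast
    qed
    then have "good_cut n g h m (\<lambda>a. \<phi> a = 2)"
      using \<phi>(2) eq unfolding good_cut_def card_monochromatic_edges by auto
    then show "\<exists>u. good_cut n g h m u" by blast
  next
    assume "\<exists>u. good_cut n g h m u"
    then obtain u where u: "good_cut n g h m u" ..
    define \<phi> where "\<phi> a = (if u a then 2 else 1 :: nat)" for a
    have eq: "(\<phi> a = \<phi> b) = (u a = u b)" for a b by (auto simp: \<phi>_def)
    have "coloring 2 ?G \<phi>"
      using u unfolding coloring_def good_cut_def edge_graph_of by (auto simp: eq) (auto simp: \<phi>_def)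
    moreover have "card (monochromatic_edges ?H \<phi>) \<le> m"
      using u unfolding card_monochromatic_edges eq good_cut_def by simp
    ultimately show "\<exists>\<phi>. coloring 2 ?G \<phi> \<and> card (monochromatic_edges ?H \<phi>) \<le> m" by blast
  qed
  then show ?thesis
    unfolding Robust_Coloring_def using instance_of_in_rc_instances[of n g hV h m] by auto
qed

section \<open>Membership in NP\<close>

fun bval :: "bool list \<Rightarrow> nat" where
  "bval [] = 0"
| "bval (b # w) = of_bool b + 2 * bval w"

lemma binary_0 [simp]: "binary 0 = []"
  by (simp add: binary.simps)

lemma binary_pos: "0 < m \<Longrightarrow> binary m = odd m # binary (m div 2)"
  by (simp add: binary.simps)

lemma bval_binary: "bval (binary m) = m"
proof (induction m rule: less_induct)
  case (less m)
  show ?case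
  proof (cases "m = 0")
    case False
    then have "bval (binary m) = of_bool (odd m) + 2 * (m div 2)"
      using less[of "m div 2"] by (simp add: binary_pos)
    then show ?thesis by (cases "even m") auto
  qed simp
qed

lemma binary_bval: "w = [] \<or> last w \<Longrightarrow> binary (bval w) = w"
proof (induction w)
  case (Cons b w)
  show ?case
  proof (cases "w = []")
    case True
    then show ?thesis using Cons.prems by (simp add: binary_pos)
  next
    case False
    then have IH: "binary (bval w) = w" using Cons by simp
    then have "0 < bval w" using False by (cases "bval w = 0") auto
    then show ?thesis using IH by (simp add: binary_pos)
  qed
qed simp

lemma last_binary: "0 < m \<Longrightarrow> last (binary m)"
proof (induction m rule: less_induct)
  case (less m)
  show ?case
  proof (cases "m = 1")
    case True
    then show ?thesis by (simp add: binary_pos)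
  next
    case False
    then have "0 < m div 2" "m div 2 < m" using less.prems by auto
    then have "last (binary (m div 2))" "binary (m div 2) \<noteq> []"
      using less.IH by (auto simp: binary_pos)
    then show ?thesis using less.prems by (simp add: binary_pos)
  qed
qed

lemma nth_binary: "i < length (binary m) \<Longrightarrow> binary m ! i = odd (m div 2 ^ i)"
proof (induction i arbitrary: m)
  case 0
  then show ?case by (cases "m = 0") (auto simp: binary_pos)
next
  case (Suc i)
  then have "0 < m" by (cases "m = 0") auto
  then show ?case using Suc by (simp add: binary_pos div_mult2_eq)
qed

text \<open>The number of digits is the number of shifts that leave something positive, and
  \<open>m\<close> itself bounds the shifts to be tried. In this form it is a function of the
  class.\<close>

lemma length_binary: "m \<le> B \<Longrightarrow> length (binary m) = (\<Sum>i<B. of_bool (0 < m div 2 ^ i))"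
proof (induction B arbitrary: m)
  case (Suc B)
  show ?case
  proof (cases "m = 0")
    case False
    then have "length (binary m) = Suc (length (binary (m div 2)))" by (simp add: binary_pos)
    also have "m div 2 \<le> B" using Suc.prems False by linarith
    from Suc.IH[OF this] have "length (binary (m div 2)) = (\<Sum>i<B. of_bool (0 < m div 2 ^ Suc i))"
      by (simp only: power_Suc div_mult2_eq)
    finally show ?thesis
      using False by (subst sum.lessThan_Suc_shift) simp
  qed simp
qed simp

text \<open>Horner's rule from the most significant bit, which is the last one of the list. Capping
  every intermediate value is harmless, since a value of at least \<open>c\<close> stays so when
  doubled.\<close>

lemma capped_bval:
  "rec_nat 0 (\<lambda>i y. min c (2 * y + of_bool (w ! (length w - 1 - i)))) (length w) = min c (bval w)"
proof -
  have "rec_nat 0 (\<lambda>i y. min c (2 * y + of_bool (w ! (length w - 1 - i)))) k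
      = min c (bval (drop (length w - k) w))" if "k \<le> length w" for k
    using that
  proof (induction k)
    case (Suc k)
    then have "drop (length w - Suc k) w = w ! (length w - 1 - k) # drop (length w - k) w"
      by (metis Cons_nth_drop_Suc Suc_diff_Suc Suc_le_lessD diff_Suc_eq_diff_pred diff_less
          less_le_trans zero_less_Suc)
    then show ?case using Suc by auto
  qed simp
  from this[of "length w"] show ?thesis by simp
qed

section \<open>Checking a certificate\<close>

abbreviation RC2 :: language where
  "RC2 \<equiv> encode ` {(G, H, k, m) \<in> Robust_Coloring. k = 2}"

lemma in_RC2_iff:
  "x \<in> RC2 \<longleftrightarrow> (\<exists>n g hV h m. x = encode (instance_of n g hV h m) \<and> proper_instance n g hV h \<and>
    (\<exists>u. good_cut n g h m u))"
proof
  assume "x \<in> RC2"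
  then obtain G H m where x: "x = encode (G, H, 2, m)" and rc: "(G, H, 2, m) \<in> Robust_Coloring"
    by auto
  then have inst: "(G, H, 2, m) \<in> rc_instances" by (auto simp: Robust_Coloring_def)
  define n where "n = card (verts G)"
  have G: "simple_graph G" "verts G = {..<n}" and H: "simple_graph H" "verts H \<subseteq> {..<n}"
    using inst by (auto simp: rc_instances_def n_def subgraph_def complement_def)
  have "G = graph_of n (\<lambda>_. True) (\<lambda>a b. {a, b} \<in> edges G)"
    using graph_of_simple_graph[OF G(1), of n] G(2) by (simp add: graph_of_def)
  moreover have "H = graph_of n (\<lambda>a. a \<in> verts H) (\<lambda>a b. {a, b} \<in> edges H)"
    using graph_of_simple_graph[OF H] .
  ultimately have eq: "(G, H, 2, m) = instance_of n (\<lambda>a b. {a, b} \<in> edges G) (\<lambda>a. a \<in> verts H)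
      (\<lambda>a b. {a, b} \<in> edges H) m"
    by simp
  then show "\<exists>n g hV h m. x = encode (instance_of n g hV h m) \<and> proper_instance n g hV h \<and>
    (\<exists>u. good_cut n g h m u)"
    using rc x instance_of_in_Robust_Coloring by metis
next
  assume "\<exists>n g hV h m. x = encode (instance_of n g hV h m) \<and> proper_instance n g hV h \<and>
    (\<exists>u. good_cut n g h m u)"
  then obtain n g hV h m where x: "x = encode (instance_of n g hV h m)"
    and "instance_of n g hV h m \<in> Robust_Coloring"
    using instance_of_in_Robust_Coloring by metis
  then show "x \<in> RC2" by (intro image_eqI[where f = encode, OF x]) simp
qed

text \<open>The functions with names in x read the constituents of an instance off its code \<open>w 0\<close>, provided
  that it has \<open>n\<close> vertices; the certificate is \<open>w 1\<close>.\<close>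

definition xbit :: "(nat \<Rightarrow> bool list) \<Rightarrow> nat \<Rightarrow> bool" where
  "xbit w i \<longleftrightarrow> contents (w 0) (int i) = 2"

definition xrow :: "(nat \<Rightarrow> bool list) \<Rightarrow> nat \<Rightarrow> nat \<Rightarrow> nat \<Rightarrow> bool" where
  "xrow w n a b = xbit w (a * (2 * n + 3) + (2 * b + 1))"

definition xg :: "(nat \<Rightarrow> bool list) \<Rightarrow> nat \<Rightarrow> nat \<Rightarrow> nat \<Rightarrow> bool" where
  "xg w n a b = xrow w n a (b + 1)"

definition xhV :: "(nat \<Rightarrow> bool list) \<Rightarrow> nat \<Rightarrow> nat \<Rightarrow> bool" where
  "xhV w n a = xrow w n (n + a) 0"

definition xh :: "(nat \<Rightarrow> bool list) \<Rightarrow> nat \<Rightarrow> nat \<Rightarrow> nat \<Rightarrow> bool" where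
  "xh w n a b = xrow w n (n + a) (b + 1)"

definition xml :: "(nat \<Rightarrow> bool list) \<Rightarrow> nat \<Rightarrow> nat" where
  "xml w n = (length (w 0) - (2 * n * (2 * n + 3) + 6)) div 2"

definition xmb :: "(nat \<Rightarrow> bool list) \<Rightarrow> nat \<Rightarrow> nat \<Rightarrow> bool" where
  "xmb w n i = xbit w (2 * n * (2 * n + 3) + 5 + (2 * i + 1))"

definition xcut :: "(nat \<Rightarrow> bool list) \<Rightarrow> nat \<Rightarrow> bool" where
  "xcut w a \<longleftrightarrow> contents (w 1) (int a) = 2"

text \<open>The bound m of an instance may be exponential in the size of the input. But it may be
  replaced by its minimum with \<open>n * n\<close>.\<close>

definition xm :: "(nat \<Rightarrow> bool list) \<Rightarrow> nat \<Rightarrow> nat" where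
  "xm w n = rec_nat 0 (\<lambda>i y. min (n * n) (2 * y + of_bool (xmb w n (xml w n - 1 - i)))) (xml w n)"

text \<open>The input is not parsed: for a guessed \<open>n\<close> the decoding makes sense on
  every word, and the input is a code if encoding the decoded parts gives it back. The condition on
  the last digit of \<open>m\<close> excludes leading zeros.\<close>

definition checks :: "(nat \<Rightarrow> bool list) \<Rightarrow> nat \<Rightarrow> bool" where
  "checks w n \<longleftrightarrow> length (w 0) = code_length n (xml w n) \<and>
    (\<forall>i<length (w 0). xbit w i =
      code_bit n (instance_row n (xg w n) (xhV w n) (xh w n)) (xml w n) (xmb w n) i) \<and>
    (xml w n = 0 \<or> xmb w n (xml w n - 1)) \<and>
    proper_instance n (xg w n) (xhV w n) (xh w n) \<and>
    good_cut n (xg w n) (xh w n) (xm w n) (xcut w)"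

lemma upred_xrow:
  assumes "upoly n" "upoly a" "upoly b"
  shows "upred (\<lambda>w v. xrow w (n w v) (a w v) (b w v))"
  unfolding xrow_def xbit_def by (intro upoly_basic assms)

lemma upoly_xml:
  assumes "upoly n" shows "upoly (\<lambda>w v. xml w (n w v))"
  unfolding xml_def by (intro upoly_basic assms)

lemma upred_xmb:
  assumes "upoly n" "upoly i" shows "upred (\<lambda>w v. xmb w (n w v) (i w v))"
  unfolding xmb_def xbit_def by (intro upoly_basic assms)

lemma upoly_min:
  assumes "upoly f" "upoly g" shows "upoly (\<lambda>w v. min (f w v) (g w v))"
  unfolding min_def by (intro upoly_basic assms)

lemma upoly_xm:
  assumes "upoly n" shows "upoly (\<lambda>w v. xm w (n w v))"
proof (rule upoly_comp1[OF _ assms])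
  show "upoly (\<lambda>w v. xm w (v 0))"
    unfolding xm_def
  proof (rule upoly_loop[where R = "\<lambda>B. B * B"])
    show "upoly (\<lambda>w v. min (v (Suc (Suc 0)) * v (Suc (Suc 0)))
        (2 * v 1 + of_bool (xmb w (v (Suc (Suc 0))) (xml w (v (Suc (Suc 0))) - 1 - v 0))))"
      by (intro upoly_min upoly_basic upred_xmb upoly_xml)
    show "poly_bounded (\<lambda>B. B * B)" by (intro poly_bounded_intros)
    fix w v B i assume "fits w v B"
    then have "v 0 * v 0 \<le> B * B" by (auto simp: fits_def intro: mult_le_mono)
    then show "rec_nat 0 (\<lambda>i y. min (v 0 * v 0) (2 * y + of_bool (xmb w (v 0) (xml w (v 0) - 1 - i)))) i \<le> B * B"
      by (cases i) auto
  qed (intro upoly_basic upoly_xml)+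
qed

text \<open>The number of vertices is found by trying all candidates up to the length of the
  input.\<close>

lemma upred_checks: "upred (\<lambda>w v. \<exists>n<Suc (length (w 0)). checks w n)"
  unfolding checks_def code_bit_def code_length_def instance_row_def graph_row_def
    proper_instance_def good_cut_def xg_def xhV_def xh_def xbit_def xcut_def
  by (intro upoly_basic upoly_xml upred_xmb upoly_xm upred_xrow)

text \<open>Decoding an encoded instance recovers its relations only on pairs
  \<open>a < b < n\<close>, which is all that these notions depend on.\<close>

lemma instance_cong:
  assumes "\<And>a b. a < b \<Longrightarrow> b < n \<Longrightarrow> g a b = g' a b" "\<And>a. a < n \<Longrightarrow> hV a = hV' a"
    and "\<And>a b. a < b \<Longrightarrow> b < n \<Longrightarrow> h a b = h' a b"
  shows "proper_instance n g hV h = proper_instance n g' hV' h'"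
    and "a < 2 * n \<Longrightarrow> b \<le> n \<Longrightarrow> instance_row n g hV h a b = instance_row n g' hV' h' a b"
proof -
  show "proper_instance n g hV h = proper_instance n g' hV' h'"
    unfolding proper_instance_def using assms by (auto dest: less_trans)
  show "instance_row n g hV h a b = instance_row n g' hV' h' a b" if "a < 2 * n" "b \<le> n"
    unfolding instance_row_def graph_row_def using assms that by auto
qed

lemma good_cut_cong:
  assumes "\<And>a b. a < b \<Longrightarrow> b < n \<Longrightarrow> g a b = g' a b"
    and "\<And>a b. a < b \<Longrightarrow> b < n \<Longrightarrow> h a b = h' a b" and "\<And>a. a < n \<Longrightarrow> u a = u' a"
  shows "good_cut n g h m u = good_cut n g' h' m u'"
proof -
  have "(\<Sum>b<n. \<Sum>a<b. of_bool (h a b \<and> u a = u b)) = (\<Sum>b<n. \<Sum>a<b. of_bool (h' a b \<and> u' a = u' b) :: nat)"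
    using assms by (intro sum.cong) auto
  then show ?thesis unfolding good_cut_def using assms(1,3) by (auto dest: less_trans)
qed

lemma good_cut_min: "good_cut n g h (min (n * n) m) u = good_cut n g h m u"
proof -
  have "(\<Sum>b<n. \<Sum>a<b. of_bool (h a b \<and> u a = u b)) \<le> (\<Sum>b<n. \<Sum>a<b. 1 :: nat)"
    by (intro sum_mono) auto
  also have "\<dots> \<le> (\<Sum>b<n. n)" by (intro sum_mono) auto
  also have "\<dots> = n * n" by simp
  finally show ?thesis by (auto simp: good_cut_def)
qed

lemma xbit_iff: "xbit w i \<longleftrightarrow> i < length (w 0) \<and> w 0 ! i"
  by (auto simp: xbit_def contents_def)

lemma xm_eq: "xm w n = min (n * n) (bval (map (xmb w n) [0..<xml w n]))"
proof -
  let ?l = "map (xmb w n) [0..<xml w n]"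
  have *: "i \<le> xml w n \<Longrightarrow> rec_nat 0 (\<lambda>i y. min c (2 * y + of_bool (xmb w n (xml w n - 1 - i)))) i
      = rec_nat 0 (\<lambda>i y. min c (2 * y + of_bool (?l ! (length ?l - 1 - i)))) i" for i c
    by (induction i) auto
  show ?thesis unfolding xm_def *[OF order_refl]
    using capped_bval[of "n * n" ?l] by simp
qed

lemma checks_sound:
  assumes "checks w n"
  shows "w 0 \<in> RC2"
proof -
  define m where "m = bval (map (xmb w n) [0..<xml w n])"
  have "map (xmb w n) [0..<xml w n] = [] \<or> last (map (xmb w n) [0..<xml w n])"
    using assms by (cases "xml w n") (auto simp: checks_def)
  then have bin: "binary m = map (xmb w n) [0..<xml w n]"
    unfolding m_def by (rule binary_bval)
  have "w 0 = map (xbit w) [0..<length (w 0)]"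
    by (rule nth_equalityI) (auto simp: xbit_iff)
  also have "\<dots> = map (code_bit n (instance_row n (xg w n) (xhV w n) (xh w n)) (xml w n) (xmb w n))
      [0..<length (w 0)]"
    using assms unfolding checks_def by (intro map_cong) auto
  also have "\<dots> = code n (instance_row n (xg w n) (xhV w n) (xh w n)) (xml w n) (xmb w n)"
    using assms unfolding checks_def code_def by simp
  also have "\<dots> = code n (instance_row n (xg w n) (xhV w n) (xh w n)) (length (binary m)) (nth (binary m))"
    unfolding bin by (simp, rule code_cong) auto
  also have "\<dots> = encode (instance_of n (xg w n) (xhV w n) (xh w n) m)"
    by (rule encode_instance_of[symmetric])
  finally have "w 0 = encode (instance_of n (xg w n) (xhV w n) (xh w n) m)" .
  moreover have "good_cut n (xg w n) (xh w n) m (xcut w)"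
    using assms unfolding checks_def xm_eq m_def[symmetric] good_cut_min by blast
  ultimately show ?thesis
    using assms unfolding in_RC2_iff checks_def by blast
qed

lemma checks_complete:
  assumes x: "x = encode (instance_of n g hV h m)" and pr: "proper_instance n g hV h"
    and cut: "good_cut n g h m u"
  shows "n \<le> length x \<and> checks (inputs [x, map u [0..<n]]) n"
proof -
  let ?w = "inputs [x, map u [0..<n]]"
  let ?row = "instance_row n g hV h" and ?ml = "length (binary m)"
  have w: "?w 0 = x" "?w 1 = map u [0..<n]" by (auto simp: inputs_def)
  have code: "x = code n ?row ?ml (nth (binary m))"
    unfolding x by (rule encode_instance_of)
  then have len: "length x = code_length n ?ml" by (simp add: code_def)
  then have ml: "xml ?w n = ?ml" by (simp add: xml_def w code_length_def)
  have bit: "xbit ?w i = code_bit n ?row ?ml (nth (binary m)) i" if "i < length x" for i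
  proof -
    have "x ! i = code_bit n ?row ?ml (nth (binary m)) i"
      using that len by (subst code) (simp add: code_def)
    then show ?thesis using that by (simp add: xbit_iff w)
  qed
  have row: "xrow ?w n a b = ?row a b" if "a < 2 * n" "b \<le> n" for a b
  proof -
    let ?r = "2 * n + 3" let ?i = "a * ?r + (2 * b + 1)"
    have "?i < (a + 1) * ?r" using that(2) by simp
    also have "\<dots> \<le> 2 * n * ?r" using that(1) by (intro mult_le_mono1) simp
    finally have i: "?i < 2 * n * ?r" .
    have d: "?i div ?r = a" "?i mod ?r = 2 * b + 1"
      using that(2) by (auto simp: div_nat_eqI)
    have "xrow ?w n a b = code_bit n ?row ?ml (nth (binary m)) ?i"
      unfolding xrow_def using i len by (intro bit) (simp add: code_length_def)
    also have "\<dots> = ?row a b"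
      unfolding code_bit_def d using i that(2) by simp
    finally show ?thesis .
  qed
  have mb: "xmb ?w n i = binary m ! i" if "i < ?ml" for i
    unfolding xmb_def using that len by (subst bit) (auto simp: code_length_def code_bit_def)
  have g: "xg ?w n a b = g a b" if "a < b" "b < n" for a b
    unfolding xg_def using row[of a "b + 1"] that by (simp add: instance_row_def graph_row_def)
  have hV: "xhV ?w n a = hV a" if "a < n" for a
    unfolding xhV_def using row[of "n + a" 0] that by (simp add: instance_row_def graph_row_def)
  have h: "xh ?w n a b = h a b" if "a < b" "b < n" for a b
    unfolding xh_def using row[of "n + a" "b + 1"] that by (simp add: instance_row_def graph_row_def)
  have "code_bit n ?row ?ml (nth (binary m)) i =
      code_bit n (instance_row n (xg ?w n) (xhV ?w n) (xh ?w n)) ?ml (xmb ?w n) i" if "i < length x" for i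
  proof -
    have "code n ?row ?ml (nth (binary m)) =
        code n (instance_row n (xg ?w n) (xhV ?w n) (xh ?w n)) ?ml (xmb ?w n)"
      using instance_cong(2)[OF g hV h] mb by (intro code_cong) auto
    then show ?thesis using that len unfolding code_def by (auto simp: map_eq_conv)
  qed
  moreover have "xml ?w n = 0 \<or> xmb ?w n (xml ?w n - 1)"
  proof (cases "m = 0")
    case False
    then have "binary m \<noteq> []" by (simp add: binary_pos)
    then show ?thesis
      using last_binary[of m] mb[of "?ml - 1"] False unfolding ml by (simp add: last_conv_nth)
  qed (simp add: ml)
  moreover have "map (xmb ?w n) [0..<?ml] = binary m"
    by (rule nth_equalityI) (auto simp: mb)
  then have "xm ?w n = min (n * n) m"
    unfolding xm_eq ml by (simp add: bval_binary)
  moreover have "xcut ?w a = u a" if "a < n" for a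
    unfolding xcut_def w using that by (auto simp: contents_def)
  ultimately have "checks ?w n"
    unfolding checks_def w ml using len bit pr cut instance_cong(1)[OF g hV h]
      good_cut_cong[OF g h, where u' = u]
    by (simp add: good_cut_min)
  moreover have "n \<le> length x" unfolding len code_length_def by (simp add: algebra_simps)
  ultimately show ?thesis by blast
qed

lemma polytime_cong:
  assumes "polytime a f" "\<And>ws. length ws = a \<Longrightarrow> f ws = g ws"
  shows "polytime a g"
  using assms unfolding polytime_def by metis

theorem RC2_in_NP: "RC2 \<in> NP"
proof -
  define R where "R x u \<longleftrightarrow> (\<exists>n<Suc (length x). checks (inputs [x, u]) n)" for x u
  have "polytime 2 (\<lambda>ws. map (\<lambda>i. \<exists>n<Suc (length (inputs ws 0)). checks (inputs ws) n) [0..<1])"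
    by (rule polytime_by_upoly) (intro upoly_const upred_checks)+
  then have "polytime_relation R"
    unfolding polytime_relation_def
  proof (rule polytime_cong)
    fix ws :: "bool list list" assume "length ws = 2"
    then obtain x u where "ws = [x, u]" by (auto simp: numeral_2_eq_2 length_Suc_conv)
    then show "map (\<lambda>i. \<exists>n<Suc (length (inputs ws 0)). checks (inputs ws) n) [0..<1] = [R (ws ! 0) (ws ! 1)]"
      by (simp add: R_def inputs_def)
  qed
  \<comment> \<open>The certificate has one bit per vertex, and a code is at least as long as the
    number of vertices; so the polynomial \<open>[:0, 1:]\<close>, the identity, is a sufficient
    bound.\<close>
  moreover have "x \<in> RC2 \<longleftrightarrow> (\<exists>u. length u \<le> poly [:0, 1:] (length x) \<and> R x u)" for x
  proof
    assume "x \<in> RC2"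
    then obtain n g hV h m u where *: "x = encode (instance_of n g hV h m)"
      "proper_instance n g hV h" "good_cut n g h m u"
      unfolding in_RC2_iff by blast
    from checks_complete[OF *] have "length (map u [0..<n]) \<le> poly [:0, 1:] (length x) \<and> R x (map u [0..<n])"
      unfolding R_def by (auto intro: exI[of _ n])
    then show "\<exists>u. length u \<le> poly [:0, 1:] (length x) \<and> R x u" by blast
  next
    assume "\<exists>u. length u \<le> poly [:0, 1:] (length x) \<and> R x u"
    then obtain u n where "checks (inputs [x, u]) n" unfolding R_def by blast
    from checks_sound[OF this] show "x \<in> RC2" by (simp add: inputs_def)
  qed
  ultimately show ?thesis unfolding NP_def by blast
qed

section \<open>Hardness\<close>

text \<open>The literals of variable \<open>v\<close> are \<open>2 * v\<close> and, negated, \<open>2 * v + 1\<close>.\<close>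

definition lit_val :: "(nat \<Rightarrow> bool) \<Rightarrow> nat \<Rightarrow> bool" where
  "lit_val \<beta> l \<longleftrightarrow> \<beta> (l div 2) \<noteq> odd l"

definition nae :: "bool \<Rightarrow> bool \<Rightarrow> bool \<Rightarrow> bool" where
  "nae a b c \<longleftrightarrow> \<not> (a = b \<and> b = c)"

definition nae_sat :: "nat \<Rightarrow> (nat \<Rightarrow> nat \<Rightarrow> nat) \<Rightarrow> bool" where
  "nae_sat N lit \<longleftrightarrow>
    (\<exists>\<beta>. \<forall>c<N. nae (lit_val \<beta> (lit c 0)) (lit_val \<beta> (lit c 1)) (lit_val \<beta> (lit c 2)))"

text \<open>The vertices below \<open>2 * V\<close> are the literals, followed by three vertices for each clause. In
  the graph of hard constraints literals are joined to their negations, and the vertices of a clause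
  to its literals. The clauses are triangles of the graph of soft constraints. So the vertices of a
  clause get the colors of the negated literals, and a triangle has one monochromatic edge if its
  clause holds, and three otherwise.\<close>

definition nae_hard :: "nat \<Rightarrow> (nat \<Rightarrow> nat \<Rightarrow> nat) \<Rightarrow> nat \<Rightarrow> nat \<Rightarrow> bool" where
  "nae_hard V lit a b \<longleftrightarrow> b < 2 * V \<and> even a \<and> b = a + 1 \<or>
    2 * V \<le> b \<and> a = lit ((b - 2 * V) div 3) ((b - 2 * V) mod 3)"

definition nae_soft :: "nat \<Rightarrow> nat \<Rightarrow> nat \<Rightarrow> bool" where
  "nae_soft V a b \<longleftrightarrow> 2 * V \<le> a \<and> (a - 2 * V) div 3 = (b - 2 * V) div 3"

text \<open>With all terms at least 1 there is no slack, so the bound on the sum is a bound on each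
  term. The terms will be the numbers of monochromatic edges in the triangles.\<close>

lemma sum_ge_card:
  assumes "\<And>c. c < N \<Longrightarrow> 1 \<le> t c"
  shows "(\<Sum>c<N. t c) \<le> N \<longleftrightarrow> (\<forall>c<N. t c \<le> (1 :: nat))"
proof
  assume le: "(\<Sum>c<N. t c) \<le> N"
  have "(\<Sum>c<N. t c - 1) + N = (\<Sum>c<N. t c - 1 + 1)"
    by (simp only: sum.distrib sum_constant card_lessThan of_nat_id mult_1_right)
  also have "\<dots> = (\<Sum>c<N. t c)" using le_add_diff_inverse2[OF assms] by (intro sum.cong) auto
  finally have "(\<Sum>c<N. t c - 1) = 0" using le by linarith
  then show "\<forall>c<N. t c \<le> 1" by (auto simp: Suc_le_eq)
next
  assume "\<forall>c<N. t c \<le> 1"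
  then have "(\<Sum>c<N. t c) \<le> (\<Sum>c<N. 1)" by (intro sum_mono) auto
  then show "(\<Sum>c<N. t c) \<le> N" by simp
qed

text \<open>The triangle of clause \<open>N\<close> consists of the last three vertices. They have
  no soft edges to earlier vertices, so each further clause adds just the three edges of its
  triangle.\<close>

lemma count_nae_soft:
  fixes u :: "nat \<Rightarrow> bool" and V N
  defines "p i \<equiv> u (2 * V + i)"
  shows "(\<Sum>b<2 * V + 3 * N. \<Sum>a<b. of_bool (nae_soft V a b \<and> u a = u b)) =
    (\<Sum>c<N. of_bool (p (3 * c) = p (3 * c + 1)) + of_bool (p (3 * c) = p (3 * c + 2))
      + of_bool (p (3 * c + 1) = p (3 * c + 2)) :: nat)"
proof (induction N)
  case 0
  show ?case by (auto simp: nae_soft_def)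
next
  case (Suc N)
  let ?M = "2 * V + 3 * N"
  let ?f = "\<lambda>a b. of_bool (nae_soft V a b \<and> u a = u b) :: nat"
  define S where "S b = (\<Sum>a<b. ?f a b)" for b
  have zero: "(\<Sum>a<?M. ?f a (?M + j)) = 0" for j
  proof -
    have "\<not> nae_soft V a (?M + j)" if "a < ?M" for a
    proof -
      have "(a - 2 * V) div 3 < N" if "2 * V \<le> a"
        using \<open>a < ?M\<close> that by (auto simp: less_mult_imp_div_less)
      moreover have "N \<le> (3 * N + j) div 3" by simp
      ultimately show ?thesis by (auto simp: nae_soft_def)
    qed
    then show ?thesis by simp
  qed
  have soft: "nae_soft V (?M + i) (?M + j)" if "i < 3" "j < 3" for i j
    using that by (auto simp: nae_soft_def)
  have "S ?M = 0" using zero[of 0] unfolding S_def by (simp only: add_0_right)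
  moreover have "S (?M + 1) = of_bool (p (3 * N) = p (3 * N + 1))"
    using soft[of 0 1] unfolding S_def Suc_eq_plus1[symmetric] sum.lessThan_Suc
    unfolding Suc_eq_plus1 zero by (simp add: p_def add.assoc)
  moreover have "S (?M + 2) = of_bool (p (3 * N) = p (3 * N + 2)) + of_bool (p (3 * N + 1) = p (3 * N + 2))"
  proof -
    have "(\<Sum>a<b + 2. g a) = (\<Sum>a<b. g a) + g b + g (b + 1)" for g :: "nat \<Rightarrow> nat" and b
      by (simp add: numeral_2_eq_2)
    then have "S (?M + 2) = (\<Sum>a<?M. ?f a (?M + 2)) + ?f ?M (?M + 2) + ?f (?M + 1) (?M + 2)"
      unfolding S_def .
    then show ?thesis
      using soft[of 0 2] soft[of 1 2] unfolding zero by (simp add: p_def add.assoc)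
  qed
  moreover have "(\<Sum>b<2 * V + 3 * Suc N. S b) = (\<Sum>b<?M. S b) + S ?M + S (?M + 1) + S (?M + 2)"
  proof -
    have "2 * V + 3 * Suc N = ?M + 3" by simp
    moreover have "(\<Sum>b<k + 3. S b) = (\<Sum>b<k. S b) + S k + S (k + 1) + S (k + 2)" for k
      by (simp add: numeral_3_eq_3 numeral_2_eq_2)
    ultimately show ?thesis by (simp only:)
  qed
  ultimately show ?case
    using Suc.IH unfolding S_def[symmetric] by simp
qed

lemma nae_graph:
  assumes V: "1 \<le> V" and lit: "\<And>c j. c < N \<Longrightarrow> j < 3 \<Longrightarrow> lit c j < 2 * V"
  shows "proper_instance (2 * V + 3 * N) (nae_hard V lit) (\<lambda>_. True) (nae_soft V)"
    and "(\<exists>u. good_cut (2 * V + 3 * N) (nae_hard V lit) (nae_soft V) N u) \<longleftrightarrow> nae_sat N lit"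
proof -
  have lit': "lit ((b - 2 * V) div 3) ((b - 2 * V) mod 3) < 2 * V" if "b < 2 * V + 3 * N" "2 * V \<le> b" for b
    using that by (intro lit) (auto simp: less_mult_imp_div_less)
  show "proper_instance (2 * V + 3 * N) (nae_hard V lit) (\<lambda>_. True) (nae_soft V)"
    unfolding proper_instance_def
  proof (intro conjI allI impI)
    fix a b assume b: "b < 2 * V + 3 * N" "a < b" "nae_soft V a b"
    then have "2 * V \<le> a" by (simp add: nae_soft_def)
    \<comment> \<open>The smaller end of a soft edge is a clause vertex, whereas the smaller end of
      a hard edge is a literal.\<close>
    then show "\<not> nae_hard V lit a b"
      using lit'[of b] b by (auto simp: nae_hard_def)
  qed (use V in auto)
  let ?cnt = "\<lambda>u c. of_bool (u (2 * V + 3 * c) = u (2 * V + (3 * c + 1)))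
    + of_bool (u (2 * V + 3 * c) = u (2 * V + (3 * c + 2)))
    + of_bool (u (2 * V + (3 * c + 1)) = u (2 * V + (3 * c + 2))) :: nat"
  have cnt: "(\<Sum>b<2 * V + 3 * N. \<Sum>a<b. of_bool (nae_soft V a b \<and> u a = u b)) \<le> N \<longleftrightarrow>
      (\<forall>c<N. nae (u (2 * V + 3 * c)) (u (2 * V + (3 * c + 1))) (u (2 * V + (3 * c + 2))))"
    for u :: "nat \<Rightarrow> bool"
  proof -
    have "?cnt u c \<le> 1 \<longleftrightarrow> nae (u (2 * V + 3 * c)) (u (2 * V + (3 * c + 1))) (u (2 * V + (3 * c + 2)))" for c
      by (auto simp: nae_def)
    moreover have "1 \<le> ?cnt u c" for c by auto
    ultimately show ?thesis
      unfolding count_nae_soft using sum_ge_card[of N "?cnt u"] by presburger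
  qed
  have hard_occ: "nae_hard V lit (lit c j) (2 * V + (3 * c + j))" if "j < 3" for c j
    using that by (simp add: nae_hard_def)
  show "(\<exists>u. good_cut (2 * V + 3 * N) (nae_hard V lit) (nae_soft V) N u) \<longleftrightarrow> nae_sat N lit"
  proof
    assume "\<exists>u. good_cut (2 * V + 3 * N) (nae_hard V lit) (nae_soft V) N u"
    then obtain u where hard: "\<And>a b. b < 2 * V + 3 * N \<Longrightarrow> a < b \<Longrightarrow> nae_hard V lit a b \<Longrightarrow> u a \<noteq> u b"
      and nae: "\<And>c. c < N \<Longrightarrow> nae (u (2 * V + 3 * c)) (u (2 * V + (3 * c + 1))) (u (2 * V + (3 * c + 2)))"
      unfolding good_cut_def cnt by blast
    define \<beta> where "\<beta> v = u (2 * v)" for v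
    have u_lit: "u l = lit_val \<beta> l" if "l < 2 * V" for l
    proof (cases "even l")
      case True
      then show ?thesis by (simp add: lit_val_def \<beta>_def)
    next
      case False
      then have l: "l = 2 * (l div 2) + 1" by simp
      then have "nae_hard V lit (2 * (l div 2)) l" using that by (simp add: nae_hard_def)
      then have "u (2 * (l div 2)) \<noteq> u l" using that l by (intro hard) auto
      then show ?thesis using False by (simp add: lit_val_def \<beta>_def)
    qed
    have "u (2 * V + (3 * c + j)) = (\<not> lit_val \<beta> (lit c j))" if "c < N" "j < 3" for c j
    proof -
      have "u (lit c j) \<noteq> u (2 * V + (3 * c + j))"
        using lit[OF that] that by (intro hard hard_occ) auto
      then show ?thesis using u_lit[OF lit[OF that]] by auto
    qed
    from this[of _ 0] this[of _ 1] this[of _ 2] nae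
    have "\<forall>c<N. nae (lit_val \<beta> (lit c 0)) (lit_val \<beta> (lit c 1)) (lit_val \<beta> (lit c 2))"
      by (simp add: nae_def)
    then show "nae_sat N lit" unfolding nae_sat_def by blast
  next
    assume "nae_sat N lit"
    then obtain \<beta> where \<beta>: "\<And>c. c < N \<Longrightarrow> nae (lit_val \<beta> (lit c 0)) (lit_val \<beta> (lit c 1)) (lit_val \<beta> (lit c 2))"
      unfolding nae_sat_def by blast
    define u where "u a = (if a < 2 * V then lit_val \<beta> a
      else \<not> lit_val \<beta> (lit ((a - 2 * V) div 3) ((a - 2 * V) mod 3)))" for a
    have "u a \<noteq> u b" if "b < 2 * V + 3 * N" "a < b" "nae_hard V lit a b" for a b
      using that lit'[of b] by (auto simp: nae_hard_def u_def lit_val_def)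
    moreover have "u (2 * V + (3 * c + j)) = (\<not> lit_val \<beta> (lit c j))" if "j < 3" for c j
      using that by (simp add: u_def)
    from this[of 0] this[of 1] this[of 2] \<beta>
    have "\<forall>c<N. nae (u (2 * V + 3 * c)) (u (2 * V + (3 * c + 1))) (u (2 * V + (3 * c + 2)))"
      by (simp add: nae_def)
    ultimately have "good_cut (2 * V + 3 * N) (nae_hard V lit) (nae_soft V) N u"
      unfolding good_cut_def cnt by blast
    then show "\<exists>u. good_cut (2 * V + 3 * N) (nae_hard V lit) (nae_soft V) N u" by blast
  qed
qed

theorem reducible_by_nae:
  fixes V N :: "(nat \<Rightarrow> bool list) \<Rightarrow> nat"
  assumes V: "upoly (\<lambda>w v. V w)" and N: "upoly (\<lambda>w v. N w)"
    and lit: "upoly (\<lambda>w v. lit w (v 0) (v 1))"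
    and V1: "\<And>w. 1 \<le> V w" and lit_less: "\<And>w c j. c < N w \<Longrightarrow> j < 3 \<Longrightarrow> lit w c j < 2 * V w"
    and L: "\<And>x. x \<in> L \<longleftrightarrow> nae_sat (N (inputs [x])) (lit (inputs [x]))"
  shows "L \<le>\<^sub>p RC2"
proof -
  define n where "n w = 2 * V w + 3 * N w" for w
  \<comment> \<open>The bound \<open>N w\<close> has to be written in binary; this is its number of
    digits by \<open>length_binary\<close>.\<close>
  define ml where "ml w = (\<Sum>i<N w. of_bool (0 < N w div 2 ^ i) :: nat)" for w
  define bit where "bit w = code_bit (n w) (instance_row (n w) (nae_hard (V w) (lit w)) (\<lambda>_. True) (nae_soft (V w)))
    (ml w) (\<lambda>i. odd (N w div 2 ^ i))" for w
  define f where "f w = map (bit w) [0..<code_length (n w) (ml w)]" for w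
  have f: "f w = encode (instance_of (n w) (nae_hard (V w) (lit w)) (\<lambda>_. True) (nae_soft (V w)) (N w))" for w
  proof -
    have "ml w = length (binary (N w))" unfolding ml_def by (rule length_binary[symmetric]) simp
    then show ?thesis
      unfolding f_def bit_def encode_instance_of code_def[symmetric]
      by (auto intro!: code_cong simp: nth_binary)
  qed
  have "x \<in> L \<longleftrightarrow> f (inputs [x]) \<in> RC2" for x
  proof -
    let ?w = "inputs [x]"
    let ?I = "instance_of (n ?w) (nae_hard (V ?w) (lit ?w)) (\<lambda>_. True) (nae_soft (V ?w)) (N ?w)"
    note graph = nae_graph[where V = "V ?w" and N = "N ?w" and lit = "lit ?w", OF V1 lit_less]
    have "?I \<in> rc_instances"
      unfolding instance_of_in_rc_instances n_def by (rule graph(1))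
    \<comment> \<open>A word of the language is the code of some positive instance. It is this one
      because \<open>encode\<close> is injective on instances, and \<open>?I\<close> is an instance
      whether or not it is positive.\<close>
    have "f ?w \<in> RC2 \<longleftrightarrow> ?I \<in> Robust_Coloring"
    proof
      assume "f ?w \<in> RC2"
      then obtain I where I: "I \<in> Robust_Coloring" "encode I = encode ?I" unfolding f by fastforce
      then have "I \<in> rc_instances" by (auto simp: Robust_Coloring_def)
      from inj_onD[OF inj_on_encode I(2) this \<open>?I \<in> rc_instances\<close>] I(1)
      show "?I \<in> Robust_Coloring" by simp
    next
      assume "?I \<in> Robust_Coloring"
      then show "f ?w \<in> RC2" unfolding f by (intro imageI) simp
    qed
    also have "\<dots> \<longleftrightarrow> nae_sat (N ?w) (lit ?w)"
      unfolding instance_of_in_Robust_Coloring n_def using graph by blast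
    finally show ?thesis using L by simp
  qed
  moreover have "polytime 1 (\<lambda>ws. f (inputs ws))"
    unfolding f_def
  proof (rule polytime_by_upoly)
    have n: "upoly (\<lambda>w v. n w)" unfolding n_def by (intro upoly_basic V N)
    have ml: "upoly (\<lambda>w v. ml w)" unfolding ml_def by (intro upoly_basic N)
    show "upoly (\<lambda>w v. code_length (n w) (ml w))"
      unfolding code_length_def by (intro upoly_basic n ml)
    show "upred (\<lambda>w v. bit w (v 0))"
      unfolding bit_def code_bit_def instance_row_def graph_row_def nae_hard_def nae_soft_def
      by (intro upoly_basic n ml V N upoly_comp2[OF lit])
  qed
  then have "polytime_function (\<lambda>x. f (inputs [x]))"
    unfolding polytime_function_def
  proof (rule polytime_cong)
    fix ws :: "bool list list" assume "length ws = 1"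
    then obtain x where "ws = [x]" by (auto simp: length_Suc_conv)
    then show "f (inputs ws) = f (inputs [ws ! 0])" by simp
  qed
  ultimately show ?thesis unfolding polytime_reducible_def by blast
qed

section \<open>From clauses of any length to not-all-equal clauses\<close>

definition cnf_sat :: "nat \<Rightarrow> nat \<Rightarrow> (nat \<Rightarrow> nat \<Rightarrow> bool) \<Rightarrow> bool" where
  "cnf_sat C K P \<longleftrightarrow> (\<exists>\<alpha>. \<forall>c<C. \<exists>l<2 * K. P c l \<and> lit_val \<alpha> l)"

text \<open>The variable 0 stands for the truth value that represents falsity, so the literal 0 is false.
  The variable \<open>chain_var K i\<close> with \<open>i = c * (2 * K) + l\<close> tells whether one of the first \<open>l\<close>
  literals makes clause \<open>c\<close> true. Its successor implies it or the literal \<open>l\<close>; this clause with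
  three literals is split into two not-all-equal clauses by the auxiliary variable
  \<open>chain_var K i + 1\<close>.\<close>

definition chain_var :: "nat \<Rightarrow> nat \<Rightarrow> nat" where
  "chain_var K i = 1 + K + 2 * i"

text \<open>With \<open>y\<close> for the auxiliary variable, the clauses \<open>2 * i\<close> and
  \<open>2 * i + 1\<close> are (not next, current, \<open>y\<close>) and (not \<open>y\<close>,
  literal, false). The chain starts with false and must end with true, so at both borders the
  literal 0 takes the place of a chain literal. Variables of the formula are shifted by 1 to make
  room for variable 0, hence its literals by 2.\<close>

definition chain_lit :: "nat \<Rightarrow> (nat \<Rightarrow> nat \<Rightarrow> bool) \<Rightarrow> nat \<Rightarrow> nat \<Rightarrow> nat" where
  "chain_lit K P e j =
    (if even e then
       if j = 0 then if (e div 2 + 1) mod (2 * K) = 0 then 0 else 2 * chain_var K (e div 2 + 1) + 1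
       else if j = 1 then if e div 2 mod (2 * K) = 0 then 0 else 2 * chain_var K (e div 2)
       else 2 * (chain_var K (e div 2) + 1)
     else
       if j = 0 then 2 * (chain_var K (e div 2) + 1) + 1
       else if j = 1 then if P (e div 2 div (2 * K)) (e div 2 mod (2 * K)) then e div 2 mod (2 * K) + 2 else 0
       else 0)"

lemma lit_val_even [simp]: "lit_val \<beta> (2 * v) = \<beta> v"
  and lit_val_odd [simp]: "lit_val \<beta> (Suc (2 * v)) = (\<not> \<beta> v)"
  and lit_val_0 [simp]: "lit_val \<beta> 0 = \<beta> 0"
  by (simp_all add: lit_val_def)

lemma chain_lit_less:
  assumes "0 < K" "e < 2 * (C * (2 * K))" "j < 3"
  shows "chain_lit K P e j < 2 * (1 + K + 2 * (C * (2 * K)))"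
proof -
  have i: "e div 2 < C * (2 * K)" using assms(2) by auto
  have "e div 2 + 1 < C * (2 * K)" if "(e div 2 + 1) mod (2 * K) \<noteq> 0"
  proof -
    have "e div 2 + 1 \<noteq> C * (2 * K)" using that by auto
    then show ?thesis using i by simp
  qed
  moreover have "e div 2 mod (2 * K) < 2 * K" using assms(1) by simp
  ultimately show ?thesis using i unfolding chain_lit_def chain_var_def by auto
qed

lemma nae_sat_chain:
  assumes K: "0 < K"
  shows "nae_sat (2 * (C * (2 * K))) (chain_lit K P) \<longleftrightarrow> cnf_sat C K P"
proof
  assume "nae_sat (2 * (C * (2 * K))) (chain_lit K P)"
  then obtain \<beta> where \<beta>: "\<And>e. e < 2 * (C * (2 * K)) \<Longrightarrow> nae (lit_val \<beta> (chain_lit K P e 0))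
      (lit_val \<beta> (chain_lit K P e 1)) (lit_val \<beta> (chain_lit K P e 2))"
    unfolding nae_sat_def by blast
  \<comment> \<open>Truth is measured against \<open>\<beta> 0\<close>, which may be either value as
    not-all-equal clauses cannot tell an assignment from its complement.\<close>
  define \<alpha> where "\<alpha> v \<longleftrightarrow> \<beta> (v + 1) \<noteq> \<beta> 0" for v
  have lit: "lit_val \<beta> (l + 2) \<noteq> \<beta> 0 \<longleftrightarrow> lit_val \<alpha> l" for l
    by (auto simp: lit_val_def \<alpha>_def)
  have "\<exists>l<2 * K. P c l \<and> lit_val \<alpha> l" if c: "c < C" for c
  proof (rule ccontr)
    assume none: "\<not> (\<exists>l<2 * K. P c l \<and> lit_val \<alpha> l)"
    define S where "S l \<longleftrightarrow> (if l = 0 then False else if l = 2 * K then True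
      else \<beta> (chain_var K (c * (2 * K) + l)) \<noteq> \<beta> 0)" for l
    \<comment> \<open>If no literal of the clause is true, falsity passes along the chain from its
      start to its end, where \<open>S\<close> is true by definition.\<close>
    have step: "\<not> S (Suc l)" if "\<not> S l" "l < 2 * K" for l
    proof -
      define i where "i = c * (2 * K) + l"
      have "c * (2 * K) + 2 * K \<le> C * (2 * K)" using c mult_le_mono1[of "Suc c" C "2 * K"] by simp
      then have i: "i < C * (2 * K)" using that(2) unfolding i_def by linarith
      have md: "i mod (2 * K) = l" "i div (2 * K) = c" using that(2) K by (auto simp: i_def)
      have md': "(i + 1) mod (2 * K) = 0 \<longleftrightarrow> Suc l = 2 * K"
        using that(2) md(1) by (auto simp: mod_Suc)
      have Sl: "S l \<longleftrightarrow> (if l = 0 then False else \<beta> (chain_var K i) \<noteq> \<beta> 0)"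
        using that(2) by (simp add: S_def i_def)
      have S_Suc: "S (Suc l) \<longleftrightarrow> (if Suc l = 2 * K then True else \<beta> (chain_var K (i + 1)) \<noteq> \<beta> 0)"
        by (simp add: S_def i_def)
      have "nae (lit_val \<beta> (chain_lit K P (2 * i) 0)) (lit_val \<beta> (chain_lit K P (2 * i) 1))
          (lit_val \<beta> (chain_lit K P (2 * i) 2))"
        by (rule \<beta>) (use i in auto)
      moreover have "nae (lit_val \<beta> (chain_lit K P (Suc (2 * i)) 0)) (lit_val \<beta> (chain_lit K P (Suc (2 * i)) 1))
          (lit_val \<beta> (chain_lit K P (Suc (2 * i)) 2))"
        by (rule \<beta>) (use i in auto)
      moreover have "(lit_val \<beta> (chain_lit K P (2 * i) 0) \<noteq> \<beta> 0) = (\<not> S (Suc l))"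
        unfolding chain_lit_def S_Suc using md' by auto
      moreover have "(lit_val \<beta> (chain_lit K P (2 * i) 1) \<noteq> \<beta> 0) = S l"
        unfolding chain_lit_def Sl using md by auto
      moreover have "lit_val \<beta> (chain_lit K P (Suc (2 * i)) 1) = \<beta> 0"
        unfolding chain_lit_def using md none that(2) lit[of l] by auto
      moreover have "lit_val \<beta> (chain_lit K P (Suc (2 * i)) 0) = (\<not> lit_val \<beta> (chain_lit K P (2 * i) 2))"
        "lit_val \<beta> (chain_lit K P (Suc (2 * i)) 2) = \<beta> 0"
        unfolding chain_lit_def by (auto simp: lit_val_def)
      ultimately show ?thesis using that(1) unfolding nae_def by argo
    qed
    have "l \<le> 2 * K \<Longrightarrow> \<not> S l" for l
      by (induction l) (use step in \<open>auto simp: S_def[of 0]\<close>)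
    from this[of "2 * K"] K show False by (simp add: S_def)
  qed
  then show "cnf_sat C K P" unfolding cnf_sat_def by blast
next
  assume "cnf_sat C K P"
  then obtain \<alpha> where \<alpha>: "\<And>c. c < C \<Longrightarrow> \<exists>l<2 * K. P c l \<and> lit_val \<alpha> l"
    unfolding cnf_sat_def by blast
  define S where "S c l \<longleftrightarrow> (\<exists>l'<l. P c l' \<and> lit_val \<alpha> l')" for c l
  \<comment> \<open>The auxiliary variables are true exactly at the first true literal of a clause,
    where the chain changes from false to true.\<close>
  define \<beta> where "\<beta> v = (if v = 0 then False else if v \<le> K then \<alpha> (v - 1)
    else let i = (v - (1 + K)) div 2; c = i div (2 * K); l = i mod (2 * K) in
      if even (v - (1 + K)) then S c l else S c (Suc l) \<and> \<not> S c l)" for v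
  have \<beta>0: "\<beta> 0 = False" by (simp add: \<beta>_def)
  have chain: "\<beta> (chain_var K i) = S (i div (2 * K)) (i mod (2 * K))"
    "\<beta> (Suc (chain_var K i)) = (S (i div (2 * K)) (Suc (i mod (2 * K))) \<and> \<not> S (i div (2 * K)) (i mod (2 * K)))" for i
    by (auto simp: \<beta>_def chain_var_def Let_def)
  have "nae (lit_val \<beta> (chain_lit K P e 0)) (lit_val \<beta> (chain_lit K P e 1)) (lit_val \<beta> (chain_lit K P e 2))"
    if e: "e < 2 * (C * (2 * K))" for e
  proof -
    define i where "i = e div 2"
    define c where "c = i div (2 * K)"
    define l where "l = i mod (2 * K)"
    have c: "c < C" using e K unfolding c_def i_def by (auto simp: less_mult_imp_div_less)
    have l: "l < 2 * K" using K by (simp add: l_def)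
    show ?thesis
    proof (cases "even e")
      case True
      have s0: "lit_val \<beta> (chain_lit K P e 0) = (\<not> S c (Suc l))"
      proof (cases "Suc l = 2 * K")
        case wrap: True
        then have "(i + 1) mod (2 * K) = 0" by (simp add: l_def mod_Suc)
        moreover have "S c (Suc l)" using \<alpha>[OF c] wrap by (simp add: S_def)
        ultimately show ?thesis using True \<beta>0 by (simp add: chain_lit_def i_def)
      next
        case False
        then have "(i + 1) mod (2 * K) = Suc l" "(i + 1) div (2 * K) = c"
          using l by (auto simp: l_def c_def mod_Suc div_Suc)
        then show ?thesis using True chain(1)[of "i + 1"] by (auto simp: chain_lit_def i_def)
      qed
      have s1: "lit_val \<beta> (chain_lit K P e 1) = S c l"
        using True \<beta>0 chain(1)[of i] by (auto simp: chain_lit_def i_def[symmetric] c_def l_def S_def)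
      have "chain_lit K P e 2 = 2 * Suc (chain_var K i)"
        using True by (simp add: chain_lit_def i_def)
      then have "lit_val \<beta> (chain_lit K P e 2) = \<beta> (Suc (chain_var K i))"
        by (simp only: lit_val_even)
      then have "lit_val \<beta> (chain_lit K P e 2) = (S c (Suc l) \<and> \<not> S c l)"
        unfolding chain(2) c_def l_def .
      with s0 s1 show ?thesis by (auto simp: nae_def)
    next
      case False
      have "chain_lit K P e 0 = Suc (2 * Suc (chain_var K i))"
        using False by (simp add: chain_lit_def i_def)
      then have "lit_val \<beta> (chain_lit K P e 0) = (\<not> \<beta> (Suc (chain_var K i)))"
        by (simp only: lit_val_odd)
      then have s0: "lit_val \<beta> (chain_lit K P e 0) = (\<not> (S c (Suc l) \<and> \<not> S c l))"
        unfolding chain(2) c_def l_def .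
      have "lit_val \<beta> (l + 2) = lit_val \<alpha> l"
        using l by (auto simp: lit_val_def \<beta>_def)
      then have "lit_val \<beta> (chain_lit K P e 1) = (P c l \<and> lit_val \<alpha> l)"
        using False \<beta>0 by (simp add: chain_lit_def i_def[symmetric] c_def[symmetric] l_def[symmetric])
      moreover have "S c (Suc l) \<and> \<not> S c l \<Longrightarrow> P c l \<and> lit_val \<alpha> l"
        by (auto simp: S_def less_Suc_eq)
      moreover have "lit_val \<beta> (chain_lit K P e 2) = False"
        using False \<beta>0 by (simp add: chain_lit_def)
      ultimately show ?thesis using s0 by (auto simp: nae_def)
    qed
  qed
  then show "nae_sat (2 * (C * (2 * K))) (chain_lit K P)" unfolding nae_sat_def by blast
qed

theorem reducible_by_cnf:
  fixes C K :: "(nat \<Rightarrow> bool list) \<Rightarrow> nat"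
  assumes C: "upoly (\<lambda>w v. C w)" and K: "upoly (\<lambda>w v. K w)"
    and P: "upred (\<lambda>w v. P w (v 0) (v 1))" and K0: "\<And>w. 0 < K w"
    and L: "\<And>x. x \<in> L \<longleftrightarrow> cnf_sat (C (inputs [x])) (K (inputs [x])) (P (inputs [x]))"
  shows "L \<le>\<^sub>p RC2"
proof (rule reducible_by_nae)
  let ?V = "\<lambda>w. 1 + K w + 2 * (C w * (2 * K w))"
  show "upoly (\<lambda>w v. ?V w)" by (intro upoly_basic C K)
  show "upoly (\<lambda>w v. 2 * (C w * (2 * K w)))" by (intro upoly_basic C K)
  show "upoly (\<lambda>w v. chain_lit (K w) (P w) (v 0) (v 1))"
    unfolding chain_lit_def chain_var_def
    by (intro upoly_basic K upoly_comp2[where F = "\<lambda>w a b. of_bool (P w a b)", OF P])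
  show "x \<in> L \<longleftrightarrow> nae_sat (2 * (C (inputs [x]) * (2 * K (inputs [x]))))
      (chain_lit (K (inputs [x])) (P (inputs [x])))" for x
    unfolding L nae_sat_chain[OF K0] ..
  show "1 \<le> ?V w" for w by simp
  show "chain_lit (K w) (P w) c j < 2 * ?V w" if "c < 2 * (C w * (2 * K w))" "j < 3" for w c j
    using chain_lit_less[OF K0 that] .
qed

section \<open>Tuples as digits\<close>

text \<open>Digit \<open>i\<close> in base \<open>B\<close>. Atoms are quadruples and clauses
  sextuples of numbers below \<open>B\<close>, while \<open>cnf_sat\<close> numbers its variables
  and clauses consecutively; all numbers below \<open>B ^ 4\<close> and \<open>B ^ 6\<close> are
  used.\<close>

definition dig :: "nat \<Rightarrow> nat \<Rightarrow> nat \<Rightarrow> nat" where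
  "dig B i v = v div B ^ i mod B"

lemma dig_less: "0 < B \<Longrightarrow> dig B i v < B"
  by (simp add: dig_def)

lemma digits_exist: "(\<And>i. i < n \<Longrightarrow> f i < B) \<Longrightarrow> \<exists>v<B ^ n. \<forall>i<n. dig B i v = f i"
proof (induction n arbitrary: f)
  case 0
  show ?case by simp
next
  case (Suc n)
  have "\<exists>v<B ^ n. \<forall>i<n. dig B i v = f (Suc i)"
    by (rule Suc.IH) (use Suc.prems in auto)
  then obtain v where v: "v < B ^ n" "\<And>i. i < n \<Longrightarrow> dig B i v = f (Suc i)" by blast
  have f0: "f 0 < B" using Suc.prems by simp
  have "f 0 + B * v < B ^ Suc n"
  proof -
    have "f 0 + B * v < B * Suc v" using f0 by simp
    also have "\<dots> \<le> B * B ^ n" using v(1) by (intro mult_le_mono2) simp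
    finally show ?thesis by simp
  qed
  moreover have "dig B i (f 0 + B * v) = f i" if "i < Suc n" for i
  proof (cases i)
    case 0
    then show ?thesis using f0 by (simp add: dig_def)
  next
    case (Suc k)
    have "(f 0 + B * v) div B ^ Suc k = v div B ^ k"
      using f0 by (simp add: div_mult2_eq)
    then show ?thesis using v(2)[of k] that Suc by (simp add: dig_def)
  qed
  ultimately show ?case by blast
qed

lemma digits4:
  assumes "t < B" "j < B" "p < B" "s < B"
  obtains v where "v < B ^ 4" "dig B 0 v = t" "dig B 1 v = j" "dig B 2 v = p" "dig B 3 v = s"
proof -
  have "[t, j, p, s] ! i < B" if "i < 4" for i
    using that assms by (auto simp: nth_Cons split: nat.splits)
  from digits_exist[of 4 "nth [t, j, p, s]" B, OF this] obtain v where v: "v < B ^ 4" "\<forall>i<4. dig B i v = [t, j, p, s] ! i" by blast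
  show ?thesis
    using that[OF v(1)] v(2)[rule_format, of 0] v(2)[rule_format, of 1] v(2)[rule_format, of 2]
      v(2)[rule_format, of 3] by simp
qed

lemma digits6:
  assumes "k < B" "t < B" "z < B" "j < B" "p < B" "s < B"
  obtains c where "c < B ^ 6" "dig B 0 c = k" "dig B 1 c = t" "dig B 2 c = z" "dig B 3 c = j"
    "dig B 4 c = p" "dig B 5 c = s"
proof -
  have "[k, t, z, j, p, s] ! i < B" if "i < 6" for i
    using that assms by (auto simp: nth_Cons split: nat.splits)
  from digits_exist[of 6 "nth [k, t, z, j, p, s]" B, OF this] obtain c where c: "c < B ^ 6" "\<forall>i<6. dig B i c = [k, t, z, j, p, s] ! i" by blast
  show ?thesis
    using that[OF c(1)] c(2)[rule_format, of 0] c(2)[rule_format, of 1] c(2)[rule_format, of 2]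
      c(2)[rule_format, of 3] c(2)[rule_format, of 4] c(2)[rule_format, of 5] by simp
qed

lemma digits_inject:
  assumes "v < B ^ n" "v' < B ^ n" "\<And>i. i < n \<Longrightarrow> dig B i v = dig B i v'"
  shows "v = v'"
  using assms
proof (induction n arbitrary: v v')
  case (Suc n)
  have "v div B = v' div B"
  proof (rule Suc.IH)
    show "v div B < B ^ n" "v' div B < B ^ n"
      using Suc.prems(1,2) by (auto intro: less_mult_imp_div_less simp: mult.commute)
    show "dig B i (v div B) = dig B i (v' div B)" if "i < n" for i
      using Suc.prems(3)[of "Suc i"] that by (simp add: dig_def div_mult2_eq)
  qed
  moreover have "v mod B = v' mod B" using Suc.prems(3)[of 0] by (simp add: dig_def)
  ultimately show ?case by (metis mult_div_mod_eq)
qed simp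

section \<open>Computations described by clauses\<close>

text \<open>A computation with \<open>J\<close> tracks, where track \<open>j\<close> at time \<open>t\<close> contains the symbol
  \<open>X t j p\<close> at distance \<open>p\<close> from its head. The entries \<open>z < Z\<close> of a transition table determine the
  steps: if each head \<open>j\<close> reads the symbol \<open>a z j\<close>, then it writes \<open>b z j\<close> and moves by
  \<open>d z j - 1\<close>. The atomic formula \<open>F t j p s\<close> states that \<open>X t j (p - 2 * T) = s\<close>. All clauses but
  the choice of the certificate on track 1 are Horn clauses, so any satisfying assignment contains
  the facts about the computation from its certificate.\<close>

locale tableau =
  fixes J Z S out :: nat and a b d :: "nat \<Rightarrow> nat \<Rightarrow> nat"
  assumes a0: "Z \<le> z \<or> J \<le> j \<Longrightarrow> a z j = 0" and b0: "Z \<le> z \<or> J \<le> j \<Longrightarrow> b z j = 0"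
    and d0: "Z \<le> z \<or> J \<le> j \<Longrightarrow> d z j = 0"
    and a_less: "z < Z \<Longrightarrow> j < J \<Longrightarrow> a z j < S" and d2: "d z j \<le> 2"
    and J: "2 \<le> J" and S: "3 \<le> S" and out: "out < J"
begin

text \<open>The clauses of kind \<open>k = 0\<close> describe the initial tracks except track 1. Those of kinds 1 and 2 say
  that track 1 holds a word of length at most \<open>U\<close> followed by blanks, those of kind 3 describe a step.
  Those of kind 4 exclude the result \<open>[False]\<close>, the only one that has the symbol 1 on the track \<open>out\<close>.
  All other numbers \<open>k\<close> give clauses with all literals.\<close>

definition clause_lit :: "bool list \<Rightarrow> nat \<Rightarrow> nat \<Rightarrow> nat \<Rightarrow> nat \<Rightarrow> nat \<Rightarrow> nat \<Rightarrow> nat \<Rightarrow> nat \<Rightarrow>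
    bool \<Rightarrow> nat \<Rightarrow> nat \<Rightarrow> nat \<Rightarrow> nat \<Rightarrow> bool" where
  "clause_lit x T U k t z j p s neg t' j' p' s' =
    (if k = 0 \<and> j < J \<and> j \<noteq> 1 \<and> p \<le> 4 * T then \<not> neg \<and> t' = 0 \<and> j' = j \<and> p' = p \<and>
       s' = (if j = 0 \<and> 2 * T \<le> p then contents x (int (p - 2 * T)) else 0)
     else if k = 1 \<and> p \<le> 4 * T then \<not> neg \<and> t' = 0 \<and> j' = 1 \<and> p' = p \<and>
       (if 2 * T \<le> p \<and> p < 2 * T + U then s' < 3 else s' = 0)
     else if k = 2 \<and> 2 * T \<le> p \<and> p < 4 * T then t' = 0 \<and> j' = 1 \<and> s' = 0 \<and> (if neg then p' = p else p' = p + 1)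
     else if k = 3 \<and> t < T \<and> z < Z \<and> j < J \<and> p \<le> 4 * T \<and> s < S \<and> 1 \<le> p + d z j \<and> p + d z j \<le> 4 * T + 1 then
       if neg then t' = t \<and> (p' = 2 * T \<and> j' < J \<and> s' = a z j' \<or>
         p + d z j \<noteq> 2 * T + 1 \<and> j' = j \<and> p' + 1 = p + d z j \<and> s' = s)
       else t' = t + 1 \<and> j' = j \<and> p' = p \<and> s' = (if p + d z j = 2 * T + 1 then b z j else s)
     else if k = 4 \<and> p \<le> 4 * T then neg \<and> t' = T \<and> j' = out \<and> p' = p \<and> s' = 1
     else True)"

definition clause_true :: "(nat \<Rightarrow> nat \<Rightarrow> nat \<Rightarrow> nat \<Rightarrow> bool) \<Rightarrow> bool list \<Rightarrow> nat \<Rightarrow> nat \<Rightarrow> nat \<Rightarrow>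
    nat \<Rightarrow> nat \<Rightarrow> nat \<Rightarrow> nat \<Rightarrow> nat \<Rightarrow> nat \<Rightarrow> bool" where
  "clause_true F x T U B k t z j p s \<longleftrightarrow> (\<exists>neg. \<exists>t'<B. \<exists>j'<B. \<exists>p'<B. \<exists>s'<B.
     clause_lit x T U k t z j p s neg t' j' p' s' \<and> F t' j' p' s' \<noteq> neg)"

definition tableau_sat :: "bool list \<Rightarrow> nat \<Rightarrow> nat \<Rightarrow> nat \<Rightarrow> bool" where
  "tableau_sat x T U B \<longleftrightarrow> (\<exists>F. \<forall>k<B. \<forall>t<B. \<forall>z<B. \<forall>j<B. \<forall>p<B. \<forall>s<B.
     clause_true F x T U B k t z j p s)"

definition coded_lit :: "bool list \<Rightarrow> nat \<Rightarrow> nat \<Rightarrow> nat \<Rightarrow> nat \<Rightarrow> nat \<Rightarrow> bool" where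
  "coded_lit x T U B c l = clause_lit x T U (dig B 0 c) (dig B 1 c) (dig B 2 c) (dig B 3 c) (dig B 4 c) (dig B 5 c)
    (odd l) (dig B 0 (l div 2)) (dig B 1 (l div 2)) (dig B 2 (l div 2)) (dig B 3 (l div 2))"

lemma cnf_sat_coded:
  assumes B: "0 < B"
  shows "cnf_sat (B ^ 6) (B ^ 4) (coded_lit x T U B) \<longleftrightarrow> tableau_sat x T U B"
proof
  assume "cnf_sat (B ^ 6) (B ^ 4) (coded_lit x T U B)"
  then obtain \<alpha> where \<alpha>: "\<And>c. c < B ^ 6 \<Longrightarrow> \<exists>l<2 * B ^ 4. coded_lit x T U B c l \<and> lit_val \<alpha> l"
    unfolding cnf_sat_def by blast
  \<comment> \<open>The choice inverts the coding of atoms by digits, which is injective below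
    \<open>B ^ 4\<close>.\<close>
  define F where "F t j p s = \<alpha> (SOME v. v < B ^ 4 \<and> dig B 0 v = t \<and> dig B 1 v = j \<and> dig B 2 v = p \<and> dig B 3 v = s)"
    for t j p s
  have F: "F (dig B 0 v) (dig B 1 v) (dig B 2 v) (dig B 3 v) = \<alpha> v" if "v < B ^ 4" for v
  proof -
    have "(SOME v'. v' < B ^ 4 \<and> dig B 0 v' = dig B 0 v \<and> dig B 1 v' = dig B 1 v \<and> dig B 2 v' = dig B 2 v
        \<and> dig B 3 v' = dig B 3 v) = v"
    proof (rule some_equality)
      fix v' assume v': "v' < B ^ 4 \<and> dig B 0 v' = dig B 0 v \<and> dig B 1 v' = dig B 1 v \<and>
        dig B 2 v' = dig B 2 v \<and> dig B 3 v' = dig B 3 v"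
      have "dig B i v' = dig B i v" if "i < 4" for i
      proof -
        have "i = 0 \<or> i = 1 \<or> i = 2 \<or> i = 3" using that by arith
        then show ?thesis using v' by blast
      qed
      then show "v' = v" using v' that digits_inject by blast
    qed (use that in simp)
    then show ?thesis unfolding F_def by simp
  qed
  show "tableau_sat x T U B"
    unfolding tableau_sat_def
  proof (intro exI[of _ F] allI impI)
    fix k t z j p s assume "k < B" "t < B" "z < B" "j < B" "p < B" "s < B"
    then obtain c where c: "c < B ^ 6" "dig B 0 c = k" "dig B 1 c = t" "dig B 2 c = z" "dig B 3 c = j"
      "dig B 4 c = p" "dig B 5 c = s"
      by (rule digits6)
    from \<alpha>[OF c(1)] obtain l where l: "l < 2 * B ^ 4" "coded_lit x T U B c l" "lit_val \<alpha> l" by blast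
    have "l div 2 < B ^ 4" using l(1) by auto
    from F[OF this] l(3) have "F (dig B 0 (l div 2)) (dig B 1 (l div 2)) (dig B 2 (l div 2)) (dig B 3 (l div 2)) \<noteq> odd l"
      by (simp add: lit_val_def)
    moreover have "clause_lit x T U k t z j p s (odd l) (dig B 0 (l div 2)) (dig B 1 (l div 2))
        (dig B 2 (l div 2)) (dig B 3 (l div 2))"
      using l(2) unfolding coded_lit_def c(2-7) .
    ultimately show "clause_true F x T U B k t z j p s"
      unfolding clause_true_def using dig_less[OF B] by blast
  qed
next
  assume "tableau_sat x T U B"
  then obtain F where "\<forall>k<B. \<forall>t<B. \<forall>z<B. \<forall>j<B. \<forall>p<B. \<forall>s<B. clause_true F x T U B k t z j p s"
    unfolding tableau_sat_def by (elim exE)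
  then have F: "clause_true F x T U B k t z j p s"
    if "k < B" "t < B" "z < B" "j < B" "p < B" "s < B" for k t z j p s
    using that by simp
  define \<alpha> where "\<alpha> v = F (dig B 0 v) (dig B 1 v) (dig B 2 v) (dig B 3 v)" for v
  have "\<exists>l<2 * B ^ 4. coded_lit x T U B c l \<and> lit_val \<alpha> l" for c
  proof -
    obtain neg t' j' p' s' where *: "t' < B" "j' < B" "p' < B" "s' < B"
      "clause_lit x T U (dig B 0 c) (dig B 1 c) (dig B 2 c) (dig B 3 c) (dig B 4 c) (dig B 5 c) neg t' j' p' s'"
      "F t' j' p' s' \<noteq> neg"
      using F[OF dig_less[OF B] dig_less[OF B] dig_less[OF B] dig_less[OF B] dig_less[OF B] dig_less[OF B],
          of 0 c 1 c 2 c 3 c 4 c 5 c] unfolding clause_true_def by blast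
    obtain v where v: "v < B ^ 4" "dig B 0 v = t'" "dig B 1 v = j'" "dig B 2 v = p'" "dig B 3 v = s'"
      using *(1-4) by (rule digits4)
    let ?l = "2 * v + of_bool neg"
    have l: "?l div 2 = v" "odd ?l = neg" "?l < 2 * B ^ 4" using v(1) by auto
    have "coded_lit x T U B c ?l" "lit_val \<alpha> ?l"
      using *(5,6) unfolding coded_lit_def lit_val_def \<alpha>_def l(1,2) v(2-5) by simp_all
    then show ?thesis using l(3) by blast
  qed
  then show "cnf_sat (B ^ 6) (B ^ 4) (coded_lit x T U B)" unfolding cnf_sat_def by blast
qed

text \<open>Positions \<open>p\<close> up to \<open>4 * T\<close> are the distances from
  \<open>- 2 * T\<close> to \<open>2 * T\<close>. After \<open>T\<close> steps the contents are
  still forced at distances up to \<open>T\<close>, which is where \<open>rej\<close> places a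
  witness of rejection. The bounds on \<open>B\<close> make all parameters of the clauses available
  as digits.\<close>

lemma tableau_sat_iff:
  assumes U: "U \<le> T" and B: "4 * T + 1 < B" "J \<le> B" "Z \<le> B" "S \<le> B" "5 \<le> B"
    and X0: "\<And>u j q. length u \<le> U \<Longrightarrow> j < J \<Longrightarrow>
      X u 0 j q = (if j = 0 then contents x q else if j = 1 then contents u q else 0)"
    and read: "\<And>u t. length u \<le> U \<Longrightarrow> t < T \<Longrightarrow> \<exists>z<Z. \<forall>j<J. X u t j 0 = a z j"
    and step: "\<And>u t z j q. length u \<le> U \<Longrightarrow> t < T \<Longrightarrow> z < Z \<Longrightarrow> \<forall>j<J. X u t j 0 = a z j \<Longrightarrow> j < J \<Longrightarrow>
      X u (Suc t) j q = (if q + int (d z j) = 1 then b z j else X u t j (q + int (d z j) - 1))"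
    and XS: "\<And>u t j q. length u \<le> U \<Longrightarrow> j < J \<Longrightarrow> X u t j q < S"
    and acc: "\<And>u q. length u \<le> U \<Longrightarrow> R u \<Longrightarrow> X u T out q \<noteq> 1"
    and rej: "\<And>u. length u \<le> U \<Longrightarrow> \<not> R u \<Longrightarrow> \<exists>q. \<bar>q\<bar> \<le> int T \<and> X u T out q = 1"
  shows "tableau_sat x T U B \<longleftrightarrow> (\<exists>u. length u \<le> U \<and> R u)"
proof
  assume "tableau_sat x T U B"
  then obtain F where "\<forall>k<B. \<forall>t<B. \<forall>z<B. \<forall>j<B. \<forall>p<B. \<forall>s<B. clause_true F x T U B k t z j p s"
    unfolding tableau_sat_def by (elim exE)
  then have F: "clause_true F x T U B k t z j p s"
    if "k < B" "t < B" "z < B" "j < B" "p < B" "s < B" for k t z j p s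
    using that by simp
  have K0: "F 0 j p (if j = 0 \<and> 2 * T \<le> p then contents x (int (p - 2 * T)) else 0)"
    if "j < J" "j \<noteq> 1" "p \<le> 4 * T" for j p
    using F[of 0 0 0 j p 0] that B by (auto simp: clause_true_def clause_lit_def)
  have K1: "\<exists>s<3. F 0 1 p s" if "p \<le> 4 * T" "2 * T \<le> p" "p < 2 * T + U" for p
    using F[of 1 0 0 0 p 0] that B by (auto simp: clause_true_def clause_lit_def)
  have K1': "F 0 1 p 0" if "p \<le> 4 * T" "\<not> (2 * T \<le> p \<and> p < 2 * T + U)" for p
    using F[of 1 0 0 0 p 0] that B by (auto simp: clause_true_def clause_lit_def)
  have K2: "F 0 1 (p + 1) 0" if "2 * T \<le> p" "p < 4 * T" "F 0 1 p 0" for p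
    using F[of 2 0 0 0 p 0] that B by (auto simp: clause_true_def clause_lit_def split: if_splits)
  have K3: "F (t + 1) j p (if p + d z j = 2 * T + 1 then b z j else s)"
    if "t < T" "z < Z" "j < J" "p \<le> 4 * T" "s < S" "1 \<le> p + d z j" "p + d z j \<le> 4 * T + 1"
      "\<And>j'. j' < J \<Longrightarrow> F t j' (2 * T) (a z j')"
      "p + d z j \<noteq> 2 * T + 1 \<Longrightarrow> F t j (p + d z j - 1) s" for t z j p s
  proof -
    have lt: "t < B" "z < B" "j < B" "p < B" "s < B" "3 < B" using that B by auto
    obtain neg t' j' p' s' where *: "clause_lit x T U 3 t z j p s neg t' j' p' s'" "F t' j' p' s' \<noteq> neg"
      using F[OF lt(6,1,2,3,4,5)] unfolding clause_true_def by blast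
    show ?thesis
    proof (cases neg)
      case True
      then have "t' = t \<and> (p' = 2 * T \<and> j' < J \<and> s' = a z j' \<or>
         p + d z j \<noteq> 2 * T + 1 \<and> j' = j \<and> p' + 1 = p + d z j \<and> s' = s)"
        using *(1) that(1-7) unfolding clause_lit_def by simp
      then have "F t' j' p' s'" using that(8)[of j'] that(9)
        by (metis add_diff_cancel_right')
      then show ?thesis using *(2) True by simp
    next
      case False
      then have "t' = t + 1 \<and> j' = j \<and> p' = p \<and> s' = (if p + d z j = 2 * T + 1 then b z j else s)"
        using *(1) that(1-7) unfolding clause_lit_def by simp
      then show ?thesis using *(2) False by simp
    qed
  qed
  have K4: "\<not> F T out p 1" if "p \<le> 4 * T" for p
    using F[of 4 0 0 0 p 0] that B by (auto simp: clause_true_def clause_lit_def)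
  \<comment> \<open>The certificate ends at the first cell carrying the blank atom, and the clauses
    of kind 2 spread blanks from there to the right. An assignment may give a cell several symbols;
    a bit is then read as true if the atom for 2 holds.\<close>
  define l where "l = (LEAST l. F 0 1 (2 * T + l) 0)"
  have "F 0 1 (2 * T + U) 0" by (rule K1') (use U in auto)
  then have Fl: "F 0 1 (2 * T + l) 0" and lU: "l \<le> U"
    unfolding l_def by (rule LeastI, rule Least_le)
  define u where "u = map (\<lambda>i. F 0 1 (2 * T + i) 2) [0..<l]"
  have u: "length u \<le> U" using lU by (simp add: u_def)
  have F1: "F 0 1 p (contents u (int p - 2 * int T))" if p: "p \<le> 4 * T" for p
  proof (cases "2 * T \<le> p \<and> p < 2 * T + l")
    case True
    define i where "i = p - 2 * T"
    have i: "p = 2 * T + i" "i < l" using True by (auto simp: i_def)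
    have "\<not> F 0 1 (2 * T + i) 0" using i(2) not_less_Least unfolding l_def by blast
    moreover obtain s where "s < 3" "F 0 1 p s" using K1[OF p] True lU by auto
    ultimately have "F 0 1 p 1 \<or> F 0 1 p 2"
      unfolding i(1) by (auto simp: numeral_eq_Suc less_Suc_eq)
    moreover have "contents u (int p - 2 * int T) = (if F 0 1 p 2 then 2 else 1)"
      using i by (auto simp: contents_def u_def)
    ultimately show ?thesis by auto
  next
    case False
    then have c0: "contents u (int p - 2 * int T) = 0"
      by (auto simp: contents_def u_def)
    show ?thesis
    proof (cases "p < 2 * T")
      case True
      then show ?thesis unfolding c0 using p by (intro K1') auto
    next
      case ge: False
      have "2 * T + l + k \<le> 4 * T \<Longrightarrow> F 0 1 (2 * T + l + k) 0" for k
        by (induction k) (use Fl K2 in auto)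
      from this[of "p - (2 * T + l)"] show ?thesis unfolding c0 using False ge p by auto
    qed
  qed
  \<comment> \<open>A cell at time \<open>t + 1\<close> comes from itself or a neighbor at time
    \<open>t\<close>. So the interval of positions with forced contents, from \<open>t\<close> to
    \<open>4 * T - t\<close>, loses one cell at each end. It always contains \<open>2 * T\<close>,
    where the heads read.\<close>
  have facts: "t \<le> T \<Longrightarrow> j < J \<Longrightarrow> t \<le> p \<Longrightarrow> p + t \<le> 4 * T \<Longrightarrow> F t j p (X u t j (int p - 2 * int T))" for t j p
  proof (induction t arbitrary: j p)
    case 0
    have c0: "contents x (int p - 2 * int T) = 0" if "p < 2 * T" using that by (simp add: contents_def)
    show ?case
    proof (cases "j = 1")
      case True
      then show ?thesis using F1[of p] 0 X0[OF u, of 1] J by simp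
    next
      case False
      then show ?thesis
        using K0[OF 0(2) False, of p] 0 X0[OF u 0(2)] c0 by (auto simp: of_nat_diff split: if_splits)
    qed
  next
    case (Suc t)
    then have t: "t < T" by simp
    obtain z where z: "z < Z" "\<forall>j<J. X u t j 0 = a z j" using read[OF u t] by blast
    have d: "d z j \<le> 2" by (rule d2)
    note st = step[OF u t z Suc.prems(2), of "int p - 2 * int T"]
    let ?q = "int p - 2 * int T + int (d z j) - 1"
    have "F (t + 1) j p (if p + d z j = 2 * T + 1 then b z j else X u t j ?q)"
    proof (rule K3)
      show "F t j' (2 * T) (a z j')" if "j' < J" for j'
        using Suc.IH[of j' "2 * T"] that z(2) t by simp
      show "X u t j ?q < S" by (rule XS[OF u Suc.prems(2)])
      have "int (p + d z j - 1) - 2 * int T = ?q" using Suc.prems by simp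
      moreover have "F t j (p + d z j - 1) (X u t j (int (p + d z j - 1) - 2 * int T))"
        by (rule Suc.IH) (use Suc.prems d in auto)
      ultimately show "F t j (p + d z j - 1) (X u t j ?q)" by (simp only:)
    qed (use Suc.prems d t z in auto)
    moreover have "int p - 2 * int T + int (d z j) = 1 \<longleftrightarrow> p + d z j = 2 * T + 1" by linarith
    ultimately show ?case unfolding st by simp
  qed
  have "R u"
  proof (rule ccontr)
    assume "\<not> R u"
    then obtain q where q: "\<bar>q\<bar> \<le> int T" "X u T out q = 1" using rej[OF u] by blast
    define p where "p = nat (q + 2 * int T)"
    have p: "int p - 2 * int T = q" "T \<le> p" "p + T \<le> 4 * T" using q(1) by (auto simp: p_def)
    from facts[OF order_refl out p(2,3)] have "F T out p 1" unfolding p(1) q(2) .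
    then show False using K4[of p] p by simp
  qed
  then show "\<exists>u. length u \<le> U \<and> R u" using u by blast
next
  assume "\<exists>u. length u \<le> U \<and> R u"
  then obtain u where u: "length u \<le> U" "R u" by blast
  \<comment> \<open>Conversely, the true atoms are the actual facts of the computation with
    certificate \<open>u\<close>; each clause is then verified separately.\<close>
  define F where "F t j p s \<longleftrightarrow> X u t j (int p - 2 * int T) = s" for t j p s
  have lt: "X u t j q < B" if "j < J" for t j q using XS[OF u(1) that, of t q] B by simp
  show "tableau_sat x T U B"
    unfolding tableau_sat_def
  proof (intro exI[of _ F] allI impI)
    fix k t z j p s assume bounds: "k < B" "t < B" "z < B" "j < B" "p < B" "s < B"
    let ?cl = "clause_lit x T U k t z j p s"
    have goal: "clause_true F x T U B k t z j p s"
      if "?cl neg t' j' p' s'" "F t' j' p' s' \<noteq> neg" "t' < B" "j' < B" "p' < B" "s' < B" for neg t' j' p' s'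
      using that unfolding clause_true_def by blast
    consider (k0) "k = 0 \<and> j < J \<and> j \<noteq> 1 \<and> p \<le> 4 * T"
      | (k1) "k = 1 \<and> p \<le> 4 * T"
      | (k2) "k = 2 \<and> 2 * T \<le> p \<and> p < 4 * T"
      | (k3) "k = 3 \<and> t < T \<and> z < Z \<and> j < J \<and> p \<le> 4 * T \<and> s < S \<and> 1 \<le> p + d z j \<and> p + d z j \<le> 4 * T + 1"
      | (k4) "k = 4 \<and> p \<le> 4 * T"
      | (other) "\<not> (k = 0 \<and> j < J \<and> j \<noteq> 1 \<and> p \<le> 4 * T)"
        "\<not> (k = 1 \<and> p \<le> 4 * T)" "\<not> (k = 2 \<and> 2 * T \<le> p \<and> p < 4 * T)"
        "\<not> (k = 3 \<and> t < T \<and> z < Z \<and> j < J \<and> p \<le> 4 * T \<and> s < S \<and> 1 \<le> p + d z j \<and> p + d z j \<le> 4 * T + 1)"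
        "\<not> (k = 4 \<and> p \<le> 4 * T)"
      by argo
    then show "clause_true F x T U B k t z j p s"
    proof cases
      case k0
      have c0: "contents x (int p - 2 * int T) = 0" if "p < 2 * T" using that by (simp add: contents_def)
      have c3: "contents x q < B" for q using B by (simp add: contents_def)
      show ?thesis
        by (rule goal[of False 0 j p "X u 0 j (int p - 2 * int T)"])
          (use k0 bounds lt[of j] c0 c3 in \<open>auto simp: clause_lit_def F_def X0[OF u(1)] of_nat_diff\<close>)
    next
      case k1
      have "contents u (int p - 2 * int T) = 0" if "\<not> (2 * T \<le> p \<and> p < 2 * T + U)"
        using that u(1) by (auto simp: contents_def)
      moreover have "contents u q < 3" "contents u q < B" for q using B by (auto simp: contents_def)
      moreover have "X u 0 1 (int p - 2 * int T) = contents u (int p - 2 * int T)"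
        using X0[OF u(1), of 1] J by simp
      ultimately show ?thesis
        by (intro goal[of False 0 1 p "X u 0 1 (int p - 2 * int T)"])
          (use k1 bounds lt[of 1] J B in \<open>auto simp: clause_lit_def F_def\<close>)
    next
      case k2
      show ?thesis
      proof (cases "contents u (int p - 2 * int T) = 0")
        case True
        then have "contents u (int (p + 1) - 2 * int T) = 0"
          using k2 by (auto simp: contents_def split: if_splits)
        then show ?thesis
          by (intro goal[of False 0 1 "p + 1" 0])
            (use k2 bounds J B X0[OF u(1), of 1] in \<open>auto simp: clause_lit_def F_def\<close>)
      next
        case False
        then show ?thesis
          by (intro goal[of True 0 1 p 0])
            (use k2 bounds J B X0[OF u(1), of 1] in \<open>auto simp: clause_lit_def F_def\<close>)
      qed
    next
      case k3
      show ?thesis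
      proof (cases "\<forall>j'<J. X u t j' 0 = a z j'")
        case False
        then obtain j' where j': "j' < J" "X u t j' 0 \<noteq> a z j'" by blast
        show ?thesis
          by (rule goal[of True t j' "2 * T" "a z j'"])
            (use k3 bounds B j' a_less[of z j'] in \<open>auto simp: clause_lit_def F_def\<close>)
      next
        case True
        note st = step[OF u(1) _ _ True, of j "int p - 2 * int T"]
        have eq: "int p - 2 * int T + int (d z j) = 1 \<longleftrightarrow> p + d z j = 2 * T + 1" by linarith
        have q: "int (p + d z j - 1) - 2 * int T = int p - 2 * int T + int (d z j) - 1" using k3 by simp
        show ?thesis
        proof (cases "p + d z j = 2 * T + 1 \<or> X u t j (int p - 2 * int T + int (d z j) - 1) = s")
          case True
          then have "X u (Suc t) j (int p - 2 * int T) = (if p + d z j = 2 * T + 1 then b z j else s)"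
            using st k3 eq by auto
          then show ?thesis
            using lt[of j "Suc t" "int p - 2 * int T"]
            by (intro goal[of False "t + 1" j p "X u (Suc t) j (int p - 2 * int T)"])
              (use k3 bounds B in \<open>auto simp: clause_lit_def F_def\<close>)
        next
          case False
          then have "\<not> F t j (p + d z j - 1) s" unfolding F_def q by simp
          then show ?thesis
            by (intro goal[of True t j "p + d z j - 1" s])
              (use k3 bounds B False in \<open>auto simp: clause_lit_def\<close>)
        qed
      qed
    next
      case k4
      show ?thesis
        by (rule goal[of True T out p 1])
          (use k4 bounds B out acc[OF u] in \<open>auto simp: clause_lit_def F_def\<close>)
    next
      case other
      have "?cl neg t' j' p' s'" for neg t' j' p' s'
        unfolding clause_lit_def if_not_P[OF other(1)] if_not_P[OF other(2)] if_not_P[OF other(3)]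
          if_not_P[OF other(4)] if_not_P[OF other(5)] by (rule TrueI)
      \<comment> \<open>A clause with all literals is satisfied by any atom, taken with the sign
        that fits its value.\<close>
      then show ?thesis
        by (rule goal[of "\<not> F 0 0 0 0" 0 0 0 0]) (use B in auto)
    qed
  qed
qed

text \<open>A table that vanishes outside a finite range is a finite case distinction; this is why
  the locale fixes the values beyond \<open>Z\<close> and \<open>J\<close>.\<close>

lemma upoly_table:
  assumes "\<And>z j. Z \<le> z \<or> J \<le> j \<Longrightarrow> f z j = 0" "upoly g" "upoly h"
  shows "upoly (\<lambda>w v. f (g w v) (h w v))"
proof -
  have "upoly (\<lambda>w v. if g w v < Z then if h w v < J then f (g w v) (h w v) else 0 else 0)"
    by (rule upoly_cases[where f = "\<lambda>z w v. if h w v < J then f z (h w v) else 0"])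
      (intro upoly_cases[where f = "\<lambda>j w v. f _ j"] upoly_const assms(2,3))+
  moreover have "(if z < Z then if j < J then f z j else 0 else 0) = f z j" for z j
    using assms(1)[of z j] by auto
  ultimately show ?thesis by simp
qed

lemma upoly_dig:
  assumes "upoly f" "upoly g"
  shows "upoly (\<lambda>w v. dig (f w v) i (g w v))"
proof -
  have "upoly (\<lambda>w v. f w v ^ i)"
    by (induction i) (auto intro: upoly_const upoly_mult assms(1))
  then show ?thesis unfolding dig_def by (intro upoly_basic assms)
qed

lemma upred_coded_lit:
  assumes T: "upoly (\<lambda>w v. T w)" and U: "upoly (\<lambda>w v. U w)" and B: "upoly (\<lambda>w v. B w)"
  shows "upred (\<lambda>w v. coded_lit (w 0) (T w) (U w) (B w) (v 0) (v 1))"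
  unfolding coded_lit_def clause_lit_def
  by (intro upoly_basic upoly_dig T U B upoly_table[where f = a, OF a0] upoly_table[where f = b, OF b0]
      upoly_table[where f = d, OF d0])

theorem reducible_by_tableau:
  fixes T U :: "(nat \<Rightarrow> bool list) \<Rightarrow> nat"
  assumes T: "upoly (\<lambda>w v. T w)" and U: "upoly (\<lambda>w v. U w)"
    and L: "\<And>x B. 4 * T (inputs [x]) + 1 < B \<Longrightarrow> J \<le> B \<Longrightarrow> Z \<le> B \<Longrightarrow> S \<le> B \<Longrightarrow> 5 \<le> B \<Longrightarrow>
      x \<in> L \<longleftrightarrow> tableau_sat x (T (inputs [x])) (U (inputs [x])) B"
  shows "L \<le>\<^sub>p RC2"
proof (rule reducible_by_cnf)
  define B where "B w = 4 * T w + J + Z + S + 5" for w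
  have B: "upoly (\<lambda>w v. B w)" unfolding B_def by (intro upoly_basic T)
  have power: "upoly (\<lambda>w v. B w ^ n)" for n
    by (induction n) (auto intro: upoly_const upoly_mult B)
  show "upoly (\<lambda>w v. B w ^ 6)" "upoly (\<lambda>w v. B w ^ 4)" by (rule power)+
  show "upred (\<lambda>w v. coded_lit (w 0) (T w) (U w) (B w) (v 0) (v 1))"
    by (rule upred_coded_lit[OF T U B])
  show "0 < B w ^ 4" for w by (simp add: B_def)
  show "x \<in> L \<longleftrightarrow> cnf_sat (B (inputs [x]) ^ 6) (B (inputs [x]) ^ 4)
      (coded_lit (inputs [x] 0) (T (inputs [x])) (U (inputs [x])) (B (inputs [x])))" for x
  proof -
    have "0 < B (inputs [x])" "inputs [x] 0 = x" by (auto simp: B_def inputs_def)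
    then show ?thesis
      using cnf_sat_coded L[of x "B (inputs [x])"] by (simp add: B_def)
  qed
qed

end

section \<open>Turing machines as tableaux\<close>

definition proper_config :: "tm \<Rightarrow> config \<Rightarrow> bool" where
  "proper_config M c \<longleftrightarrow> fst c \<le> states M \<and> length (snd c) = tapes M \<and>
    (\<forall>j<tapes M. \<forall>i. fst (snd c ! j) i < symbols M)"

text \<open>Halting is turned into a step that does not change anything.\<close>

definition trans_total :: "tm \<Rightarrow> nat \<Rightarrow> nat list \<Rightarrow> nat \<times> (nat \<times> dir) list" where
  "trans_total M q as = (if q = states M then (q, map (\<lambda>s. (s, Stay)) as) else delta M q as)"

lemma step_trans_total:
  assumes "length (snd c) = tapes M"
  shows "step M c = (let r = trans_total M (fst c) (map read (snd c)) in (fst r, map2 act (snd r) (snd c)))"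
proof (cases "fst c = states M")
  case True
  have "map2 act (map (\<lambda>s. (s, Stay)) (map read tps)) tps = tps" for tps
    by (induction tps) (auto simp: act_keep)
  then show ?thesis using True by (cases c) (simp add: step_def trans_total_def Let_def)
qed (simp add: step_def trans_total_def)

lemma trans_total_proper:
  assumes "turing_machine M" "q \<le> states M" "length as = tapes M" "set as \<subseteq> {..<symbols M}"
  shows "fst (trans_total M q as) \<le> states M" "length (snd (trans_total M q as)) = tapes M"
    "\<And>j. j < tapes M \<Longrightarrow> fst (snd (trans_total M q as) ! j) < symbols M"
proof -
  have "fst (trans_total M q as) \<le> states M \<and> length (snd (trans_total M q as)) = tapes M \<and>
      fst ` set (snd (trans_total M q as)) \<subseteq> {..<symbols M}"
  proof (cases "q = states M")
    case True
    then show ?thesis using assms by (auto simp: trans_total_def)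
  next
    case False
    then show ?thesis using assms by (simp add: trans_total_def turing_machine_def)
  qed
  then show "fst (trans_total M q as) \<le> states M" "length (snd (trans_total M q as)) = tapes M"
    "\<And>j. j < tapes M \<Longrightarrow> fst (snd (trans_total M q as) ! j) < symbols M"
    by (auto simp: image_subset_iff)
qed

lemma proper_config_read:
  "proper_config M c \<Longrightarrow> set (map read (snd c)) \<subseteq> {..<symbols M}"
  by (fastforce simp: proper_config_def read_def set_conv_nth)

lemma step_nth:
  assumes "turing_machine M" "proper_config M c" "j < tapes M"
  shows "snd (step M c) ! j = act (snd (trans_total M (fst c) (map read (snd c))) ! j) (snd c ! j)"
proof -
  have "length (snd (trans_total M (fst c) (map read (snd c)))) = tapes M"
    using assms proper_config_read by (intro trans_total_proper(2)) (auto simp: proper_config_def)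
  then show ?thesis
    using assms(2,3) by (simp add: step_trans_total proper_config_def Let_def)
qed

lemma proper_config_step:
  assumes M: "turing_machine M" and c: "proper_config M c"
  shows "proper_config M (step M c)"
proof -
  let ?r = "trans_total M (fst c) (map read (snd c))"
  have r: "fst ?r \<le> states M" "length (snd ?r) = tapes M" "\<And>j. j < tapes M \<Longrightarrow> fst (snd ?r ! j) < symbols M"
    using trans_total_proper[OF M, of "fst c" "map read (snd c)"] c proper_config_read[OF c]
    by (auto simp: proper_config_def)
  have "fst (snd (step M c) ! j) i < symbols M" if "j < tapes M" for i j
    unfolding step_nth[OF M c that] using r(3)[OF that] c that by (auto simp: act_def proper_config_def)
  moreover have "fst (step M c) = fst ?r" "length (snd (step M c)) = tapes M"
    using c r(2) by (auto simp: step_trans_total proper_config_def Let_def)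
  ultimately show ?thesis using r(1) by (simp add: proper_config_def)
qed

lemma proper_config_funpow:
  assumes M: "turing_machine M"
  shows "proper_config M ((step M ^^ t) (initial M ws))"
proof (induction t)
  case 0
  have "contents w i < 3" for w i by (simp add: contents_def)
  then have "contents w i < symbols M" for w i
    using M unfolding turing_machine_def by (meson less_le_trans)
  then show ?case by (auto simp: proper_config_def initial_def)
qed (use M proper_config_step in simp)

text \<open>A machine may halt with its output head anywhere. As the head has moved at most once per
  step, cell 0 with the result is still within distance \<open>t\<close> of it.\<close>

lemma head_bound:
  assumes M: "turing_machine M" and j: "j < tapes M"
  shows "\<bar>snd (snd ((step M ^^ t) (initial M ws)) ! j)\<bar> \<le> int t"
proof (induction t)
  case 0
  show ?case using j by (simp add: initial_def)
next
  case (Suc t)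
  have "\<bar>offset e\<bar> \<le> 1" for e by (cases e) auto
  then have "\<bar>snd (act e tp)\<bar> \<le> \<bar>snd tp\<bar> + 1" for e tp
    unfolding act_def snd_conv by (meson abs_triangle_ineq add_left_mono order_trans)
  then have "\<bar>snd (snd ((step M ^^ Suc t) (initial M ws)) ! j)\<bar>
      \<le> \<bar>snd (snd ((step M ^^ t) (initial M ws)) ! j)\<bar> + 1"
    unfolding funpow.simps comp_def step_nth[OF M proper_config_funpow[OF M] j] .
  then show ?case using Suc by simp
qed

text \<open>Track \<open>tapes M\<close> is the tape for the state: it holds the state at distance 0
  and 0 elsewhere. Reading it together with the other heads selects the transition.\<close>

definition track :: "tm \<Rightarrow> config \<Rightarrow> nat \<Rightarrow> int \<Rightarrow> nat" where
  "track M c j q = (if j < tapes M then fst (snd c ! j) (snd (snd c ! j) + q)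
    else if q = 0 then fst c else 0)"

lemma poly_nat_mono: "m \<le> n \<Longrightarrow> poly p m \<le> poly p (n :: nat)"
  by (induction p) (auto intro: mult_le_mono)

theorem RC2_NP_hard: "NP_hard RC2"
  unfolding NP_hard_def
proof
  fix L assume "L \<in> NP"
  then obtain R and qu :: "nat poly" where R: "polytime_relation R"
    and L: "\<And>x. x \<in> L \<longleftrightarrow> (\<exists>u. length u \<le> poly qu (length x) \<and> R x u)"
    unfolding NP_def by blast
  obtain M and qt :: "nat poly" where M: "turing_machine M"
    and comp: "\<And>ws. length ws = 2 \<Longrightarrow>
      computes_within M ws [R (ws ! 0) (ws ! 1)] (poly qt (sum_list (map length ws)))"
    using R unfolding polytime_relation_def polytime_def by blast
  define n where "n = tapes M"
  have n: "2 < n" using comp[of "[[], []]"] by (simp add: computes_within_def n_def)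
  \<comment> \<open>Each combination of a state, including the halting state, with the symbols read
    is an entry of the transition table; the number of an entry is its index in
    \<open>es\<close>.\<close>
  define A where "A = {(q, as). q \<le> states M \<and> length as = n \<and> set as \<subseteq> {..<symbols M}}"
  have "A = {..states M} \<times> {as. set as \<subseteq> {..<symbols M} \<and> length as = n}" by (auto simp: A_def)
  then have "finite A" by (simp add: finite_lists_length_eq)
  then obtain es where es: "set es = A" using finite_list by blast
  define Z where "Z = length es"
  have inA: "es ! z \<in> A" if "z < Z" for z using that es by (auto simp: Z_def)
  define r where "r z = trans_total M (fst (es ! z)) (snd (es ! z))" for z
  define a where "a z j = (if z < Z \<and> j < n + 1 then if j < n then snd (es ! z) ! j else fst (es ! z) else 0)" for z j
  define b where "b z j = (if z < Z \<and> j < n + 1 then if j < n then fst (snd (r z) ! j) else fst (r z) else 0)" for z j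
  \<comment> \<open>Moves are shifted by 1 to be natural numbers, so the value 1 for the track of
    the state means that it never moves.\<close>
  define d where "d z j = (if z < Z \<and> j < n + 1 then if j < n then nat (offset (snd (snd (r z) ! j)) + 1) else 1 else 0)"
    for z j
  \<comment> \<open>Symbols and states share the tracks, and \<open>states M\<close> itself occurs
    as a state.\<close>
  define S where "S = symbols M + states M + 1"
  have sym3: "3 \<le> symbols M" using M by (simp add: turing_machine_def)
  have off: "offset e + 1 \<ge> 0" "offset e + 1 \<le> 2" for e by (cases e; simp)+
  interpret tableau "n + 1" Z S "n - 1" a b d
  proof
    show "a z j < S" if "z < Z" "j < n + 1" for z j
    proof -
      obtain q as where e: "es ! z = (q, as)" "q \<le> states M" "length as = n" "set as \<subseteq> {..<symbols M}"
        using inA[OF \<open>z < Z\<close>] by (auto simp: A_def)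
      have "as ! j < symbols M" if "j < n" using e(3,4) that by (metis lessThan_iff nth_mem subsetD)
      then show ?thesis using that e(1,2) by (auto simp: a_def S_def trans_less_add1)
    qed
    show "d z j \<le> 2" for z j
      using off(2)[of "snd (snd (r z) ! j)"] by (auto simp: d_def)
  qed (use n sym3 in \<open>auto simp: a_def b_def d_def S_def\<close>)
  define U where "U w = poly qu (length (w 0))" for w :: "nat \<Rightarrow> bool list"
  \<comment> \<open>The first summand bounds the running time for all certificates up to length
    \<open>U w\<close>; the second makes \<open>T w\<close> at least \<open>U w\<close>, as
    \<open>tableau_sat_iff\<close> demands for the certificate to lie in the window.\<close>
  define T where "T w = poly qt (length (w 0) + U w) + U w" for w
  show "L \<le>\<^sub>p RC2"
  proof (rule reducible_by_tableau[where T = T and U = U])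
    show U: "upoly (\<lambda>w v. U w)" unfolding U_def by (intro upoly_basic)
    show "upoly (\<lambda>w v. T w)" unfolding T_def by (intro upoly_basic U)
    fix x B
    let ?T = "T (inputs [x])" and ?U = "U (inputs [x])"
    assume B: "4 * ?T + 1 < B" "n + 1 \<le> B" "Z \<le> B" "S \<le> B" "5 \<le> B"
    define cf where "cf u t = (step M ^^ t) (initial M [x, u])" for u t
    define X where "X u t = track M (cf u t)" for u t
    have proper: "proper_config M (cf u t)" for u t
      unfolding cf_def by (rule proper_config_funpow[OF M])
    have reads: "es ! z = (fst (cf u t), map read (snd (cf u t)))"
      if z: "z < Z" and eq: "\<forall>j<n + 1. X u t j 0 = a z j" for u t z
    proof -
      obtain q as where e: "es ! z = (q, as)" "length as = n" using inA[OF z] by (auto simp: A_def)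
      have "as = map read (snd (cf u t))"
      proof (rule nth_equalityI)
        show "length as = length (map read (snd (cf u t)))"
          using proper[of u t] e(2) by (simp add: proper_config_def n_def)
        fix j assume "j < length as"
        then have "j < n" using e(2) by simp
        moreover have "X u t j 0 = a z j" using eq \<open>j < n\<close> by simp
        ultimately show "as ! j = map read (snd (cf u t)) ! j"
          using proper[of u t] z e(1) by (simp add: X_def track_def a_def n_def read_def proper_config_def)
      qed
      moreover have "X u t n 0 = a z n" using eq by simp
      then have "fst (cf u t) = q" using z e(1) by (simp add: X_def track_def a_def n_def)
      ultimately show ?thesis using e(1) by simp
    qed
    have "tableau_sat x ?T ?U B \<longleftrightarrow> (\<exists>u. length u \<le> ?U \<and> R x u)"
    proof (rule tableau_sat_iff[where X = X])
      show "?U \<le> ?T" by (simp add: T_def)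
      show "4 * ?T + 1 < B" "n + 1 \<le> B" "Z \<le> B" "S \<le> B" "5 \<le> B" using B .
      show "X u 0 j q = (if j = 0 then contents x q else if j = 1 then contents u q else 0)" if "j < n + 1" for u j q
      proof -
        have "contents [] q = 0" by (simp add: contents_def)
        then show ?thesis using that n
          by (auto simp: X_def track_def cf_def initial_def n_def nth_Cons' less_Suc_eq)
      qed
      show "\<exists>z<Z. \<forall>j<n + 1. X u t j 0 = a z j" for u t
      proof -
        have "(fst (cf u t), map read (snd (cf u t))) \<in> A"
          using proper[of u t] proper_config_read[OF proper, of u t] by (simp add: A_def proper_config_def n_def)
        then obtain z where z: "z < Z" "es ! z = (fst (cf u t), map read (snd (cf u t)))"
          unfolding es[symmetric] in_set_conv_nth Z_def by blast
        have "X u t j 0 = a z j" if "j < n + 1" for j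
          using that z proper[of u t] by (auto simp: X_def track_def a_def n_def read_def proper_config_def)
        then show ?thesis using z(1) by blast
      qed
      \<comment> \<open>After the move, the cell at distance \<open>q\<close> is the one that was at
        distance \<open>q + d z j - 1\<close>, and the cell just written is the one where this is
        0.\<close>
      show "X u (Suc t) j q = (if q + int (d z j) = 1 then b z j else X u t j (q + int (d z j) - 1))"
        if z: "z < Z" and eq: "\<forall>j<n + 1. X u t j 0 = a z j" and j: "j < n + 1" for u t z j q
      proof -
        have rz: "r z = trans_total M (fst (cf u t)) (map read (snd (cf u t)))"
          unfolding r_def reads[OF z eq] by simp
        have cfS: "cf u (Suc t) = step M (cf u t)" by (simp add: cf_def)
        show ?thesis
        proof (cases "j < n")
          case True
          have "snd (cf u (Suc t)) ! j = act (snd (r z) ! j) (snd (cf u t) ! j)"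
            unfolding cfS rz using step_nth[OF M proper] True by (simp add: n_def)
          moreover have "int (d z j) = offset (snd (snd (r z) ! j)) + 1"
            using True z off(1) by (simp add: d_def)
          ultimately show ?thesis
            using True z by (auto simp: X_def track_def n_def[symmetric] act_def b_def algebra_simps)
        next
          case False
          then have "j = n" using j by simp
          moreover have "fst (cf u (Suc t)) = fst (r z)"
            using proper[of u t] unfolding cfS rz by (simp add: step_trans_total proper_config_def Let_def)
          ultimately show ?thesis
            using z by (auto simp: X_def track_def n_def[symmetric] b_def d_def)
        qed
      qed
      show "X u t j q < S" for u t j q
        using proper[of u t] by (auto simp: X_def track_def proper_config_def S_def intro: less_SucI trans_less_add1)
      \<comment> \<open>The machine may halt before time \<open>?T\<close>, depending on the
        certificate. A halting configuration is repeated by \<open>step\<close>, so the result is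
        still there at the common time.\<close>
      have final: "snd (cf u ?T) ! (n - 1) = last (snd (cf u ?T)) \<and>
          fst (last (snd (cf u ?T))) = contents [R x u]" if u: "length u \<le> ?U" for u
      proof -
        obtain t tps where t: "t \<le> poly qt (length x + length u)" "cf u t = (states M, tps)"
          "fst (last tps) = contents [R x u]"
          using comp[of "[x, u]"] by (auto simp: computes_within_def cf_def)
        have "t \<le> ?T"
          using t(1) poly_nat_mono[of "length x + length u" "length x + ?U" qt] u
          by (simp add: T_def inputs_def)
        moreover have "(step M ^^ k) (states M, tps) = (states M, tps)" for k
          by (induction k) (auto simp: step_def)
        moreover have "cf u (k + t) = (step M ^^ k) (cf u t)" for k
          by (simp add: cf_def funpow_add)
        from this[of "?T - t"] \<open>t \<le> ?T\<close> have "cf u ?T = (step M ^^ (?T - t)) (cf u t)" by simp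
        ultimately have "cf u ?T = (states M, tps)" unfolding t(2) by simp
        moreover have "length tps = n" using proper[of u t] t(2) by (simp add: proper_config_def n_def)
        moreover from this n have "last tps = tps ! (n - 1)" by (subst last_conv_nth) auto
        ultimately show ?thesis using t(3) by simp
      qed
      show "X u ?T (n - 1) q \<noteq> 1" if "length u \<le> ?U" "R x u" for u q
        using final[OF that(1)] that(2) n by (auto simp: X_def track_def n_def[symmetric] contents_def)
      show "\<exists>q. \<bar>q\<bar> \<le> int ?T \<and> X u ?T (n - 1) q = 1" if "length u \<le> ?U" "\<not> R x u" for u
      proof (intro exI conjI)
        \<comment> \<open>Seen from the head, cell 0 is at distance \<open>- ?h\<close>; for the
          result \<open>[False]\<close> it contains the symbol 1.\<close>
        let ?h = "snd (snd (cf u ?T) ! (n - 1))"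
        show "\<bar>- ?h\<bar> \<le> int ?T"
          using head_bound[OF M, of "n - 1"] n unfolding cf_def n_def by simp
        show "X u ?T (n - 1) (- ?h) = 1"
          using final[OF that(1)] that(2) n by (auto simp: X_def track_def n_def[symmetric] contents_def)
      qed
    qed
    then show "x \<in> L \<longleftrightarrow> tableau_sat x ?T ?U B"
      unfolding L by (simp add: U_def inputs_def)
  qed
qed

theorem theorem4:
  shows "NP_complete (encode ` {(G, H, k, m) \<in> Robust_Coloring. k = 2})"
  unfolding NP_complete_def using RC2_in_NP RC2_NP_hard by blast

end
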